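(* Suppose there is an algorithm that solves the next-to-shortest path problem on every $(s,t)$-layered graph $G_L$ in time $O\big(|V_B(G_L)|^2\,|E_{FP}(G_L)|\,(|E(G_L)|+|V(G_L)|\log|V(G_L)|)\big)$. Then there is an algorithm that solves the next-to-shortest path problem on every directed graph $G=(V,E,w)$ with positive edge weights in time $O(|V|^4|E|^3\log|V|)$.
   Context: Graphs are finite simple directed graphs $G=(V,E,w)$ with $w:E\to\mathbb{R}_{>0}$, with two given vertices $s,t$. Paths have no repeated vertices; $w(P)$ is the total weight; $d_G(u,v)$ is the shortest-path distance ($\infty$ if no path). An $s\to t$ path $P$ is not-shortest if $w(P)>d_G(s,t)$; it is a next-to-shortest path if it is not-shortest and of minimum length among not-shortest $s\to t$ paths. The next-to-shortest path problem: given $G,s,t$, output an $s\to t$ next-to-shortest path, or report that none exists. An edge $(u,v)$ is a back-edge if $d_G(s,u)+w(u,v)>d_G(s,v)$ and a forward-edge if $d_G(s,u)+w(u,v)=d_G(s,v)$. $V_B(G)$ is the set of vertices incident to at least one back-edge; $E_{FP}(G)$ is the set of ordered pairs $((u_1,v_1),(u_2,v_2))$ of forward-edges with $d_G(s,u_1)=d_G(s,u_2)$. $G$ is $(s,t)$-layered if (1) for every $u\in V$, $d_G(s,u)+d_G(u,t)=d_G(s,t)$ (all finite); (2) for every edge $(u,v)$, $d_G(s,u)\neq d_G(s,v)$; (3) for every edge $(u,v)$ with $d_G(s,u)<d_G(s,v)$ and every $x\in V$, either $d_G(s,x)\le d_G(s,u)$ or $d_G(s,x)\ge d_G(s,u)+w(u,v)$.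 *)

theory Defs
  imports "Graph_Theory.Graph_Theory" "HOL-Library.Extended_Real" Complex_Main
begin

section \<open>Weighted digraphs and next-to-shortest paths\<close>

text \<open>
  Finite simple directed graphs are the library's pair digraphs (finite, loop-free, arcs are
  pairs of vertices). The distance \<open>\<mu>\<close> is the infimum of the costs of all walks; as weights are
  positive and the graph is finite, it is attained by a path whenever one exists.
\<close>

locale st_digraph = pair_digraph G
  for G :: "'a pair_pre_digraph" +
  fixes w :: "('a \<times> 'a) weight_fun" and s t :: 'a
  assumes weight_pos: "e \<in> parcs G \<Longrightarrow> 0 < w e"
    and source_in_verts: "s \<in> pverts G"
    and target_in_verts: "t \<in> pverts G"
begin

abbreviation dist_G :: "'a \<Rightarrow> 'a \<Rightarrow> ereal" where
  "dist_G \<equiv> \<mu> w"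

definition not_shortest :: "('a \<times> 'a) awalk \<Rightarrow> bool" where
  "not_shortest p \<longleftrightarrow> apath s p t \<and> ereal (awalk_cost w p) > dist_G s t"

definition next_to_shortest :: "('a \<times> 'a) awalk \<Rightarrow> bool" where
  "next_to_shortest p \<longleftrightarrow>
     not_shortest p \<and> (\<forall>q. not_shortest q \<longrightarrow> awalk_cost w p \<le> awalk_cost w q)"

definition back_edges :: "('a \<times> 'a) set" where
  "back_edges = {(u, v) \<in> parcs G. dist_G s u + ereal (w (u, v)) > dist_G s v}"

definition forward_edges :: "('a \<times> 'a) set" where
  "forward_edges = {(u, v) \<in> parcs G. dist_G s u + ereal (w (u, v)) = dist_G s v}"

definition V_B :: "'a set" where
  "V_B = {x \<in> pverts G. \<exists>(u, v) \<in> back_edges. x = u \<or> x = v}"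

definition E_FP :: "(('a \<times> 'a) \<times> ('a \<times> 'a)) set" where
  "E_FP = {((u1, v1), (u2, v2)).
     (u1, v1) \<in> forward_edges \<and> (u2, v2) \<in> forward_edges \<and> dist_G s u1 = dist_G s u2}"

definition layered :: bool where
  "layered \<longleftrightarrow>
     (\<forall>u \<in> pverts G. dist_G s u < \<infinity> \<and> dist_G u t < \<infinity> \<and>
        dist_G s u + dist_G u t = dist_G s t) \<and>
     (\<forall>(u, v) \<in> parcs G. dist_G s u \<noteq> dist_G s v) \<and>
     (\<forall>(u, v) \<in> parcs G. dist_G s u < dist_G s v \<longrightarrow>
        (\<forall>x \<in> pverts G. dist_G s x \<le> dist_G s u \<or>
           dist_G s x \<ge> dist_G s u + ereal (w (u, v))))"

end


section \<open>The machine model\<close>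

text \<open>
  Algorithms are programs of a random-access machine over the naturals and the reals, written in
  a structured language. The memory consists of arrays of unbounded length, numbered by
  naturals, of natural numbers and of real numbers; a program can only mention finitely many
  arrays. Indices are computed, so addressing is indirect.

  Real numbers are only added, subtracted and compared; in particular there are no real
  constants besides 0 and no conversions between the two sorts of numbers. Naturals are added,
  subtracted (truncating at 0) and compared, but not multiplied, so that charging
  one unit per operation does not give the machine unrealistic power.
\<close>

record state =
  nmem :: "nat \<Rightarrow> nat \<Rightarrow> nat"
  rmem :: "nat \<Rightarrow> nat \<Rightarrow> real"

datatype nexp =
    NConst nat
  | NRead nat nexp
  | NAdd nexp nexp
  | NSub nexp nexp

datatype rexp =
    RZero
  | RRead nat nexp
  | RAdd rexp rexp
  | RSub rexp rexp

datatype bexp =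
    NLess nexp nexp
  | RLess rexp rexp
  | Not bexp
  | And bexp bexp

datatype com =
    Skip
  | NWrite nat nexp nexp  \<comment> \<open>array, index, value\<close>
  | RWrite nat nexp rexp  \<comment> \<open>array, index, value\<close>
  | Seq com com
  | If bexp com com
  | While bexp com

primrec nval :: "nexp \<Rightarrow> state \<Rightarrow> nat" where
  "nval (NConst k) \<sigma> = k"
| "nval (NRead a i) \<sigma> = nmem \<sigma> a (nval i \<sigma>)"
| "nval (NAdd x y) \<sigma> = nval x \<sigma> + nval y \<sigma>"
| "nval (NSub x y) \<sigma> = nval x \<sigma> - nval y \<sigma>"

primrec rval :: "rexp \<Rightarrow> state \<Rightarrow> real" where
  "rval RZero \<sigma> = 0"
| "rval (RRead a i) \<sigma> = rmem \<sigma> a (nval i \<sigma>)"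
| "rval (RAdd x y) \<sigma> = rval x \<sigma> + rval y \<sigma>"
| "rval (RSub x y) \<sigma> = rval x \<sigma> - rval y \<sigma>"

primrec bval :: "bexp \<Rightarrow> state \<Rightarrow> bool" where
  "bval (NLess x y) \<sigma> \<longleftrightarrow> nval x \<sigma> < nval y \<sigma>"
| "bval (RLess x y) \<sigma> \<longleftrightarrow> rval x \<sigma> < rval y \<sigma>"
| "bval (Not b) \<sigma> \<longleftrightarrow> \<not> bval b \<sigma>"
| "bval (And b c) \<sigma> \<longleftrightarrow> bval b \<sigma> \<and> bval c \<sigma>"

definition nwrite :: "nat \<Rightarrow> nat \<Rightarrow> nat \<Rightarrow> state \<Rightarrow> state" where
  "nwrite a i x \<sigma> = \<sigma>\<lparr>nmem := (nmem \<sigma>)(a := (nmem \<sigma> a)(i := x))\<rparr>"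

definition rwrite :: "nat \<Rightarrow> nat \<Rightarrow> real \<Rightarrow> state \<Rightarrow> state" where
  "rwrite a i x \<sigma> = \<sigma>\<lparr>rmem := (rmem \<sigma>)(a := (rmem \<sigma> a)(i := x))\<rparr>"

text \<open>
  \<open>exec c \<sigma> k \<sigma>'\<close>: started in \<open>\<sigma>\<close>, the program \<open>c\<close> terminates in \<open>\<sigma>'\<close> after exactly \<open>k\<close> steps.
  Every write and every test counts as one step. The expressions in a program have
  constant size, so counting each operation separately would change \<open>k\<close> by at most a
  constant factor depending on \<open>c\<close>.
\<close>

inductive exec :: "com \<Rightarrow> state \<Rightarrow> nat \<Rightarrow> state \<Rightarrow> bool" where
  exec_Skip: "exec Skip \<sigma> 1 \<sigma>"
| exec_NWrite: "exec (NWrite a i x) \<sigma> 1 (nwrite a (nval i \<sigma>) (nval x \<sigma>) \<sigma>)"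
| exec_RWrite: "exec (RWrite a i x) \<sigma> 1 (rwrite a (nval i \<sigma>) (rval x \<sigma>) \<sigma>)"
| exec_Seq: "exec c \<sigma> k \<sigma>' \<Longrightarrow> exec d \<sigma>' l \<sigma>'' \<Longrightarrow> exec (Seq c d) \<sigma> (k + l) \<sigma>''"
| exec_IfTrue: "bval b \<sigma> \<Longrightarrow> exec c \<sigma> k \<sigma>' \<Longrightarrow> exec (If b c d) \<sigma> (1 + k) \<sigma>'"
| exec_IfFalse: "\<not> bval b \<sigma> \<Longrightarrow> exec d \<sigma> k \<sigma>' \<Longrightarrow> exec (If b c d) \<sigma> (1 + k) \<sigma>'"
| exec_WhileFalse: "\<not> bval b \<sigma> \<Longrightarrow> exec (While b c) \<sigma> 1 \<sigma>"
| exec_WhileTrue: "bval b \<sigma> \<Longrightarrow> exec c \<sigma> k \<sigma>' \<Longrightarrow> exec (While b c) \<sigma>' l \<sigma>'' \<Longrightarrow>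
    exec (While b c) \<sigma> (1 + k + l) \<sigma>''"

lemma exec_deterministic:
  "exec c \<sigma> k \<sigma>' \<Longrightarrow> exec c \<sigma> l \<sigma>'' \<Longrightarrow> l = k \<and> \<sigma>'' = \<sigma>'"
proof (induction arbitrary: l \<sigma>'' rule: exec.induct)
  case exec_Skip then show ?case by cases auto
next
  case exec_NWrite then show ?case by cases auto
next
  case exec_RWrite then show ?case by cases auto
next
  case exec_Seq from exec_Seq.prems show ?case
    by cases (auto dest!: exec_Seq.IH)
next
  case exec_IfTrue from exec_IfTrue.prems show ?case
    by cases (auto dest!: exec_IfTrue.IH simp: exec_IfTrue.hyps)
next
  case exec_IfFalse from exec_IfFalse.prems show ?case
    by cases (auto dest!: exec_IfFalse.IH simp: exec_IfFalse.hyps)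
next
  case exec_WhileFalse from exec_WhileFalse.prems show ?case
    by cases (auto simp: exec_WhileFalse.hyps)
next
  case exec_WhileTrue from exec_WhileTrue.prems show ?case
    by cases (auto dest!: exec_WhileTrue.IH simp: exec_WhileTrue.hyps)
qed


section \<open>Solving the next-to-shortest path problem on the machine\<close>

text \<open>
  An input graph has vertices \<open>0, \<dots>, n - 1\<close> and is given by an arbitrarily ordered list of its
  edges. Natural array 0 holds \<open>n\<close>, the number of edges, \<open>s\<close> and \<open>t\<close>; natural arrays 1 and 2 and
  real array 0 hold the tails, the heads and the weights of the edges. All other cells are 0.
\<close>

definition array_of :: "'b::zero list \<Rightarrow> nat \<Rightarrow> 'b" where
  "array_of xs i = (if i < length xs then xs ! i else 0)"

definition input_state ::
  "nat \<Rightarrow> (nat \<times> nat) list \<Rightarrow> (nat \<times> nat) weight_fun \<Rightarrow> nat \<Rightarrow> nat \<Rightarrow> state" where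
  "input_state n es w s t =
     \<lparr>nmem = (\<lambda>_ _. 0)
        (0 := array_of [n, length es, s, t],
         1 := array_of (map fst es),
         2 := array_of (map snd es)),
      rmem = (\<lambda>_ _. 0)(0 := array_of (map w es))\<rparr>"

text \<open>
  The result is left in natural array 3: the number of vertices of the path, followed by
  its vertices. The empty list, which is not the vertex list of any path, reports that there is
  no next-to-shortest path.
\<close>

definition outputs :: "state \<Rightarrow> nat list \<Rightarrow> bool" where
  "outputs \<sigma> vs \<longleftrightarrow> nmem \<sigma> 3 0 = length vs \<and> (\<forall>i < length vs. nmem \<sigma> 3 (Suc i) = vs ! i)"

definition correct_output ::
  "nat pair_pre_digraph \<Rightarrow> (nat \<times> nat) weight_fun \<Rightarrow> nat \<Rightarrow> nat \<Rightarrow> state \<Rightarrow> bool" where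
  "correct_output G w s t \<sigma> \<longleftrightarrow>
     (if \<exists>p. st_digraph.next_to_shortest G w s t p
      then \<exists>p. st_digraph.next_to_shortest G w s t p \<and> outputs \<sigma> (pawalk_verts s p)
      else outputs \<sigma> [])"

text \<open>
  \<open>A\<close> solves the next-to-shortest path problem on all instances in the class \<open>\<C>\<close>
  in time \<open>O(f)\<close>, the constant being uniform over all instances.
\<close>

definition solves_in_time_O ::
  "com \<Rightarrow>
   (nat pair_pre_digraph \<Rightarrow> (nat \<times> nat) weight_fun \<Rightarrow> nat \<Rightarrow> nat \<Rightarrow> bool) \<Rightarrow>
   (nat pair_pre_digraph \<Rightarrow> (nat \<times> nat) weight_fun \<Rightarrow> nat \<Rightarrow> nat \<Rightarrow> real) \<Rightarrow> bool" where
  "solves_in_time_O A \<C> f \<longleftrightarrow>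
     (\<exists>c::real. \<forall>G w s t n es.
        st_digraph G w s t \<and> \<C> G w s t \<and>
        pverts G = {..<n} \<and> set es = parcs G \<and> distinct es \<longrightarrow>
        (\<exists>k \<sigma>. exec A (input_state n es w s t) k \<sigma> \<and>
           correct_output G w s t \<sigma> \<and> real k \<le> c * f G w s t))"

text \<open>
  The factors of the time bounds are read as being at least 1. This only
  matters in the degenerate cases where a factor vanishes (no back-edge, no edge,
  a single vertex), in which the bound would literally demand running time 0.
\<close>

definition layered_time ::
  "nat pair_pre_digraph \<Rightarrow> (nat \<times> nat) weight_fun \<Rightarrow> nat \<Rightarrow> nat \<Rightarrow> real" where
  "layered_time G w s t =
     max 1 (real (card (st_digraph.V_B G w s))) ^ 2 *
     max 1 (real (card (st_digraph.E_FP G w s))) *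
     max 1 (real (card (parcs G)) + real (card (pverts G)) * log 2 (real (card (pverts G))))"

definition general_time ::
  "nat pair_pre_digraph \<Rightarrow> (nat \<times> nat) weight_fun \<Rightarrow> nat \<Rightarrow> nat \<Rightarrow> real" where
  "general_time G w s t =
     real (card (pverts G)) ^ 4 *
     max 1 (real (card (parcs G))) ^ 3 *
     max 1 (log 2 (real (card (pverts G))))"

end

theory Submission
  imports Defs
begin

text \<open>
  Call a vertex good if it lies on a shortest \<open>s\<close>-\<open>t\<close> path, and an edge tight if it lies on one. A path that
  is not shortest makes detours: maximal segments between good vertices that use no tight edge and whose
  inner vertices are not good. If a detour leads from \<open>u\<close> to a vertex \<open>v\<close> that is not closer to \<open>s\<close>, then a
  shortest path to \<open>u\<close>, a cheapest detour from \<open>u\<close> to \<open>v\<close> and a shortest path from \<open>v\<close> form a simple path, so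
  the best such path is found directly. All other paths live in a layered graph: the good vertices with
  the tight edges subdivided at all distances from \<open>s\<close> that occur, and one back-edge for every cheapest
  detour towards \<open>s\<close>. Expanding an optimal path of the layered graph can repeat a vertex that is not good,
  but cutting at that vertex yields a cheaper path that still is not shortest, which by optimality is
  dominated by the first kind. The cheaper of the two candidates is therefore correct.
\<close>

section \<open>Walks as vertex lists\<close>

text \<open>Each clause of layeredness dictates one feature of the construction. Clause (1) leaves
  only good vertices. Clause (3) forbids an edge to jump over an occurring distance, hence the
  subdivision at all of them. Clause (2) forbids edges inside a level, hence detours between equal
  distances are treated directly, together with the rising ones. The exponents rest on two savings:
  back-edges join good vertices only, so \<open>V_B\<close> has at most |V| elements although the
  subdivided graph has O(|V||E|) vertices; and a tight edge has at most one piece per level, so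
  \<open>E_FP\<close> has at most |V||E|^2 elements. With O(|V||E|) edges and logarithm O(log |V|)
  the product is |V|^2 times |V||E|^2 times |V||E| log |V|. The assumed algorithm is an arbitrary
  \<open>com\<close>, so its arrays are moved beyond those of the caller and it must be given an
  exactly initialised memory. Everything around the call is quadratic in |V|(|E| + 1), which the
  bound absorbs; this is why one Bellman-Ford run per vertex is affordable.\<close>

definition walk :: "('v \<times> 'v) set \<Rightarrow> 'v \<Rightarrow> 'v list \<Rightarrow> 'v \<Rightarrow> bool" where
  "walk E x p y \<longleftrightarrow> p \<noteq> [] \<and> hd p = x \<and> last p = y \<and> successively (\<lambda>a b. (a, b) \<in> E) p"

fun cost :: "('v \<times> 'v \<Rightarrow> real) \<Rightarrow> 'v list \<Rightarrow> real" where
  "cost w (a # b # p) = w (a, b) + cost w (b # p)"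
| "cost w _ = 0"

lemma walk_Nil [simp]: "\<not> walk E x [] y"
  by (simp add: walk_def)

lemma walk_single [simp]: "walk E x [a] y \<longleftrightarrow> x = a \<and> y = a"
  by (auto simp: walk_def)

lemma walk_Cons_Cons [simp]:
  "walk E x (a # b # p) y \<longleftrightarrow> x = a \<and> (a, b) \<in> E \<and> walk E b (b # p) y"
  by (auto simp: walk_def)

lemma walk_append_iff:
  "walk E x (p @ y # q) z \<longleftrightarrow> walk E x (p @ [y]) y \<and> walk E y (y # q) z"
  by (cases q) (auto simp: walk_def successively_append_iff hd_append split: if_splits)

lemma walk_splitD:
  assumes "walk E x (p @ y # q) z"
  shows "walk E x (p @ [y]) y" "walk E y (y # q) z"
  using iffD1[OF walk_append_iff assms] by auto

lemma cost_append: "cost w (p @ y # q) = cost w (p @ [y]) + cost w (y # q)"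
proof (induction p)
  case Nil then show ?case by simp
next
  case (Cons a p) then show ?case by (cases p) auto
qed

lemma walk_hd: "walk E x p y \<Longrightarrow> \<exists>q. p = x # q"
  by (cases p) (auto simp: walk_def)

lemma walk_last: "walk E x p y \<Longrightarrow> \<exists>q. p = q @ [y]"
  by (cases p rule: rev_cases) (auto simp: walk_def)

lemma walk_ends_in: "walk E x p y \<Longrightarrow> x \<in> set p \<and> y \<in> set p"
  by (auto simp: walk_def)

lemma walk_trans:
  assumes "walk E x p y" "walk E y q z"
  shows "walk E x (p @ tl q) z" "cost w (p @ tl q) = cost w p + cost w q"
proof -
  obtain p' q' where "p = p' @ [y]" "q = y # q'"
    using walk_last[OF assms(1)] walk_hd[OF assms(2)] by blast
  then show "walk E x (p @ tl q) z" "cost w (p @ tl q) = cost w p + cost w q"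
    using assms walk_append_iff[of E x p' y q' z] cost_append[of w p' y q'] by simp_all
qed

lemma walk_snoc:
  "walk E x p y \<Longrightarrow> (y, z) \<in> E \<Longrightarrow> walk E x (p @ [z]) z \<and> cost w (p @ [z]) = cost w p + w (y, z)"
  using walk_trans[of E x p y "[y, z]" z] by simp

lemma walk_Cons:
  "walk E y p z \<Longrightarrow> (x, y) \<in> E \<Longrightarrow> walk E x (x # p) z \<and> cost w (x # p) = w (x, y) + cost w p"
  by (cases p) (auto simp: walk_def)

lemma walk_mono: "walk E x p y \<Longrightarrow> E \<subseteq> F \<Longrightarrow> walk F x p y"
  unfolding walk_def by (auto elim: successively_mono)

lemma walk_verts: "walk E x p y \<Longrightarrow> E \<subseteq> V \<times> V \<Longrightarrow> x \<in> V \<Longrightarrow> set p \<subseteq> V"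
proof (induction p arbitrary: x)
  case (Cons a p) then show ?case by (cases p) auto
qed simp

lemma walk_tl_verts: "walk E x p y \<Longrightarrow> a \<in> set (tl p) \<Longrightarrow> \<exists>b. (b, a) \<in> E"
proof (induction p arbitrary: x)
  case (Cons c p) then show ?case by (cases p) auto
qed simp

lemma cost_nonneg: "walk E x p y \<Longrightarrow> \<forall>e\<in>E. 0 < w e \<Longrightarrow> 0 \<le> cost w p"
proof (induction p arbitrary: x)
  case (Cons c p) then show ?case by (cases p) (force intro: add_nonneg_nonneg less_imp_le)+
qed simp

lemma cost_pos:
  assumes "walk E x p y" "\<forall>e\<in>E. 0 < w e" "length p > 1"
  shows "0 < cost w p"
proof -
  obtain a b q where p: "p = a # b # q" using assms(3) by (cases p; cases "tl p") auto
  then show ?thesis using assms cost_nonneg[of E b "b # q" y w] by (auto intro: add_pos_nonneg)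
qed

lemma cost_pos_ends:
  assumes "walk E x p y" "\<forall>e\<in>E. 0 < w e" "x \<noteq> y"
  shows "0 < cost w p"
proof (rule cost_pos[OF assms(1,2)])
  show "length p > 1" using assms(1,3) by (cases p; cases "tl p") auto
qed

text \<open>The closed walk that is cut out has at least one edge, so positive weights make the
  saving strict. Strictness is what later contradicts optimality.\<close>

lemma walk_cut:
  assumes "walk E x (p @ a # q @ a # r) y" "\<forall>e\<in>E. 0 < w e"
  shows "walk E x (p @ a # r) y" "cost w (p @ a # r) < cost w (p @ a # q @ a # r)"
proof -
  have *: "walk E x (p @ [a]) a" "walk E a ((a # q) @ a # r) y"
    using iffD1[OF walk_append_iff[of E x p a "q @ a # r" y]] assms(1) by simp_all
  then have **: "walk E a ((a # q) @ [a]) a" "walk E a (a # r) y"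
    using iffD1[OF walk_append_iff[of E a "a # q" a r y]] by simp_all
  from * ** show "walk E x (p @ a # r) y" using iffD2[OF walk_append_iff[of E x p a r y]] by simp
  have "0 < cost w ((a # q) @ [a])" by (rule cost_pos[OF **(1) assms(2)]) auto
  then show "cost w (p @ a # r) < cost w (p @ a # q @ a # r)"
    using cost_append[of w p a r] cost_append[of w p a "q @ a # r"] cost_append[of w "a # q" a r]
    by simp
qed

lemma walk_to_path:
  assumes "walk E x p y" "\<forall>e\<in>E. 0 < w e"
  shows "\<exists>q. walk E x q y \<and> distinct q \<and> cost w q \<le> cost w p"
  using assms(1)
proof (induction "length p" arbitrary: p rule: less_induct)
  case less
  show ?case
  proof (cases "distinct p")
    case False
    then obtain a b c d where p: "p = a @ b # c @ b # d"
      using not_distinct_decomp[of p] by auto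
    have "walk E x (a @ b # d) y" "cost w (a @ b # d) < cost w p"
      using walk_cut[of E x a b c d y w] less.prems assms(2) p by auto
    moreover have "length (a @ b # d) < length p" by (simp add: p)
    ultimately show ?thesis using less.hyps[of "a @ b # d"] by force
  qed (use less.prems in auto)
qed

text \<open>An infimum in the reals, hence without meaning when there is no walk; the facts about it
  therefore carry an explicit walk as hypothesis.\<close>

definition wdist :: "('v \<times> 'v) set \<Rightarrow> ('v \<times> 'v \<Rightarrow> real) \<Rightarrow> 'v \<Rightarrow> 'v \<Rightarrow> real" where
  "wdist E w x y = Inf (cost w ` {p. walk E x p y})"

text \<open>There may be infinitely many walks, but each can be shortened to a path without raising
  its cost, and there are only finitely many paths.\<close>

lemma wdist_attained:
  assumes "walk E x p y" "\<forall>e\<in>E. 0 < w e" "finite E"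
  shows "(\<exists>q. walk E x q y \<and> distinct q \<and> cost w q = wdist E w x y) \<and>
    (\<forall>r. walk E x r y \<longrightarrow> wdist E w x y \<le> cost w r)"
proof -
  \<comment> \<open>\<open>x\<close> is added because the trivial walk \<open>[x]\<close> may start
    at a vertex without edges.\<close>
  let ?V = "insert x (fst ` E \<union> snd ` E)"
  let ?P = "{q. walk E x q y \<and> distinct q}"
  have "?P \<subseteq> {q. set q \<subseteq> ?V \<and> length q \<le> card ?V}"
  proof
    fix q assume "q \<in> ?P"
    then have *: "walk E x q y" "distinct q" by auto
    have "set q \<subseteq> ?V" by (rule walk_verts[OF *(1)]) (auto intro: rev_image_eqI)
    moreover have "length q = card (set q)" using *(2) by (simp add: distinct_card)
    ultimately show "q \<in> {q. set q \<subseteq> ?V \<and> length q \<le> card ?V}"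
      using assms(3) by (auto intro: card_mono)
  qed
  then have fin: "finite ?P"
    using finite_lists_length_le[of ?V "card ?V"] assms(3) finite_subset by auto
  have ne: "?P \<noteq> {}" using walk_to_path[of E x p y w] assms by auto
  obtain q where q: "q \<in> ?P" "\<And>r. r \<in> ?P \<Longrightarrow> cost w q \<le> cost w r"
    using ex_min_if_finite[of "cost w ` ?P"] fin ne
    by (metis (no_types, lifting) arg_min_if_finite(1) arg_min_least)
  have low: "cost w q \<le> cost w r" if "walk E x r y" for r
    using walk_to_path[of E x r y w] that q(2) assms(2) by force
  have "wdist E w x y = cost w q" unfolding wdist_def
    by (rule cInf_eq_minimum) (use q low in auto)
  with q low show ?thesis by auto
qed

lemma wdist_le:
  assumes "walk E x p y" "\<forall>e\<in>E. 0 < w e" "finite E"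
  shows "wdist E w x y \<le> cost w p"
  using wdist_attained[OF assms] assms(1) by blast

lemma wdist_refl: "\<forall>e\<in>E. 0 < w e \<Longrightarrow> finite E \<Longrightarrow> wdist E w x x = 0"
  using wdist_le[of E x "[x]" x w] wdist_attained[of E x "[x]" x w] cost_nonneg[of E x _ x w]
  by force

text \<open>Carries walks between the layered graph and its copy on list indices, on which the
  assumed algorithm is run.\<close>

lemma walk_pair_map:
  "inj_on f V \<Longrightarrow> set p \<subseteq> V \<Longrightarrow> E \<subseteq> V \<times> V \<Longrightarrow> x \<in> V \<Longrightarrow> y \<in> V \<Longrightarrow>
    walk (map_prod f f ` E) (f x) (map f p) (f y) \<longleftrightarrow> walk E x p y"
proof (induction p arbitrary: x)
  case (Cons a p)
  then show ?case
  proof (cases p)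
    case (Cons b q)
    have "(f a, f b) \<in> map_prod f f ` E \<longleftrightarrow> (a, b) \<in> E"
      using Cons.prems Cons by (auto simp: inj_on_eq_iff)
    then show ?thesis using Cons.IH[of b] Cons.prems Cons by (auto simp: inj_on_eq_iff)
  qed (auto simp: inj_on_eq_iff)
qed simp

lemma cost_map: "cost w (map f p) = cost (\<lambda>(a, b). w (f a, f b)) p"
  by (induction p rule: induct_list012) auto

subsection \<open>Connection with arc walks\<close>

context st_digraph
begin

lemma arcs_pos: "\<forall>e\<in>parcs G. 0 < w e" by (blast intro: weight_pos)

lemma awalk_imp_walk:
  assumes "awalk u p v"
  shows "walk (parcs G) u (pawalk_verts u p) v \<and> awalk_cost w p = cost w (pawalk_verts u p)"
  using assms
proof (induction p arbitrary: u)
  case Nil then show ?case by (auto simp: awalk_Nil_iff)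
next
  case (Cons e p)
  then have *: "fst e = u" "e \<in> parcs G" "awalk (snd e) p v" by (auto simp: awalk_Cons_iff)
  obtain q where q: "pawalk_verts (snd e) p = snd e # q"
    using Cons.IH[OF *(3)] walk_hd by fastforce
  have "e = (u, snd e)" using * by (cases e) auto
  then show ?case using Cons.IH[OF *(3)] * q by auto
qed

lemma walk_imp_awalk:
  assumes "walk (parcs G) u p v" "u \<in> pverts G"
  shows "\<exists>q. awalk u q v \<and> pawalk_verts u q = p"
  using assms
proof (induction p arbitrary: u)
  case Nil then show ?case by simp
next
  case (Cons a p)
  show ?case
  proof (cases p)
    case Nil
    then show ?thesis using Cons.prems by (intro exI[of _ "[]"]) (auto simp: awalk_Nil_iff)
  next
    case (Cons b r)
    then have *: "u = a" "(a, b) \<in> parcs G" "walk (parcs G) b p v" using Cons.prems by auto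
    moreover have "b \<in> pverts G" using *(2) by (rule in_arcsD2)
    ultimately obtain q where "awalk b q v" "pawalk_verts b q = p" using Cons.IH by blast
    then show ?thesis using * by (intro exI[of _ "(a, b) # q"]) (auto simp: awalk_Cons_iff)
  qed
qed

text \<open>Without a walk the extended distance is infinite while \<open>wdist\<close> is some real
  number, so the two agree only where a walk exists.\<close>

lemma dist_eq_wdist:
  assumes "walk (parcs G) u p v" "u \<in> pverts G"
  shows "dist_G u v = ereal (wdist (parcs G) w u v)"
proof -
  obtain q where q: "walk (parcs G) u q v" "cost w q = wdist (parcs G) w u v"
    "\<And>r. walk (parcs G) u r v \<Longrightarrow> wdist (parcs G) w u v \<le> cost w r"
    using wdist_attained[OF assms(1) arcs_pos pair_finite_arcs] by blast
  obtain a where a: "awalk u a v" "pawalk_verts u a = q" using walk_imp_awalk[OF q(1) assms(2)] by auto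
  show ?thesis unfolding \<mu>_def
  proof (rule INF_eqI)
    fix b assume "b \<in> {p. awalk u p v}"
    then show "ereal (wdist (parcs G) w u v) \<le> ereal (awalk_cost w b)"
      using awalk_imp_walk[of u b v] q(3) by simp
  next
    fix y assume y: "\<And>i. i \<in> {p. awalk u p v} \<Longrightarrow> y \<le> ereal (awalk_cost w i)"
    have "awalk_cost w a = wdist (parcs G) w u v" using awalk_imp_walk[OF a(1)] a(2) q(2) by simp
    then show "y \<le> ereal (wdist (parcs G) w u v)" using y[of a] a(1) by simp
  qed
qed

definition nsp :: "'a list \<Rightarrow> bool" where
  "nsp p \<longleftrightarrow> walk (parcs G) s p t \<and> distinct p \<and> wdist (parcs G) w s t < cost w p"

lemma not_shortest_iff_nsp:
  "not_shortest p \<longleftrightarrow> awalk s p t \<and> nsp (pawalk_verts s p)"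
proof (cases "awalk s p t")
  case True
  note * = awalk_imp_walk[OF True]
  then have "dist_G s t = ereal (wdist (parcs G) w s t)"
    using dist_eq_wdist source_in_verts by blast
  then show ?thesis using True * by (auto simp: not_shortest_def nsp_def apath_def)
qed (auto simp: not_shortest_def apath_def)

lemma next_to_shortestI:
  assumes "nsp p" "\<And>q. nsp q \<Longrightarrow> cost w p \<le> cost w q"
  shows "\<exists>a. next_to_shortest a \<and> pawalk_verts s a = p"
proof -
  obtain a where "awalk s a t" "pawalk_verts s a = p"
    using walk_imp_awalk[of s p t] assms(1) source_in_verts by (auto simp: nsp_def)
  then show ?thesis using assms awalk_imp_walk
    by (intro exI[of _ a]) (auto simp: next_to_shortest_def not_shortest_iff_nsp)
qed

lemma next_to_shortestD:
  assumes "next_to_shortest a"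
  shows "nsp (pawalk_verts s a)" "nsp q \<Longrightarrow> cost w (pawalk_verts s a) \<le> cost w q"
proof -
  have a: "awalk s a t" "nsp (pawalk_verts s a)"
    using assms by (auto simp: next_to_shortest_def not_shortest_iff_nsp)
  then show "nsp (pawalk_verts s a)" by simp
  assume q: "nsp q"
  then obtain b where "awalk s b t" "pawalk_verts s b = q"
    using walk_imp_awalk[of s q t] source_in_verts by (auto simp: nsp_def)
  then show "cost w (pawalk_verts s a) \<le> cost w q"
    using assms q a awalk_imp_walk by (auto simp: next_to_shortest_def not_shortest_iff_nsp)
qed

text \<open>Finitely many paths, so a cheapest not-shortest one exists. This is how a report of
  failure on the layered graph turns into the absence of every not-shortest path.\<close>

lemma nsp_imp_next_to_shortest:
  assumes "nsp p"
  shows "\<exists>a. next_to_shortest a"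
proof -
  have "finite {q. nsp q}"
  proof (rule finite_subset)
    show "{q. nsp q} \<subseteq> {q. set q \<subseteq> pverts G \<and> length q \<le> card (pverts G)}"
    proof clarify
      fix q assume "nsp q"
      then have "set q \<subseteq> pverts G" "distinct q"
        using walk_verts[of "parcs G" s q t "pverts G"] source_in_verts in_arcsD1 in_arcsD2
        by (auto simp: nsp_def subset_iff)
      then show "set q \<subseteq> pverts G \<and> length q \<le> card (pverts G)"
        using card_mono[of "pverts G" "set q"] pair_finite_verts by (simp add: distinct_card)
    qed
  qed (use finite_lists_length_le pair_finite_verts in blast)
  then obtain q where "nsp q" "\<And>r. nsp r \<Longrightarrow> cost w q \<le> cost w r"
    using assms arg_min_if_finite(1)[of "{q. nsp q}" "cost w"] arg_min_least[of "{q. nsp q}" _ "cost w"]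
    by blast
  then show ?thesis using next_to_shortestI by blast
qed

end

section \<open>Detours around the shortest-path subgraph\<close>

text \<open>With \<open>t\<close> unreachable or \<open>s = t\<close> there is no not-shortest path
  at all. Those inputs are answered separately through \<open>no_nsp\<close>, so a nontrivial
  shortest path may be presupposed here.\<close>

locale reduction =
  fixes E :: "('v \<times> 'v) set" and w :: "'v \<times> 'v \<Rightarrow> real" and s t :: 'v
  assumes finE: "finite E" and pos: "\<forall>e\<in>E. 0 < w e" and irrefl: "(x, x) \<notin> E"
    and conn: "\<exists>p. walk E s p t" and s_ne_t: "s \<noteq> t"
begin

definition ds :: "'v \<Rightarrow> real" where "ds x = wdist E w s x"
definition dt :: "'v \<Rightarrow> real" where "dt x = wdist E w x t"

text \<open>Reachability is demanded explicitly because \<open>ds\<close> and \<open>dt\<close> say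
  nothing when their sets of walks are empty.\<close>

definition good :: "'v \<Rightarrow> bool" where
  "good x \<longleftrightarrow> (\<exists>p. walk E s p x) \<and> (\<exists>p. walk E x p t) \<and> ds x + dt x = ds t"

text \<open>For good ends the local equation suffices for lying on a shortest path:
  \<open>ds u + w (u, v) + dt v = ds v + dt v = ds t\<close>.\<close>

definition Tight :: "('v \<times> 'v) set" where
  "Tight = {(u, v) \<in> E. good u \<and> good v \<and> ds u + w (u, v) = ds v}"

text \<open>Only heads are constrained. Every vertex of a walk but the first is a head, so inner
  vertices are not good while the start is free; one distance computation in \<open>Det v\<close>
  thus serves all starting points of detours to \<open>v\<close>.\<close>

definition Det :: "'v \<Rightarrow> ('v \<times> 'v) set" where
  "Det v = {(a, b) \<in> E. (a, b) \<notin> Tight \<and> (b = v \<or> \<not> good b)}"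

definition detour :: "'v \<Rightarrow> 'v \<Rightarrow> real" where
  "detour u v = wdist (Det v) w u v"

lemma Det_sub: "Det v \<subseteq> E" by (auto simp: Det_def)
lemma finDet: "finite (Det v)" using finE Det_sub finite_subset by blast
lemma posDet: "\<forall>e\<in>Det v. 0 < w e" using pos Det_sub by blast

lemma ds_le: "walk E s p x \<Longrightarrow> ds x \<le> cost w p"
  unfolding ds_def by (rule wdist_le[OF _ pos finE])

lemma dt_le: "walk E x p t \<Longrightarrow> dt x \<le> cost w p"
  unfolding dt_def by (rule wdist_le[OF _ pos finE])

lemma ds_attained: "walk E s p x \<Longrightarrow> \<exists>q. walk E s q x \<and> distinct q \<and> cost w q = ds x"
  unfolding ds_def using wdist_attained[OF _ pos finE] by blast

lemma dt_attained: "walk E x p t \<Longrightarrow> \<exists>q. walk E x q t \<and> distinct q \<and> cost w q = dt x"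
  unfolding dt_def using wdist_attained[OF _ pos finE] by blast

lemma ds_step:
  assumes "walk E s p x" "walk E x q y"
  shows "ds y \<le> ds x + cost w q"
proof -
  obtain r where r: "walk E s r x" "cost w r = ds x" using ds_attained[OF assms(1)] by auto
  show ?thesis using ds_le[OF walk_trans(1)[OF r(1) assms(2)]] walk_trans(2)[OF r(1) assms(2), of w] r(2)
    by simp
qed

lemma dt_step:
  assumes "walk E x q y" "walk E y p t"
  shows "dt x \<le> cost w q + dt y"
proof -
  obtain r where r: "walk E y r t" "cost w r = dt y" using dt_attained[OF assms(2)] by auto
  show ?thesis using dt_le[OF walk_trans(1)[OF assms(1) r(1)]] walk_trans(2)[OF assms(1) r(1), of w] r(2)
    by simp
qed

lemma ds_s: "ds s = 0" unfolding ds_def using wdist_refl[OF pos finE] .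
lemma dt_t: "dt t = 0" unfolding dt_def using wdist_refl[OF pos finE] .

lemma dt_s: "dt s = ds t" by (simp add: dt_def ds_def)

lemma good_s: "good s" unfolding good_def
  using conn ds_s dt_s by (auto intro!: exI[of _ "[s]"])

lemma good_t: "good t" unfolding good_def
  using conn dt_t by (auto intro!: exI[of _ "[t]"])

lemma ds_dt_ge: "walk E s p x \<Longrightarrow> walk E x q t \<Longrightarrow> ds t \<le> ds x + dt x"
  using dt_attained[of x q] ds_step[of p x _ t] by metis

text \<open>Cutting at \<open>x\<close> leaves two walks that cost at least \<open>ds x\<close> and
  \<open>dt x\<close>; for a vertex that is not good this sum exceeds \<open>ds t\<close>.\<close>

lemma walk_via_bad:
  assumes "walk E s p t" "x \<in> set p" "\<not> good x"
  shows "ds t < cost w p"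
proof -
  obtain a b where p: "p = a @ x # b" using assms(2) by (auto simp: in_set_conv_decomp)
  have *: "walk E s (a @ [x]) x" "walk E x (x # b) t"
    using walk_splitD[OF assms(1)[unfolded p]] by auto
  have "cost w p = cost w (a @ [x]) + cost w (x # b)" unfolding p by (rule cost_append)
  moreover have "ds t \<noteq> ds x + dt x" using assms(3) * unfolding good_def by metis
  ultimately show ?thesis using ds_le[OF *(1)] dt_le[OF *(2)] ds_dt_ge[OF *] by linarith
qed

text \<open>Equality would turn all the triangle inequalities into equalities, which makes both ends
  good and the edge tight.\<close>

lemma walk_via_nontight:
  assumes "walk E s a u" "walk E v b t" "(u, v) \<in> E" "(u, v) \<notin> Tight"
  shows "ds t < ds u + w (u, v) + dt v"
proof -
  have u: "walk E s (a @ [v]) v" "walk E u (u # b) t"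
    using walk_snoc[of E s a u v w] walk_Cons[of E v b t u w] assms by auto
  have "ds v \<le> ds u + w (u, v)" using ds_step[OF assms(1), of "[u, v]" v] assms(3) by simp
  moreover have "dt u \<le> w (u, v) + dt v" using dt_step[of u "[u, v]" v, OF _ assms(2)] assms(3) by simp
  moreover have "ds t \<le> ds v + dt v" "ds t \<le> ds u + dt u"
    using ds_dt_ge u assms(1,2) by blast+
  ultimately show ?thesis using assms u unfolding Tight_def good_def
    by (smt (verit, best) case_prodI mem_Collect_eq)
qed

text \<open>Continued by a shortest walk to \<open>t\<close>, the walk is part of a shortest one, so
  all triangle inequalities at \<open>y\<close> are equalities. The levels confine the initial piece
  of a candidate path strictly below \<open>ds u\<close>, apart from \<open>u\<close>
  itself.\<close>

lemma good_prefix: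
  assumes "walk E s p u" "cost w p = ds u" "good u" "y \<in> set p"
  shows "good y \<and> (y = u \<or> ds y < ds u)"
proof -
  obtain a b where p: "p = a @ y # b" using assms(4) by (auto simp: in_set_conv_decomp)
  have *: "walk E s (a @ [y]) y" "walk E y (y # b) u"
    using walk_splitD[OF assms(1)[unfolded p]] by auto
  obtain r where r: "walk E u r t" using assms(3) by (auto simp: good_def)
  have yt: "walk E y ((y # b) @ tl r) t" using walk_trans(1)[OF *(2) r] .
  have c: "cost w p = cost w (a @ [y]) + cost w (y # b)" unfolding p by (rule cost_append)
  have 1: "ds y \<le> cost w (a @ [y])" using ds_le[OF *(1)] .
  have 2: "ds u \<le> ds y + cost w (y # b)" using ds_step[OF *] .
  have 3: "dt y \<le> cost w (y # b) + dt u" using dt_step[OF *(2) r] .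
  have 4: "ds t \<le> ds y + dt y" using ds_dt_ge[OF *(1) yt] .
  have "y = u \<or> 0 < cost w (y # b)" using cost_pos_ends[OF *(2) pos] by auto
  moreover have "good y" using 1 2 3 4 c assms(2,3) * yt unfolding good_def by (auto intro!: antisym)
  ultimately show ?thesis using 1 2 c assms(2) by auto
qed

text \<open>Mirror image of \<open>good_prefix\<close>: the final piece stays strictly above
  \<open>ds u\<close>, apart from \<open>u\<close> itself. Distances to \<open>t\<close> become
  levels through \<open>ds y + dt y = ds t\<close>.\<close>

lemma good_suffix:
  assumes "walk E u p t" "cost w p = dt u" "good u" "y \<in> set p"
  shows "good y \<and> (y = u \<or> ds u < ds y)"
proof -
  obtain a b where p: "p = a @ y # b" using assms(4) by (auto simp: in_set_conv_decomp)
  have *: "walk E u (a @ [y]) y" "walk E y (y # b) t"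
    using walk_splitD[OF assms(1)[unfolded p]] by auto
  obtain r where r: "walk E s r u" using assms(3) by (auto simp: good_def)
  have sy: "walk E s (r @ tl (a @ [y])) y" using walk_trans(1)[OF r *(1)] .
  have c: "cost w p = cost w (a @ [y]) + cost w (y # b)" unfolding p by (rule cost_append)
  have 1: "dt y \<le> cost w (y # b)" using dt_le[OF *(2)] .
  have 2: "dt u \<le> cost w (a @ [y]) + dt y" using dt_step[OF *] .
  have 3: "ds y \<le> ds u + cost w (a @ [y])" using ds_step[OF r *(1)] .
  have 4: "ds t \<le> ds y + dt y" using ds_dt_ge[OF sy *(2)] .
  have "y = u \<or> 0 < cost w (a @ [y])" using cost_pos_ends[OF *(1) pos] by auto
  moreover have "ds u + dt u = ds t" using assms(3) by (simp add: good_def)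
  moreover have "good y" using 1 2 3 4 c assms(2,3) * sy unfolding good_def by (auto intro!: antisym)
  ultimately show ?thesis using 1 2 3 4 c assms(2) by auto
qed

text \<open>The last edge of a shortest walk to \<open>x\<close> is tight. With
  \<open>tight_out\<close> this gives every vertex of the layered graph a neighbour on either
  side.\<close>

lemma tight_in:
  assumes "good x" "x \<noteq> s"
  shows "\<exists>u. (u, x) \<in> Tight"
proof -
  obtain p where p: "walk E s p x" "cost w p = ds x"
    using ds_attained assms(1) unfolding good_def by blast
  obtain q where q: "p = q @ [x]" using walk_last[OF p(1)] by auto
  then have "q \<noteq> []" using p(1) assms(2) by auto
  then obtain r u where pp: "p = (r @ [u]) @ [x]" using q by (metis rev_exhaust)
  have "good u" using good_prefix[OF p assms(1), of u] pp by auto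
  have "walk E s (r @ u # [x]) x" using p(1) pp by simp
  then have *: "walk E s (r @ [u]) u" "walk E u [u, x] x"
    using iffD1[OF walk_append_iff[of E s r u "[x]" x]] by blast+
  have "ds u + w (u, x) \<le> ds x"
    using cost_append[of w r u "[x]"] pp p(2) ds_le[OF *(1)] by simp
  moreover have "ds x \<le> ds u + w (u, x)" using ds_step[OF *] by simp
  ultimately show ?thesis using * \<open>good u\<close> assms(1) unfolding Tight_def by auto
qed

lemma tight_out:
  assumes "good x" "x \<noteq> t"
  shows "\<exists>v. (x, v) \<in> Tight"
proof -
  obtain p where p: "walk E x p t" "cost w p = dt x"
    using dt_attained assms(1) unfolding good_def by blast
  obtain v r where pp: "p = x # v # r" using p(1) assms(2) walk_hd[OF p(1)] by (metis walk_single
      neq_Nil_conv)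
  have gv: "good v" using good_suffix[OF p assms(1), of v] pp by auto
  have *: "(x, v) \<in> E" "walk E v (v # r) t" using p(1) pp by auto
  have "w (x, v) + dt v \<le> dt x" using pp p(2) dt_le[OF *(2)] by simp
  moreover obtain q where "walk E s q x" using assms(1) unfolding good_def by auto
  then have "ds v \<le> ds x + w (x, v)" using ds_step[of q x "[x, v]" v] * by simp
  ultimately show ?thesis using * gv assms(1) unfolding Tight_def good_def
    by (auto intro!: exI[of _ v])
qed

lemma tight_less: "(u, v) \<in> Tight \<Longrightarrow> ds u < ds v"
  using pos unfolding Tight_def by force

lemma detour_le: "walk (Det v) u p v \<Longrightarrow> detour u v \<le> cost w p"
  unfolding detour_def by (rule wdist_le[OF _ posDet finDet])

lemma detour_pos: "walk (Det v) u p v \<Longrightarrow> u \<noteq> v \<Longrightarrow> 0 < detour u v"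
  unfolding detour_def using wdist_attained[OF _ posDet finDet] cost_pos_ends[OF _ posDet] by metis

lemma Det_walk_verts:
  assumes "walk (Det v) u p v" "distinct p" "u \<noteq> v" "good u" "good v"
  shows "filter good p = [u, v]" "x \<in> set p \<Longrightarrow> x = u \<or> x = v \<or> \<not> good x"
proof -
  obtain q where q: "p = u # q" using walk_hd[OF assms(1)] by auto
  have *: "x = v \<or> \<not> good x" if "x \<in> set q" for x
    using walk_tl_verts[OF assms(1), of x] that q by (auto simp: Det_def)
  then show "x \<in> set p \<Longrightarrow> x = u \<or> x = v \<or> \<not> good x" using q by auto
  have "v \<in> set q" using assms(1,3) q walk_ends_in[OF assms(1)] by auto
  then obtain a b where ab: "q = a @ v # b" by (auto simp: in_set_conv_decomp)
  have "filter good a = []" "filter good b = []"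
    using * ab assms(2) q by (auto simp: filter_empty_conv)
  then show "filter good p = [u, v]" using q ab assms(4,5) by simp
qed

text \<open>The three pieces live in disjoint zones: good vertices of level at most
  \<open>ds u\<close>, vertices that are not good, and good vertices of level at least
  \<open>ds v\<close>. Since the detour does not descend, they meet only in \<open>u\<close> and
  \<open>v\<close>.\<close>

lemma up_detour_path:
  assumes "good u" "good v" "u \<noteq> v" "ds u \<le> ds v"
    and a: "walk E s a u" "distinct a" "cost w a = ds u"
    and m: "walk (Det v) u m v" "distinct m"
    and b: "walk E v b t" "distinct b" "cost w b = dt v"
  shows "walk E s (a @ tl m @ tl b) t" "distinct (a @ tl m @ tl b)"
    "cost w (a @ tl m @ tl b) = ds u + cost w m + dt v" "ds t < ds u + cost w m + dt v"
proof -
  have mE: "walk E u m v" using walk_mono[OF m(1) Det_sub] .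
  have mb: "walk E u (m @ tl b) t" "cost w (m @ tl b) = cost w m + cost w b"
    using walk_trans[OF mE b(1)] by auto
  have tl: "tl (m @ tl b) = tl m @ tl b" using mE by (cases m) auto
  show W: "walk E s (a @ tl m @ tl b) t" and C: "cost w (a @ tl m @ tl b) = ds u + cost w m + dt v"
    using walk_trans[OF a(1) mb(1)] mb(2) a(3) b(3) tl by auto
  obtain m' where m': "m = u # m'" using walk_hd[OF m(1)] by auto
  obtain b' where b': "b = v # b'" using walk_hd[OF b(1)] by auto
  have 1: "good y \<and> (y = u \<or> ds y < ds u)" if "y \<in> set a" for y
    using good_prefix[OF a(1,3) assms(1) that] .
  have 2: "y = v \<or> \<not> good y" if "y \<in> set m'" for y
    using walk_tl_verts[OF m(1), of y] that m' by (auto simp: Det_def)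
  have 3: "good y \<and> ds v < ds y" if "y \<in> set b'" for y
    using good_suffix[OF b(1,3) assms(2), of y] that b' b(2) by auto
  show "distinct (a @ tl m @ tl b)"
    using a(2) b(2) m(2) b' m' 1 2 3 assms(3,4) by (auto simp: disjoint_iff) (metis order.asym
        order_le_less_trans not_less)+
  \<comment> \<open>The first edge of a detour is not tight and alone accounts for the strict
    excess; the rest of the detour enters only through the triangle inequality at
    \<open>x\<close>.\<close>
  obtain x m'' where x: "m' = x # m''" using m' m(1) assms(3) by (cases m') auto
  have ux: "(u, x) \<in> E" "(u, x) \<notin> Tight" and xw: "walk (Det v) x m' v"
    using m(1) m' x by (auto simp: Det_def)
  have xE: "walk E x m' v" using walk_mono[OF xw Det_sub] .
  have "ds t < ds u + w (u, x) + dt x"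
    using walk_via_nontight[OF a(1) walk_trans(1)[OF xE b(1)] ux] .
  moreover have "dt x \<le> cost w m' + dt v" using dt_step[OF xE b(1)] .
  ultimately show "ds t < ds u + cost w m + dt v" using m' x by simp
qed

text \<open>Cutting a closed subwalk at a repeated bad vertex keeps that vertex, so the shorter walk
  still is not a shortest one.\<close>

lemma shortcut_at_bad:
  assumes "walk E s p t" "distinct (filter good p)" "ds t < cost w p" "\<not> distinct p"
  shows "\<exists>q. walk E s q t \<and> distinct q \<and> ds t < cost w q \<and> cost w q < cost w p"
  using assms
proof (induction "length p" arbitrary: p rule: less_induct)
  case less
  obtain a x b c where p: "p = a @ x # b @ x # c"
    using not_distinct_decomp[OF less.prems(4)] by auto
  have bad: "\<not> good x" using less.prems(2) p by auto
  let ?q = "a @ x # c"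
  have q: "walk E s ?q t" "cost w ?q < cost w p"
    using walk_cut[of E s a x b c t w] less.prems(1) pos p by auto
  have lt: "ds t < cost w ?q" using walk_via_bad[OF q(1) _ bad] by simp
  have dis: "distinct (filter good ?q)" using less.prems(2) p by auto
  show ?case
  proof (cases "distinct ?q")
    case False
    then show ?thesis using less.hyps[of ?q] q lt dis p by force
  qed (use q lt in blast)
qed

end

section \<open>The layered graph\<close>

text \<open>\<open>Inl x\<close> is the vertex \<open>x\<close> of the given graph, \<open>Inr (e, l)\<close> the point of the
  subdivided tight edge \<open>e\<close> at distance \<open>l\<close> from the source.\<close>

type_synonym 'a lvert = "'a + ('a \<times> 'a) \<times> real"

text \<open>A potential certifies layeredness. No edge raises \<open>lev\<close> by more than its
  weight, so a walk costs at least the difference of levels; chains of predecessors and successors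
  attain it. Hence \<open>lev x\<close> and \<open>lev t - lev x\<close> are the distances from
  \<open>s\<close> and to \<open>t\<close>.\<close>

lemma (in st_digraph) layered_by_levels:
  fixes lev :: "'a \<Rightarrow> real"
  assumes s0: "lev s = 0"
    and edge: "\<And>u v. (u, v) \<in> parcs G \<Longrightarrow> lev v < lev u \<or>
      lev u < lev v \<and> w (u, v) = lev v - lev u \<and> (\<forall>x\<in>pverts G. lev x \<le> lev u \<or> lev v \<le> lev x)"
    and pred: "\<And>x. x \<in> pverts G \<Longrightarrow> x \<noteq> s \<Longrightarrow> \<exists>u. (u, x) \<in> parcs G \<and> lev u < lev x"
    and succ: "\<And>x. x \<in> pverts G \<Longrightarrow> x \<noteq> t \<Longrightarrow> \<exists>v. (x, v) \<in> parcs G \<and> lev x < lev v"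
  shows "layered" and "x \<in> pverts G \<Longrightarrow> dist_G s x = ereal (lev x)"
    and "wdist (parcs G) w s t = lev t" and "\<exists>p. walk (parcs G) s p t"
proof -
  have up: "w (u, v) = lev v - lev u" if "(u, v) \<in> parcs G" "lev u < lev v" for u v
    using edge[OF that(1)] that(2) by auto
  have low: "lev y - lev x \<le> cost w p" if "walk (parcs G) x p y" for x p y
    using that
  proof (induction p arbitrary: x)
    case (Cons a p)
    show ?case
    proof (cases p)
      case (Cons b q)
      then have *: "(a, b) \<in> parcs G" "walk (parcs G) b p y" "x = a" using Cons.prems by auto
      have "lev b - lev a \<le> w (a, b)" using edge[OF *(1)] weight_pos[OF *(1)] by auto
      then show ?thesis using Cons.IH[OF *(2)] Cons * by simp
    qed (use Cons in auto)
  qed simp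
  have from_s: "\<exists>p. walk (parcs G) s p x \<and> cost w p = lev x" if "x \<in> pverts G" for x
    using that
  \<comment> \<open>Levels are real numbers, so the induction counts the vertices on lower
    levels.\<close>
  proof (induction "card {y \<in> pverts G. lev y < lev x}" arbitrary: x rule: less_induct)
    case less
    show ?case
    proof (cases "x = s")
      case True then show ?thesis using s0 by (intro exI[of _ "[s]"]) auto
    next
      case False
      then obtain u where u: "(u, x) \<in> parcs G" "lev u < lev x" using pred less.prems by blast
      have uV: "u \<in> pverts G" using u(1) by (rule in_arcsD1)
      have "card {y \<in> pverts G. lev y < lev u} < card {y \<in> pverts G. lev y < lev x}"
        by (rule psubset_card_mono) (use u uV pair_finite_verts in auto)
      then obtain p where p: "walk (parcs G) s p u" "cost w p = lev u" using less.hyps uV by blast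
      show ?thesis using walk_snoc[OF p(1) u(1), of w] p(2) up[OF u] by auto
    qed
  qed
  have to_t: "\<exists>p. walk (parcs G) x p t \<and> cost w p = lev t - lev x" if "x \<in> pverts G" for x
    using that
  proof (induction "card {y \<in> pverts G. lev x < lev y}" arbitrary: x rule: less_induct)
    case less
    show ?case
    proof (cases "x = t")
      case True then show ?thesis by (intro exI[of _ "[t]"]) auto
    next
      case False
      then obtain u where u: "(x, u) \<in> parcs G" "lev x < lev u" using succ less.prems by blast
      have uV: "u \<in> pverts G" using u(1) by (rule in_arcsD2)
      have "card {y \<in> pverts G. lev u < lev y} < card {y \<in> pverts G. lev x < lev y}"
        by (rule psubset_card_mono) (use u uV pair_finite_verts in auto)
      then obtain p where p: "walk (parcs G) u p t" "cost w p = lev t - lev u" using less.hyps uV by blast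
      show ?thesis using walk_Cons[OF p(1) u(1), of w] p(2) up[OF u] by auto
    qed
  qed
  have d: "wdist (parcs G) w x y = lev y - lev x"
    if wp: "walk (parcs G) x p y" and cp: "cost w p = lev y - lev x" for x y p
  proof -
    obtain q where "walk (parcs G) x q y" "cost w q = wdist (parcs G) w x y"
      using wdist_attained[OF wp arcs_pos pair_finite_arcs] by blast
    then show ?thesis using low[of x q y] wdist_le[OF wp arcs_pos pair_finite_arcs] cp by linarith
  qed
  have ds: "dist_G s x = ereal (lev x)" if "x \<in> pverts G" for x
    using from_s[OF that] dist_eq_wdist[OF _ source_in_verts] d[of s _ x] s0 by fastforce
  have dt: "dist_G x t = ereal (lev t - lev x)" if "x \<in> pverts G" for x
    using to_t[OF that] dist_eq_wdist[OF _ that] d[of x _ t] by fastforce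
  show "x \<in> pverts G \<Longrightarrow> dist_G s x = ereal (lev x)" by (rule ds)
  show "wdist (parcs G) w s t = lev t" "\<exists>p. walk (parcs G) s p t"
    using from_s[OF target_in_verts] d[of s _ t] s0 by fastforce+
  show "layered" unfolding layered_def
  proof (intro conjI ballI, goal_cases)
    case (1 u) then show ?case by (simp add: ds)
  next
    case (2 u) then show ?case by (simp add: dt)
  next
    case (3 u) then show ?case by (simp add: ds dt target_in_verts)
  next
    case (4 e)
    then show ?case using edge[of "fst e" "snd e"] in_arcsD1[of "fst e" "snd e"] in_arcsD2[of "fst e" "snd e"]
      by (cases e) (auto simp: ds)
  next
    case (5 e)
    then show ?case using edge[of "fst e" "snd e"] in_arcsD1[of "fst e" "snd e"] in_arcsD2[of "fst e" "snd e"]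
      by (cases e) (auto simp: ds)
  qed
qed

section \<open>Vertices, edges and walks of the layered graph\<close>

context reduction
begin

definition Good :: "'v set" where "Good = {x. good x}"
definition Lev :: "real set" where "Lev = ds ` Good"

definition nextl :: "real \<Rightarrow> real \<Rightarrow> bool" where
  "nextl l l' \<longleftrightarrow> l \<in> Lev \<and> l' \<in> Lev \<and> l < l' \<and> (\<forall>k\<in>Lev. k \<le> l \<or> l' \<le> k)"

fun lev :: "'v lvert \<Rightarrow> real" where
  "lev (Inl x) = ds x"
| "lev (Inr (e, l)) = l"

fun own :: "'v lvert \<Rightarrow> 'v" where
  "own (Inl x) = x"
| "own (Inr (e, l)) = fst e"

text \<open>The ends of an edge are represented by the original vertices, so chains of different
  tight edges meet exactly in good vertices. On a tight edge the two ends have different levels, and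
  the tests do not compete.\<close>

definition pt :: "'v \<times> 'v \<Rightarrow> real \<Rightarrow> 'v lvert" where
  "pt e l = (if l = ds (fst e) then Inl (fst e) else if l = ds (snd e) then Inl (snd e) else Inr (e, l))"

definition VA :: "'v lvert set" where
  "VA = Inl ` Good \<union> {Inr (e, l) |e l. e \<in> Tight \<and> l \<in> Lev \<and> ds (fst e) < l \<and> l < ds (snd e)}"

definition FAe :: "'v \<times> 'v \<Rightarrow> ('v lvert \<times> 'v lvert) set" where
  "FAe e = {(pt e l, pt e l') |l l'. nextl l l' \<and> ds (fst e) \<le> l \<and> l' \<le> ds (snd e)}"

definition FA :: "('v lvert \<times> 'v lvert) set" where
  "FA = (\<Union>e\<in>Tight. FAe e)"

text \<open>Strict descent keeps edges off a common level. All detours between the same two vertices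
  collapse to one edge, which keeps the graph simple.\<close>

definition BA :: "('v lvert \<times> 'v lvert) set" where
  "BA = {(Inl u, Inl v) |u v. good u \<and> good v \<and> ds v < ds u \<and> (\<exists>p. walk (Det v) u p v)}"

definition EA :: "('v lvert \<times> 'v lvert) set" where "EA = FA \<union> BA"

text \<open>The direction tells the two kinds of edges apart: forward edges rise by their weight,
  back-edges descend and cost a cheapest detour.\<close>

definition WA :: "'v lvert \<times> 'v lvert \<Rightarrow> real" where
  "WA e = (if lev (fst e) < lev (snd e) then lev (snd e) - lev (fst e)
    else detour (projl (fst e)) (projl (snd e)))"

lemma finGood: "finite Good"
proof (rule finite_subset)
  show "Good \<subseteq> insert s (snd ` E)"
    using tight_in unfolding Good_def Tight_def by (force intro: rev_image_eqI)
qed (use finE in auto)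

text \<open>Every good vertex other than \<open>s\<close> is the head of a tight edge. Having a
  bound by edges besides the one by vertices turns the quadratic number of back-edges into
  O(|V||E|).\<close>

lemma card_Good: "card Good \<le> card E + 1"
proof -
  have "Good \<subseteq> insert s (snd ` E)"
    using tight_in unfolding Good_def Tight_def by (force intro: rev_image_eqI)
  then have "card Good \<le> card (insert s (snd ` E))" using finE by (intro card_mono) auto
  also have "\<dots> \<le> card E + 1" using card_insert_le_m1 card_image_le[OF finE, of snd]
    by (metis Suc_eq_plus1 add.commute card_insert_if finE finite_imageI le_SucI not_less_eq_eq Suc_le_mono)
  finally show ?thesis .
qed

lemma finLev: "finite Lev" unfolding Lev_def using finGood by simp

lemma card_Lev: "card Lev \<le> card Good" unfolding Lev_def using finGood card_image_le by blast

lemma finTight: "finite Tight" using finE unfolding Tight_def by (auto elim: rev_finite_subset)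

lemma card_Tight: "card Tight \<le> card E" using finE unfolding Tight_def by (auto intro: card_mono)

lemma TightD: "(u, v) \<in> Tight \<Longrightarrow> good u \<and> good v \<and> (u, v) \<in> E \<and> w (u, v) = ds v - ds u \<and> ds u \<in> Lev \<and> ds
    v \<in> Lev"
  unfolding Tight_def Lev_def Good_def by auto

lemma nextl_ex:
  assumes "l \<in> Lev" "k \<in> Lev" "l < k"
  obtains l' where "nextl l l'" "l' \<le> k"
proof
  let ?M = "{k \<in> Lev. l < k}"
  have M: "finite ?M" "k \<in> ?M" using finLev assms by auto
  have "Min ?M \<in> ?M" using Min_in[OF M(1)] M(2) by blast
  moreover have "k' \<le> l \<or> Min ?M \<le> k'" if "k' \<in> Lev" for k'
    using M(1) that by (cases "k' \<le> l") (auto intro: Min_le)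
  ultimately show "nextl l (Min ?M)" using assms unfolding nextl_def by blast
  show "Min ?M \<le> k" using M by simp
qed

lemma prevl_ex:
  assumes "l \<in> Lev" "k \<in> Lev" "l < k"
  obtains l' where "nextl l' k" "l \<le> l'"
proof
  let ?M = "{l \<in> Lev. l < k}"
  have M: "finite ?M" "l \<in> ?M" using finLev assms by auto
  have "Max ?M \<in> ?M" using Max_in[OF M(1)] M(2) by blast
  moreover have "k' \<le> Max ?M \<or> k \<le> k'" if "k' \<in> Lev" for k'
    using M(1) that by (cases "k \<le> k'") (auto intro: Max_ge)
  ultimately show "nextl (Max ?M) k" using assms unfolding nextl_def by blast
  show "l \<le> Max ?M" using M by simp
qed

lemma nextl_unique: "nextl l a \<Longrightarrow> nextl l b \<Longrightarrow> a = b"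
  unfolding nextl_def by force

lemma lev_pt [simp]: "lev (pt e l) = l"
  by (simp add: pt_def)

lemma pt_in_VA: "e \<in> Tight \<Longrightarrow> l \<in> Lev \<Longrightarrow> ds (fst e) \<le> l \<Longrightarrow> l \<le> ds (snd e) \<Longrightarrow> pt e l \<in> VA"
  using TightD[of "fst e" "snd e"] by (cases e) (auto simp: pt_def VA_def Good_def)

lemma FA_next: "(a, b) \<in> FA \<Longrightarrow> nextl (lev a) (lev b)"
  unfolding FA_def FAe_def by auto

lemma BA_less: "(a, b) \<in> BA \<Longrightarrow> lev b < lev a"
  unfolding BA_def by auto

lemma EA_VA: "EA \<subseteq> VA \<times> VA"
proof -
  have "FA \<subseteq> VA \<times> VA" unfolding FA_def FAe_def
    by (auto intro!: pt_in_VA simp: nextl_def)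
  then show ?thesis unfolding EA_def BA_def by (auto simp: VA_def Good_def)
qed

lemma VA_lev: "a \<in> VA \<Longrightarrow> lev a \<in> Lev" by (auto simp: VA_def Lev_def)

lemma WA_FA: "(a, b) \<in> FA \<Longrightarrow> WA (a, b) = lev b - lev a"
  using FA_next by (simp add: WA_def nextl_def)

lemma WA_BA: "(Inl u, Inl v) \<in> BA \<Longrightarrow> WA (Inl u, Inl v) = detour u v"
  using BA_less[of "Inl u" "Inl v"] by (simp add: WA_def)

lemma WA_pos: "e \<in> EA \<Longrightarrow> 0 < WA e"
  unfolding EA_def
proof (elim UnE)
  assume "e \<in> FA" then show ?thesis using WA_FA[of "fst e" "snd e"] FA_next[of "fst e" "snd e"]
    by (simp add: nextl_def)
next
  assume e: "e \<in> BA"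
  then obtain u v p where "e = (Inl u, Inl v)" "walk (Det v) u p v" "ds v < ds u" unfolding BA_def by auto
  then show ?thesis using detour_pos[of v u p] WA_BA e by auto
qed

lemma FAeI: "e \<in> Tight \<Longrightarrow> nextl l l' \<Longrightarrow> ds (fst e) \<le> l \<Longrightarrow> l' \<le> ds (snd e) \<Longrightarrow> (pt e l, pt e l') \<in> FA"
  unfolding FA_def FAe_def by blast

text \<open>Every such point lies above the tail of some tight edge and not above its head: an
  incoming tight edge for a good vertex, its own edge for a subdivision point. The point of that
  edge one level below precedes it.\<close>

lemma FA_pred:
  assumes "a \<in> VA" "a \<noteq> Inl s"
  shows "\<exists>b. (b, a) \<in> FA"
proof -
  obtain e where e: "e \<in> Tight" "a = pt e (lev a)" "ds (fst e) < lev a" "lev a \<le> ds (snd e)"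
  proof (cases a)
    case (Inl x)
    then have "good x" "x \<noteq> s" using assms by (auto simp: VA_def Good_def)
    then obtain u where "(u, x) \<in> Tight" using tight_in by blast
    then show ?thesis using that[of "(u, x)"] tight_less[of u x] Inl by (auto simp: pt_def)
  next
    case (Inr z)
    then show ?thesis using assms that[of "fst z"] by (auto simp: VA_def pt_def)
  qed
  have "ds (fst e) \<in> Lev" using TightD[of "fst e" "snd e"] e(1) by simp
  then obtain l where "nextl l (lev a)" "ds (fst e) \<le> l" using prevl_ex e(3) VA_lev[OF assms(1)] by blast
  then show ?thesis using FAeI[OF e(1), of l "lev a"] e by auto
qed

lemma FA_succ:
  assumes "a \<in> VA" "a \<noteq> Inl t"
  shows "\<exists>b. (a, b) \<in> FA"
proof -
  obtain e where e: "e \<in> Tight" "a = pt e (lev a)" "ds (fst e) \<le> lev a" "lev a < ds (snd e)"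
  proof (cases a)
    case (Inl x)
    then have "good x" "x \<noteq> t" using assms by (auto simp: VA_def Good_def)
    then obtain u where "(x, u) \<in> Tight" using tight_out by blast
    then show ?thesis using that[of "(x, u)"] tight_less[of x u] Inl by (auto simp: pt_def)
  next
    case (Inr z)
    then show ?thesis using assms that[of "fst z"] by (auto simp: VA_def pt_def)
  qed
  have "ds (snd e) \<in> Lev" using TightD[of "fst e" "snd e"] e(1) by simp
  then obtain l where "nextl (lev a) l" "l \<le> ds (snd e)" using nextl_ex e(4) VA_lev[OF assms(1)] by blast
  then show ?thesis using FAeI[OF e(1), of "lev a" l] e by auto
qed

text \<open>When subdivided edges are contracted again, \<open>own a\<close> is the last vertex of the given graph visited
  by a walk that has reached \<open>a\<close>.\<close>

lemma EA_step:
  assumes "(a, b) \<in> EA"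
  shows "case b of
      Inr z \<Rightarrow> own b = own a \<and> WA (a, b) = lev b - lev a
    | Inl y \<Rightarrow> (own a, y) \<in> Tight \<and> WA (a, b) = ds y - lev a \<or>
        a = Inl (own a) \<and> ds y < ds (own a) \<and> good (own a) \<and> good y \<and>
        (\<exists>p. walk (Det y) (own a) p y) \<and> WA (a, b) = detour (own a) y"
  using assms unfolding EA_def
proof (elim UnE)
  assume ab: "(a, b) \<in> FA"
  then obtain e l l' where e: "e \<in> Tight" "a = pt e l" "b = pt e l'" "nextl l l'" "ds (fst e) \<le> l"
    "l' \<le> ds (snd e)" unfolding FA_def FAe_def by blast
  have "l < l'" using e(4) by (simp add: nextl_def)
  then have "own a = fst e" "b = Inl (snd e) \<or> b = Inr (e, l')" using e by (auto simp: pt_def)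
  then show ?thesis using WA_FA[OF ab] e(1) by (cases e) auto
next
  assume ab: "(a, b) \<in> BA"
  then obtain u v where uv: "a = Inl u" "b = Inl v" by (auto simp: BA_def)
  show ?thesis using WA_BA[of u v] ab uv by (auto simp: BA_def)
qed

text \<open>The start is an arbitrary level so that induction applies. The lower bound on levels
  gives distinctness within the chain; the clause on \<open>own\<close> separates it from the rest
  of a path, which never returns to the tail of \<open>e\<close>.\<close>

lemma chain:
  assumes "e \<in> Tight" "l \<in> Lev" "ds (fst e) \<le> l" "l < ds (snd e)"
  shows "\<exists>C. walk EA (pt e l) C (Inl (snd e)) \<and> distinct C \<and> cost WA C = ds (snd e) - l \<and>
    (\<forall>z\<in>set C. l \<le> lev z \<and> (z = Inl (snd e) \<or> own z = fst e))"
  using assms(2-)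
proof (induction "card {k \<in> Lev. l < k}" arbitrary: l rule: less_induct)
  case less
  have sl: "ds (snd e) \<in> Lev" using TightD[of "fst e" "snd e"] assms(1) by simp
  obtain l' where l': "nextl l l'" "l' \<le> ds (snd e)" using nextl_ex[OF less.prems(1) sl less.prems(3)] .
  have ll: "l < l'" "l' \<in> Lev" using l' by (auto simp: nextl_def)
  have ed: "(pt e l, pt e l') \<in> FA" using FAeI assms(1) l' less.prems by blast
  then have ed': "(pt e l, pt e l') \<in> EA" by (simp add: EA_def)
  have W: "WA (pt e l, pt e l') = l' - l" using WA_FA[OF ed] by simp
  have ow: "own (pt e l) = fst e" using less.prems by (simp add: pt_def)
  show ?case
  proof (cases "l' = ds (snd e)")
    case True
    have "fst e \<noteq> snd e" using tight_less[of "fst e" "snd e"] assms(1) by auto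
    then have "pt e l' = Inl (snd e)" "pt e l \<noteq> Inl (snd e)" using True ll less.prems
      by (auto simp: pt_def)
    then show ?thesis using ed' W True ow ll by (intro exI[of _ "[pt e l, pt e l']"]) auto
  next
    case False
    have "card {k \<in> Lev. l' < k} < card {k \<in> Lev. l < k}"
      by (rule psubset_card_mono) (use ll finLev in auto)
    then obtain C where C: "walk EA (pt e l') C (Inl (snd e))" "distinct C" "cost WA C = ds (snd e) - l'"
      "\<forall>z\<in>set C. l' \<le> lev z \<and> (z = Inl (snd e) \<or> own z = fst e)"
      using less.hyps[of l'] ll l' False less.prems by force
    have "pt e l \<notin> set C"
    proof
      assume "pt e l \<in> set C"
      then have "l' \<le> lev (pt e l)" using C(4) by blast
      then show False using ll by simp
    qed
    then show ?thesis using walk_Cons[OF C(1) ed', of WA] C W ow ll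
      by (intro exI[of _ "pt e l # C"]) (auto intro: order_trans)
  qed
qed

lemma path_dichotomy:
  assumes "walk E x q t" "good x" "distinct q"
  shows "(\<exists>u v a m b. good u \<and> good v \<and> u \<noteq> v \<and> ds u \<le> ds v \<and> walk E x a u \<and> walk (Det v) u m v \<and>
      walk E v b t \<and> cost w q = cost w a + cost w m + cost w b) \<or>
    (\<exists>P. walk EA (Inl x) P (Inl t) \<and> distinct P \<and> own ` set P \<subseteq> set q \<and>
      cost WA P \<le> cost w q \<and> ds t - ds x \<le> cost WA P \<and>
      (ds t - ds x < cost w q \<longrightarrow> ds t - ds x < cost WA P))"
  (is "?up x q \<or> ?lay x q")
  using assms
proof (induction "length q" arbitrary: q x rule: less_induct)
  case less
  show ?case
  proof (cases "x = t")
    case True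
    then have "q = [t]" using less.prems(1,3) walk_hd[OF less.prems(1)] walk_last[OF less.prems(1)]
      by (metis append_butlast_last_id distinct.simps(2) last_ConsR last_in_set list.distinct(1)
          snoc_eq_iff_butlast)
    then show ?thesis using True by (intro disjI2 exI[of _ "[Inl t]"]) auto
  next
    case False
    obtain q' where q': "q = x # q'" using walk_hd[OF less.prems(1)] by auto
    have "t \<in> set q'" using walk_ends_in[OF less.prems(1)] q' False by auto
    then have "\<exists>y\<in>set q'. good y" using good_t by auto
    \<comment> \<open>The first good vertex after \<open>x\<close>; one exists because
      \<open>t\<close> is good. So the vertices in \<open>bs\<close> are exactly the inner vertices
      of the segment, and none is good.\<close>
    then obtain bs y r where y: "q' = bs @ y # r" "good y" "\<forall>z\<in>set bs. \<not> good z"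
      using split_list_first_prop[of q' good] by blast
    have q: "q = (x # bs) @ y # r" using q' y by simp
    have W: "walk E x ((x # bs) @ [y]) y" "walk E y (y # r) t"
      using walk_splitD[OF less.prems(1)[unfolded q]] by auto
    have C: "cost w q = cost w ((x # bs) @ [y]) + cost w (y # r)" unfolding q by (rule cost_append)
    have xy: "x \<noteq> y" "x \<notin> set (y # r)" using less.prems(3) q by auto
    have IH: "?up y (y # r) \<or> ?lay y (y # r)"
      using less.hyps[of "y # r" y] W(2) y(2) less.prems(3) q by auto
    show ?thesis
    proof (cases "?up y (y # r)")
      case True
      then obtain u v a m b where *: "good u" "good v" "u \<noteq> v" "ds u \<le> ds v" "walk E y a u"
        "walk (Det v) u m v" "walk E v b t" "cost w (y # r) = cost w a + cost w m + cost w b" by blast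
      have "?up x q" using * walk_trans(1)[OF W(1) *(5)] walk_trans(2)[OF W(1) *(5), of w] C
        by (intro exI[of _ u] exI[of _ v] exI[of _ "((x # bs) @ [y]) @ tl a"] exI[of _ m] exI[of _ b]) simp
      then show ?thesis ..
    next
      case False
      then obtain P where P: "walk EA (Inl y) P (Inl t)" "distinct P" "own ` set P \<subseteq> set (y # r)"
        "cost WA P \<le> cost w (y # r)" "ds t - ds y \<le> cost WA P"
        "ds t - ds y < cost w (y # r) \<longrightarrow> ds t - ds y < cost WA P" using IH by blast
      obtain P' where P': "P = Inl y # P'" using walk_hd[OF P(1)] by auto
      show ?thesis
      proof (cases "(x, y) \<in> Tight \<and> bs = []")
        case True
        then have T: "(x, y) \<in> Tight" by simp
        have px: "pt (x, y) (ds x) = Inl x" by (simp add: pt_def)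
        obtain D where D: "walk EA (Inl x) D (Inl y)" "distinct D" "cost WA D = ds y - ds x"
          "\<forall>z\<in>set D. z = Inl y \<or> own z = x"
          using chain[OF T, of "ds x"] tight_less[OF T] TightD[OF T] px by auto
        have cxy: "cost w q = (ds y - ds x) + cost w (y # r)" using C True TightD[OF T] by simp
        have "z \<notin> set P'" if "z \<in> set D" for z
        proof
          assume z: "z \<in> set P'"
          then have "z \<noteq> Inl y" using P(2) P' by auto
          then have "own z = x" using D(4) that by blast
          moreover have "own z \<in> set (y # r)" using P(3) P' z by auto
          ultimately show False using xy(2) by simp
        qed
        then have "distinct (D @ tl P)" using D(2) P(2) P' by auto
        moreover have "own ` set (D @ tl P) \<subseteq> set q"
          using D(4) P(3) P' q by auto
        ultimately have "?lay x q" using walk_trans(1)[OF D(1) P(1)] walk_trans(2)[OF D(1) P(1), of WA]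
            cxy D(3) P(4-6) by (intro exI[of _ "D @ tl P"]) auto
        then show ?thesis ..
      next
        case notT: False
        have det: "walk (Det y) x ((x # bs) @ [y]) y"
        proof -
          \<comment> \<open>An edge with an end that is not good is never tight, so non-tightness
            has to be assumed only for a segment that is a single edge.\<close>
          have "walk (Det y) z (z # bs @ [y]) y"
            if "walk E z (z # bs @ [y]) y" "\<forall>z\<in>set bs. \<not> good z" "bs = [] \<longrightarrow> (z, y) \<notin> Tight" for z bs
            using that
          proof (induction bs arbitrary: z)
            case Nil then show ?case by (simp add: Det_def)
          next
            case (Cons c bs)
            then have "(z, c) \<in> Det y" "walk (Det y) c (c # bs @ [y]) y"
              using Cons.IH[of c] by (auto simp: Det_def Tight_def)
            then show ?case by simp
          qed
          then show ?thesis using W(1) y(3) notT by auto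
        qed
        show ?thesis
        proof (cases "ds x \<le> ds y")
          case True
          have "?up x q" using less.prems(2) y(2) xy(1) True det W(2) C
            by (intro exI[of _ x] exI[of _ y] exI[of _ "[x]"] exI[of _ "(x # bs) @ [y]"] exI[of _ "y #
                r"]) auto
          then show ?thesis ..
        next
          case False
          have B: "(Inl x, Inl y) \<in> BA" using False less.prems(2) y(2) det by (auto simp: BA_def)
          then have B': "(Inl x, Inl y) \<in> EA" by (simp add: EA_def)
          have WB: "WA (Inl x, Inl y) = detour x y" using WA_BA[OF B] .
          \<comment> \<open>The cheapest detour may cost less than the segment it replaces.
            Strictness is regained from the descent: a positive detour plus
            \<open>ds t - ds y\<close> already exceeds \<open>ds t - ds x\<close>.\<close>
          have "detour x y \<le> cost w ((x # bs) @ [y])" "0 < detour x y"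
            using detour_le[OF det] detour_pos[OF det xy(1)] by auto
          moreover have "Inl x \<notin> set P" using P(3) xy(2) by force
          moreover have "own ` set (Inl x # P) \<subseteq> set q" using P(3) q by auto
          ultimately have "?lay x q" using walk_Cons[OF P(1) B', of WA] WB P(2,4,5) False C
            by (intro exI[of _ "Inl x # P"]) auto
          then show ?thesis ..
        qed
      qed
    qed
  qed
qed

section \<open>Size of the layered graph\<close>

lemma finVA: "finite VA" and card_VA: "card VA \<le> card Good + card E * card Good"
proof -
  have sub: "VA \<subseteq> Inl ` Good \<union> Inr ` (Tight \<times> Lev)" by (auto simp: VA_def)
  have fin: "finite (Inl ` Good \<union> Inr ` (Tight \<times> Lev))" using finGood finTight finLev by auto
  then show "finite VA" using sub finite_subset by blast
  have "card VA \<le> card (Inl ` Good :: 'v lvert set) + card (Inr ` (Tight \<times> Lev) :: 'v lvert set)"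
    using card_mono[OF fin sub] card_Un_le order_trans by blast
  also have "\<dots> \<le> card Good + card Tight * card Lev"
    by (simp add: card_image inj_on_def card_cartesian_product)
  also have "\<dots> \<le> card Good + card E * card Good"
    using card_Tight card_Lev by (simp add: mult_le_mono)
  finally show "card VA \<le> card Good + card E * card Good" .
qed

text \<open>A forward edge is determined by its tight edge and the level of its tail, as the next
  level is unique. For pairs the level is shared, so it is counted once: this saves a factor |V| in
  the bound for \<open>E_FP\<close>.\<close>

lemma FA_image: "\<exists>h. FA \<subseteq> h ` (Tight \<times> Lev) \<and>
    {(x, y) \<in> FA \<times> FA. lev (fst x) = lev (fst y)} \<subseteq> (\<lambda>(l, e, e'). (h (e, l), h (e', l))) ` (Lev \<times> Tight
        \<times> Tight)"
proof -
  define h where "h = (\<lambda>(e, l). (pt e l, pt e (SOME l'. nextl l l')))"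
  have h: "h (e, l) = (pt e l, pt e l')" if "nextl l l'" for e l l'
    using that someI[of "nextl l" l'] nextl_unique unfolding h_def by auto
  have 1: "\<exists>e\<in>Tight. x = h (e, lev (fst x)) \<and> lev (fst x) \<in> Lev" if xF: "x \<in> FA" for x
  proof -
    obtain e l l' where e: "e \<in> Tight" "x = (pt e l, pt e l')" "nextl l l'"
      using xF unfolding FA_def FAe_def by blast
    then show ?thesis using h[OF e(3), of e] by (intro bexI[of _ e]) (auto simp: nextl_def)
  qed
  show ?thesis
  proof (intro exI[of _ h] conjI subsetI)
    fix x assume "x \<in> FA" then show "x \<in> h ` (Tight \<times> Lev)" using 1[of x] by blast
  next
    fix z assume "z \<in> {(x, y) \<in> FA \<times> FA. lev (fst x) = lev (fst y)}"
    then obtain x y where z: "z = (x, y)" "x \<in> FA" "y \<in> FA" "lev (fst x) = lev (fst y)" by auto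
    obtain e where e: "e \<in> Tight" "x = h (e, lev (fst x))" "lev (fst x) \<in> Lev" using 1[OF z(2)] by auto
    obtain e' where e': "e' \<in> Tight" "y = h (e', lev (fst y))" using 1[OF z(3)] by auto
    show "z \<in> (\<lambda>(l, e, e'). (h (e, l), h (e', l))) ` (Lev \<times> Tight \<times> Tight)"
      using e e' z(1,4) by (intro image_eqI[of _ _ "(lev (fst x), e, e')"]) auto
  qed
qed

lemma finFA: "finite FA" and card_FA: "card FA \<le> card E * card Good"
  and card_FP: "card {(x, y) \<in> FA \<times> FA. lev (fst x) = lev (fst y)} \<le> card Good * (card E * card E)"
proof -
  obtain h where h: "FA \<subseteq> h ` (Tight \<times> Lev)"
    "{(x, y) \<in> FA \<times> FA. lev (fst x) = lev (fst y)} \<subseteq> (\<lambda>(l, e, e'). (h (e, l), h (e', l))) ` (Lev \<times> Tight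
        \<times> Tight)"
    using FA_image by auto
  have fin: "finite (Tight \<times> Lev)" "finite (Lev \<times> Tight \<times> Tight)" using finTight finLev by auto
  then show "finite FA" using h(1) finite_subset by blast
  have "card FA \<le> card (Tight \<times> Lev)"
    using card_mono[OF _ h(1)] card_image_le[OF fin(1), of h] fin(1) by fastforce
  also have "\<dots> \<le> card E * card Good"
    using card_Tight card_Lev by (simp add: card_cartesian_product mult_le_mono)
  finally show "card FA \<le> card E * card Good" .
  have "card {(x, y) \<in> FA \<times> FA. lev (fst x) = lev (fst y)} \<le> card (Lev \<times> Tight \<times> Tight)"
    using surj_card_le[OF fin(2) h(2)] .
  also have "\<dots> \<le> card Good * (card E * card E)"
    using card_Tight card_Lev by (simp add: card_cartesian_product mult_le_mono)
  finally show "card {(x, y) \<in> FA \<times> FA. lev (fst x) = lev (fst y)} \<le> card Good * (card E * card E)" .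
qed

lemma finBA: "finite BA" and card_BA: "card BA \<le> card Good * card Good"
proof -
  have sub: "BA \<subseteq> (\<lambda>(u, v). (Inl u, Inl v)) ` (Good \<times> Good)" by (auto simp: BA_def Good_def)
  then show "finite BA" using finGood finite_subset by blast
  show "card BA \<le> card Good * card Good"
    using surj_card_le[OF _ sub] finGood by (simp add: card_cartesian_product)
qed

end

section \<open>Reasoning about programs\<close>

text \<open>A weakest precondition for total correctness whose postcondition also sees the step
  count, so that result and time are proved together. Determinism makes the rules for loop-free
  programs equations usable by the simplifier.\<close>

definition run :: "com \<Rightarrow> state \<Rightarrow> (nat \<Rightarrow> state \<Rightarrow> bool) \<Rightarrow> bool" where
  "run c \<sigma> Q \<longleftrightarrow> (\<exists>k \<sigma>'. exec c \<sigma> k \<sigma>' \<and> Q k \<sigma>')"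

inductive_cases SeqE: "exec (Seq c d) \<sigma> k \<sigma>'"
inductive_cases IfE: "exec (If b c d) \<sigma> k \<sigma>'"

lemma run_Skip [simp]: "run Skip \<sigma> Q \<longleftrightarrow> Q 1 \<sigma>"
  unfolding run_def using exec_Skip[of \<sigma>] exec_deterministic by blast

lemma run_NWrite [simp]: "run (NWrite a i x) \<sigma> Q \<longleftrightarrow> Q 1 (nwrite a (nval i \<sigma>) (nval x \<sigma>) \<sigma>)"
  unfolding run_def using exec_NWrite[of a i x \<sigma>] exec_deterministic by blast

lemma run_RWrite [simp]: "run (RWrite a i x) \<sigma> Q \<longleftrightarrow> Q 1 (rwrite a (nval i \<sigma>) (rval x \<sigma>) \<sigma>)"
  unfolding run_def using exec_RWrite[of a i x \<sigma>] exec_deterministic by blast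

lemma run_Seq [simp]: "run (Seq c d) \<sigma> Q \<longleftrightarrow> run c \<sigma> (\<lambda>k \<sigma>'. run d \<sigma>' (\<lambda>l. Q (k + l)))"
  unfolding run_def by (auto intro: exec.intros elim!: SeqE; blast intro: exec.intros)

lemma run_If [simp]:
  "run (If b c d) \<sigma> Q \<longleftrightarrow>
    (if bval b \<sigma> then run c \<sigma> (\<lambda>k. Q (1 + k)) else run d \<sigma> (\<lambda>k. Q (1 + k)))"
  unfolding run_def by (auto elim!: IfE) (metis exec_IfTrue exec_IfFalse plus_1_eq_Suc)+

lemma run_mono:
  "run c \<sigma> Q \<Longrightarrow> (\<And>k \<sigma>'. Q k \<sigma>' \<Longrightarrow> R k \<sigma>') \<Longrightarrow> run c \<sigma> R"
  unfolding run_def by blast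

lemma run_SeqI:
  "run c \<sigma> P \<Longrightarrow> (\<And>k \<sigma>'. P k \<sigma>' \<Longrightarrow> run d \<sigma>' (\<lambda>l. Q (k + l))) \<Longrightarrow> run (Seq c d) \<sigma> Q"
  unfolding run_Seq by (rule run_mono)

primrec nmods :: "com \<Rightarrow> nat set" where
  "nmods Skip = {}"
| "nmods (NWrite a i x) = {a}"
| "nmods (RWrite a i x) = {}"
| "nmods (Seq c d) = nmods c \<union> nmods d"
| "nmods (If b c d) = nmods c \<union> nmods d"
| "nmods (While b c) = nmods c"

primrec rmods :: "com \<Rightarrow> nat set" where
  "rmods Skip = {}"
| "rmods (NWrite a i x) = {}"
| "rmods (RWrite a i x) = {a}"
| "rmods (Seq c d) = rmods c \<union> rmods d"
| "rmods (If b c d) = rmods c \<union> rmods d"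
| "rmods (While b c) = rmods c"

text \<open>The frame condition, at the granularity of whole arrays and read off the program text.
  It lets facts about arrays that a subprogram does not mention as targets survive its
  execution.\<close>

definition keeps :: "com \<Rightarrow> state \<Rightarrow> state \<Rightarrow> bool" where
  "keeps c \<sigma> \<sigma>' \<longleftrightarrow>
    (\<forall>a. a \<notin> nmods c \<longrightarrow> nmem \<sigma>' a = nmem \<sigma> a) \<and> (\<forall>a. a \<notin> rmods c \<longrightarrow> rmem \<sigma>' a = rmem \<sigma> a)"

lemma nmem_nwrite [simp]: "nmem (nwrite a i x \<sigma>) b = (if b = a then (nmem \<sigma> a)(i := x) else nmem \<sigma> b)"
  by (simp add: nwrite_def)

lemma rmem_nwrite [simp]: "rmem (nwrite a i x \<sigma>) = rmem \<sigma>"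
  by (simp add: nwrite_def)

lemma rmem_rwrite [simp]: "rmem (rwrite a i x \<sigma>) b = (if b = a then (rmem \<sigma> a)(i := x) else rmem \<sigma> b)"
  by (simp add: rwrite_def)

lemma nmem_rwrite [simp]: "nmem (rwrite a i x \<sigma>) = nmem \<sigma>"
  by (simp add: rwrite_def)

lemma exec_keeps: "exec c \<sigma> k \<sigma>' \<Longrightarrow> keeps c \<sigma> \<sigma>'"
  unfolding keeps_def by (induction rule: exec.induct) auto

lemma run_keeps: "run c \<sigma> Q \<Longrightarrow> run c \<sigma> (\<lambda>k \<sigma>'. Q k \<sigma>' \<and> keeps c \<sigma> \<sigma>')"
  unfolding run_def using exec_keeps by blast

text \<open>The variant bounds the number of rounds. A round costs its body and one test; the final
  1 is the failing test.\<close>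

lemma run_While:
  assumes "I \<sigma>"
    and step: "\<And>\<sigma>. I \<sigma> \<Longrightarrow> bval b \<sigma> \<Longrightarrow> run c \<sigma> (\<lambda>k \<sigma>'. k \<le> T \<and> I \<sigma>' \<and> f \<sigma>' < f \<sigma>)"
  shows "run (While b c) \<sigma> (\<lambda>k \<sigma>'. k \<le> f \<sigma> * (T + 1) + 1 \<and> I \<sigma>' \<and> \<not> bval b \<sigma>')"
  using assms(1)
proof (induction "f \<sigma>" arbitrary: \<sigma> rule: less_induct)
  case less
  show ?case
  proof (cases "bval b \<sigma>")
    case False
    then have "exec (While b c) \<sigma> 1 \<sigma>" by (rule exec_WhileFalse)
    then show ?thesis using less.prems False unfolding run_def by force
  next
    case True
    obtain k \<sigma>1 where 1: "exec c \<sigma> k \<sigma>1" "k \<le> T" "I \<sigma>1" "f \<sigma>1 < f \<sigma>"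
      using step[OF less.prems True] unfolding run_def by auto
    obtain l \<sigma>2 where 2: "exec (While b c) \<sigma>1 l \<sigma>2" "l \<le> f \<sigma>1 * (T + 1) + 1" "I \<sigma>2" "\<not> bval b \<sigma>2"
      using less.hyps[OF 1(4,3)] unfolding run_def by auto
    have "(f \<sigma>1 + 1) * (T + 1) \<le> f \<sigma> * (T + 1)" using 1(4) by (intro mult_le_mono1) simp
    then have "1 + k + l \<le> f \<sigma> * (T + 1) + 1" using 1(2) 2(2) by simp
    then show ?thesis using exec_WhileTrue[OF True 1(1) 2(1)] 2(3,4) unfolding run_def by blast
  qed
qed

abbreviation sc :: "nat \<Rightarrow> nexp" where "sc a \<equiv> NRead a (NConst 0)"
abbreviation put :: "nat \<Rightarrow> nexp \<Rightarrow> com" where "put a x \<equiv> NWrite a (NConst 0) x"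

definition For :: "nat \<Rightarrow> nexp \<Rightarrow> com \<Rightarrow> com" where
  "For i e c = Seq (put i (NConst 0))
     (While (NLess (sc i) e) (Seq c (put i (NAdd (sc i) (NConst 1)))))"

lemma mods_For [simp]: "nmods (For i e c) = insert i (nmods c)" "rmods (For i e c) = rmods c"
  by (auto simp: For_def)

text \<open>\<open>e\<close> is evaluated anew in every test, so its value must be stable under
  everything the loop may change. In \<open>T + 2\<close> the extra steps are test and increment;
  the final 2 pays for the initialisation and the failing test.\<close>

lemma run_For:
  assumes bound: "\<And>\<sigma>. keeps (For i e c) \<sigma>0 \<sigma> \<Longrightarrow> nval e \<sigma> = N"
    and fresh: "i \<notin> nmods c"
    and init: "I 0 (nwrite i 0 0 \<sigma>0)"
    and step: "\<And>j \<sigma>. j < N \<Longrightarrow> I j \<sigma> \<Longrightarrow> nmem \<sigma> i 0 = j \<Longrightarrow> keeps (For i e c) \<sigma>0 \<sigma> \<Longrightarrow>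
      run c \<sigma> (\<lambda>k \<sigma>'. k \<le> T \<and> I (Suc j) (nwrite i 0 (Suc j) \<sigma>'))"
  shows "run (For i e c) \<sigma>0 (\<lambda>k \<sigma>'. k \<le> N * (T + 2) + 2 \<and> I N \<sigma>' \<and> keeps (For i e c) \<sigma>0 \<sigma>')"
proof -
  let ?b = "NLess (sc i) e" and ?c = "Seq c (put i (NAdd (sc i) (NConst 1)))"
  let ?I = "\<lambda>\<sigma>. nmem \<sigma> i 0 \<le> N \<and> I (nmem \<sigma> i 0) \<sigma> \<and> keeps (For i e c) \<sigma>0 \<sigma>"
  let ?f = "\<lambda>\<sigma>. N - nmem \<sigma> i 0"
  have "run (While ?b ?c) (nwrite i 0 0 \<sigma>0)
    (\<lambda>k \<sigma>'. k \<le> ?f (nwrite i 0 0 \<sigma>0) * ((T + 1) + 1) + 1 \<and> ?I \<sigma>' \<and> \<not> bval ?b \<sigma>')"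
  proof (rule run_While)
    show "?I (nwrite i 0 0 \<sigma>0)" using init by (simp add: keeps_def)
  next
    fix \<sigma> assume I: "?I \<sigma>" and b: "bval ?b \<sigma>"
    let ?j = "nmem \<sigma> i 0"
    have j: "?j < N" using b bound I by simp
    have "run c \<sigma> (\<lambda>k \<sigma>'. (k \<le> T \<and> I (Suc ?j) (nwrite i 0 (Suc ?j) \<sigma>')) \<and> keeps c \<sigma> \<sigma>')"
      by (rule run_keeps) (use step[OF j] I in auto)
    then show "run ?c \<sigma> (\<lambda>k \<sigma>'. k \<le> T + 1 \<and> ?I \<sigma>' \<and> ?f \<sigma>' < ?f \<sigma>)"
      unfolding run_Seq
    proof (rule run_mono)
      fix k \<sigma>' assume *: "(k \<le> T \<and> I (Suc ?j) (nwrite i 0 (Suc ?j) \<sigma>')) \<and> keeps c \<sigma> \<sigma>'"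
      then have "nmem \<sigma>' i 0 = ?j" using fresh by (simp add: keeps_def)
      then show "run (put i (NAdd (sc i) (NConst 1))) \<sigma>'
          (\<lambda>l \<sigma>'. k + l \<le> T + 1 \<and> ?I \<sigma>' \<and> ?f \<sigma>' < ?f \<sigma>)"
        using * I j by (auto simp: keeps_def)
    qed
  qed
  then show ?thesis unfolding For_def run_Seq run_NWrite nval.simps
    by (rule run_mono) (use bound in \<open>auto simp: For_def algebra_simps\<close>)
qed

abbreviation nz :: "nexp \<Rightarrow> bexp" where "nz x \<equiv> NLess (NConst 0) x"
abbreviation neq :: "nexp \<Rightarrow> nexp \<Rightarrow> bexp" where
  "neq x y \<equiv> Not (And (Not (NLess x y)) (Not (NLess y x)))"
abbreviation eqn :: "nexp \<Rightarrow> nexp \<Rightarrow> bexp" where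
  "eqn x y \<equiv> And (Not (NLess x y)) (Not (NLess y x))"
abbreviation Or :: "bexp \<Rightarrow> bexp \<Rightarrow> bexp" where "Or b c \<equiv> Not (And (Not b) (Not c))"

lemma not_less_both [simp]: "\<not> (x::nat) < y \<and> \<not> y < x \<longleftrightarrow> x = y" by auto

subsection \<open>Relocating the arrays of a program\<close>

primrec shiftn :: "nat \<Rightarrow> nexp \<Rightarrow> nexp" where
  "shiftn d (NConst k) = NConst k"
| "shiftn d (NRead a i) = NRead (a + d) (shiftn d i)"
| "shiftn d (NAdd x y) = NAdd (shiftn d x) (shiftn d y)"
| "shiftn d (NSub x y) = NSub (shiftn d x) (shiftn d y)"

primrec shiftr :: "nat \<Rightarrow> rexp \<Rightarrow> rexp" where
  "shiftr d RZero = RZero"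
| "shiftr d (RRead a i) = RRead (a + d) (shiftn d i)"
| "shiftr d (RAdd x y) = RAdd (shiftr d x) (shiftr d y)"
| "shiftr d (RSub x y) = RSub (shiftr d x) (shiftr d y)"

primrec shiftb :: "nat \<Rightarrow> bexp \<Rightarrow> bexp" where
  "shiftb d (NLess x y) = NLess (shiftn d x) (shiftn d y)"
| "shiftb d (RLess x y) = RLess (shiftr d x) (shiftr d y)"
| "shiftb d (Not b) = Not (shiftb d b)"
| "shiftb d (And b c) = And (shiftb d b) (shiftb d c)"

primrec shift :: "nat \<Rightarrow> com \<Rightarrow> com" where
  "shift d Skip = Skip"
| "shift d (NWrite a i x) = NWrite (a + d) (shiftn d i) (shiftn d x)"
| "shift d (RWrite a i x) = RWrite (a + d) (shiftn d i) (shiftr d x)"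
| "shift d (Seq c e) = Seq (shift d c) (shift d e)"
| "shift d (If b c e) = If (shiftb d b) (shift d c) (shift d e)"
| "shift d (While b c) = While (shiftb d b) (shift d c)"

definition view :: "nat \<Rightarrow> state \<Rightarrow> state" where
  "view d \<sigma> = \<lparr>nmem = \<lambda>a. nmem \<sigma> (a + d), rmem = \<lambda>a. rmem \<sigma> (a + d)\<rparr>"

lemma nval_shift [simp]: "nval (shiftn d x) \<sigma> = nval x (view d \<sigma>)"
  by (induction x) (auto simp: view_def)

lemma rval_shift [simp]: "rval (shiftr d x) \<sigma> = rval x (view d \<sigma>)"
  by (induction x) (auto simp: view_def)

lemma bval_shift [simp]: "bval (shiftb d x) \<sigma> = bval x (view d \<sigma>)"
  by (induction x) auto

lemma view_nwrite: "view d (nwrite (a + d) i x \<sigma>) = nwrite a i x (view d \<sigma>)"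
  by (auto simp: view_def nwrite_def fun_eq_iff)

lemma view_rwrite: "view d (rwrite (a + d) i x \<sigma>) = rwrite a i x (view d \<sigma>)"
  by (auto simp: view_def rwrite_def fun_eq_iff)

text \<open>The relocated program sees memory only through \<open>view d\<close>, where it behaves
  like the original, step by step. Together with \<open>mods_shift\<close> it can be called as a
  subroutine while the caller keeps its arrays below \<open>d\<close>.\<close>

lemma exec_shift:
  "exec c \<sigma>0 k \<sigma>1 \<Longrightarrow> view d \<sigma> = \<sigma>0 \<Longrightarrow> \<exists>\<sigma>'. exec (shift d c) \<sigma> k \<sigma>' \<and> view d \<sigma>' = \<sigma>1"
proof (induction arbitrary: \<sigma> rule: exec.induct)
  case exec_Skip then show ?case by (auto intro: exec.intros simp del: One_nat_def)
next
  case (exec_NWrite a i x \<sigma>0)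
  then show ?case
    using exec.exec_NWrite[of "a + d" "shiftn d i" "shiftn d x" \<sigma>] by (auto simp: view_nwrite)
next
  case (exec_RWrite a i x \<sigma>0)
  then show ?case
    using exec.exec_RWrite[of "a + d" "shiftn d i" "shiftr d x" \<sigma>] by (auto simp: view_rwrite)
next
  case exec_Seq then show ?case by simp (metis exec.exec_Seq)
next
  case exec_IfTrue then show ?case by (metis bval_shift shift.simps(5) exec.exec_IfTrue)
next
  case exec_IfFalse then show ?case by (metis bval_shift shift.simps(5) exec.exec_IfFalse)
next
  case exec_WhileFalse then show ?case by (metis bval_shift shift.simps(6) exec.exec_WhileFalse)
next
  case exec_WhileTrue then show ?case by (metis bval_shift shift.simps(6) exec.exec_WhileTrue)
qed

lemma mods_shift: "a < d \<Longrightarrow> a \<notin> nmods (shift d c) \<and> a \<notin> rmods (shift d c)"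
  by (induction c) auto

declare One_nat_def [simp del]

lemma add_one_nat [simp]: "(x::nat) + 1 = Suc x" "1 + x = Suc x" by auto

section \<open>Shortest walks to a target on the machine\<close>

abbreviation (input) "aMode \<equiv> 4 :: nat"
abbreviation (input) "aTarget \<equiv> 5 :: nat"
abbreviation (input) "aReach \<equiv> 6 :: nat"
abbreviation (input) "aNext \<equiv> 7 :: nat"
abbreviation (input) "aI \<equiv> 8 :: nat"
abbreviation (input) "aK \<equiv> 9 :: nat"
abbreviation (input) "aJ \<equiv> 10 :: nat"
abbreviation (input) "aFromS \<equiv> 11 :: nat"
abbreviation (input) "aGood \<equiv> 12 :: nat"
abbreviation (input) "aTight \<equiv> 13 :: nat"
abbreviation (input) "aCount \<equiv> 14 :: nat"
abbreviation (input) "aCur \<equiv> 15 :: nat"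
abbreviation (input) "rDist \<equiv> 1 :: nat"

abbreviation (input) "xN \<equiv> NRead 0 (NConst 0)"
abbreviation (input) "xM \<equiv> NRead 0 (NConst 1)"
abbreviation (input) "xS \<equiv> NRead 0 (NConst 2)"
abbreviation (input) "xT \<equiv> NRead 0 (NConst 3)"
abbreviation (input) "tailOf j \<equiv> NRead 1 (sc j)"
abbreviation (input) "headOf j \<equiv> NRead 2 (sc j)"

text \<open>In mode 0 all edges are usable; in mode 1 only edges that are not marked tight and whose head
  is the target or not marked good. Initially no mark is set.\<close>

definition relax :: com where
  "relax = If (And
      (And (NLess (NAdd (sc aMode) (NRead aTight (sc aJ))) (NConst 2))
        (Or (eqn (headOf aJ) (sc aTarget)) (NLess (NAdd (sc aMode) (NRead aGood (headOf aJ))) (NConst 2))))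
      (And (nz (NRead aReach (headOf aJ)))
        (Or (Not (nz (NRead aReach (tailOf aJ))))
          (RLess (RAdd (RRead 0 (sc aJ)) (RRead rDist (headOf aJ))) (RRead rDist (tailOf aJ))))))
    (Seq (NWrite aReach (tailOf aJ) (NConst 1))
      (Seq (RWrite rDist (tailOf aJ) (RAdd (RRead 0 (sc aJ)) (RRead rDist (headOf aJ))))
        (NWrite aNext (tailOf aJ) (headOf aJ))))
    Skip"

text \<open>Bellman-Ford run backwards: labels are distances to the target, so the pointers in
  \<open>aNext\<close> produce a path in the order in which it has to be written.\<close>

definition dist_to :: com where
  "dist_to = Seq (For aI xN (NWrite aReach (sc aI) (NConst 0)))
     (Seq (NWrite aReach (sc aTarget) (NConst 1))
     (Seq (RWrite rDist (sc aTarget) RZero)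
       (For aK xN (For aJ xM relax))))"

text \<open>The starting vertex is not written, so successive calls concatenate walks without
  doubling the joints. Cell 0 of array 3 is reserved for the length, hence \<open>aCount\<close> is
  also the position of the last vertex written.\<close>

definition chase :: com where
  "chase = While (neq (sc aCur) (sc aTarget))
     (Seq (put aCur (NRead aNext (sc aCur)))
     (Seq (put aCount (NAdd (sc aCount) (NConst 1)))
       (NWrite 3 (sc aCount) (sc aCur))))"

lemma mods_relax [simp]: "nmods relax = {aReach, aNext}" "rmods relax = {rDist}"
  by (auto simp: relax_def)

lemma mods_dist_to [simp]: "nmods dist_to = {aI, aReach, aK, aJ, aNext}" "rmods dist_to = {rDist}"
  by (auto simp: dist_to_def)

lemma mods_chase [simp]: "nmods chase = {aCur, aCount, 3}" "rmods chase = {}"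
  by (auto simp: chase_def)

definition outl :: "state \<Rightarrow> nat list \<Rightarrow> bool" where
  "outl \<sigma> xs \<longleftrightarrow> nmem \<sigma> aCount 0 = length xs \<and> (\<forall>i<length xs. nmem \<sigma> 3 (Suc i) = xs ! i)"

section \<open>Correctness of the distance computation and of path recovery\<close>

locale instance_data =
  fixes n :: nat and es :: "(nat \<times> nat) list" and w :: "nat \<times> nat \<Rightarrow> real" and s t :: nat
  assumes es_verts: "set es \<subseteq> {..<n} \<times> {..<n}" and es_distinct: "distinct es"
    and es_pos: "\<forall>e\<in>set es. 0 < w e" and es_irrefl: "(x, x) \<notin> set es"
    and s_less: "s < n" and t_less: "t < n"
begin

text \<open>Invariant of the Bellman-Ford iteration with target \<open>v\<close> after \<open>k\<close> full rounds and \<open>j\<close>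
  relaxations of the next one. Relaxation is in place, so the pointers \<open>N\<close> only satisfy an
  inequality until the distances are final.\<close>

definition bf_inv :: "(nat \<times> nat) set \<Rightarrow> nat \<Rightarrow> nat \<Rightarrow> nat \<Rightarrow> (nat \<Rightarrow> nat) \<Rightarrow> (nat \<Rightarrow> real) \<Rightarrow> (nat \<Rightarrow> nat) \<Rightarrow>
    bool" where
  "bf_inv F v k j R D N \<longleftrightarrow>
    (\<forall>x<n. R x \<noteq> 0 \<longrightarrow> (\<exists>p. walk F x p v \<and> cost w p = D x)) \<and>
    (\<forall>x p. walk F x p v \<longrightarrow> length p \<le> k + 1 \<or> length p = k + 2 \<and> (\<exists>i<j. es ! i = (p ! 0, p ! 1)) \<longrightarrow>
      R x \<noteq> 0 \<and> D x \<le> cost w p) \<and>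
    (\<forall>x<n. R x \<noteq> 0 \<longrightarrow> x \<noteq> v \<longrightarrow> (x, N x) \<in> F \<and> R (N x) \<noteq> 0 \<and> w (x, N x) + D (N x) \<le> D x) \<and>
    R v \<noteq> 0 \<and> D v = 0"

lemma bf_inv_init:
  assumes "v < n" "\<And>x. x < n \<Longrightarrow> R x \<noteq> 0 \<longleftrightarrow> x = v" "D v = 0"
  shows "bf_inv F v 0 0 R D N"
proof -
  have *: "p = [x] \<and> x = v" if "walk F x p v" "length p \<le> 1" for x p
    using that by (cases p) auto
  show ?thesis unfolding bf_inv_def using assms
    by (auto intro!: exI[of _ "[v]"] dest: *)
qed

text \<open>Labels only decrease, which preserves the bounds already reached and the pointer
  inequalities. The new walks to be covered are those with \<open>k + 1\<close> edges that start
  with edge \<open>j\<close>.\<close>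

lemma bf_inv_relax:
  assumes F: "F \<subseteq> set es" and inv: "bf_inv F v k j R D N" and j: "j < length es" and v: "v < n"
    and e: "es ! j = (a, b)"
    and upd: "R' = R(a := 1)" "D' = D(a := w (a, b) + D b)" "N' = N(a := b)"
    and c: "c \<longleftrightarrow> (a, b) \<in> F \<and> R b \<noteq> 0 \<and> (R a = 0 \<or> w (a, b) + D b < D a)"
  shows "if c then bf_inv F v k (Suc j) R' D' N' else bf_inv F v k (Suc j) R D N"
proof -
  have ab: "(a, b) \<in> set es" using e j nth_mem by metis
  then have an: "a < n" "b < n" "a \<noteq> b" and wab: "0 < w (a, b)"
    using es_verts es_irrefl es_pos by auto
  have i1: "\<exists>p. walk F x p v \<and> cost w p = D x" if "x < n" "R x \<noteq> 0" for x
    using inv that unfolding bf_inv_def by blast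
  have i2: "R x \<noteq> 0 \<and> D x \<le> cost w p"
    if "walk F x p v" "length p \<le> k + 1 \<or> length p = k + 2 \<and> (\<exists>i<j. es ! i = (p ! 0, p ! 1))" for x p
    using inv that unfolding bf_inv_def by blast
  have i3: "(x, N x) \<in> F \<and> R (N x) \<noteq> 0 \<and> w (x, N x) + D (N x) \<le> D x" if "x < n" "R x \<noteq> 0" "x \<noteq> v" for x
    using inv that unfolding bf_inv_def by blast
  have i4: "R v \<noteq> 0" "D v = 0" using inv unfolding bf_inv_def by auto
  have Fpos: "\<forall>e\<in>F. 0 < w e" using F es_pos by auto
  have Dge: "0 \<le> D x" if "x < n" "R x \<noteq> 0" for x
    using i1[OF that] cost_nonneg[OF _ Fpos] by metis
  \<comment> \<open>Without its first edge such a walk has \<open>k\<close> edges, so the label of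
    \<open>b\<close> is already at most the cost of the rest.\<close>
  have split: "(\<exists>q. p = a # b # q \<and> (a, b) \<in> F \<and> R b \<noteq> 0 \<and> w (a, b) + D b \<le> cost w p) \<and> x = a"
    if wp: "walk F x p v" and l: "length p = k + 2" and ep: "es ! j = (p ! 0, p ! 1)" for x p
  proof -
    obtain a' b' q where p: "p = a' # b' # q" using l by (cases p; cases "tl p") auto
    then have "a' = a" "b' = b" using ep e by auto
    moreover have "R b \<noteq> 0 \<and> D b \<le> cost w (b # q)" using i2[of b "b # q"] wp l p calculation by auto
    ultimately show ?thesis using p wp by auto
  qed
  show ?thesis
  proof (cases c)
    case False
    have "R x \<noteq> 0 \<and> D x \<le> cost w p"
      if wp: "walk F x p v" and l: "length p \<le> k + 1 \<or> length p = k + 2 \<and> (\<exists>i<Suc j. es ! i = (p ! 0, p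
          ! 1))" for x p
    proof (cases "length p \<le> k + 1 \<or> length p = k + 2 \<and> (\<exists>i<j. es ! i = (p ! 0, p ! 1))")
      case True then show ?thesis using i2[OF wp] by blast
    next
      case f: False
      then have "length p = k + 2" "es ! j = (p ! 0, p ! 1)" using l less_Suc_eq by auto
      then show ?thesis using split[OF wp] False c by auto
    qed
    then show ?thesis using False i1 i3 i4 unfolding bf_inv_def by auto
  next
    case True
    then have cc: "(a, b) \<in> F" "R b \<noteq> 0" "R a = 0 \<or> w (a, b) + D b < D a" using c by auto
    \<comment> \<open>The label of the target is 0 and cannot be improved, since labels are
      nonnegative and weights positive.\<close>
    have av: "a \<noteq> v" using cc(3) i4 Dge[OF an(2) cc(2)] wab by auto
    have 1: "\<exists>p. walk F x p v \<and> cost w p = D' x" if "x < n" "R' x \<noteq> 0" for x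
    proof (cases "x = a")
      case True
      obtain p where "walk F b p v" "cost w p = D b" using i1[OF an(2) cc(2)] by auto
      then show ?thesis using walk_Cons[of F b p v a w] cc(1) True upd by auto
    qed (use i1[of x] that upd in auto)
    have le: "R x \<noteq> 0 \<Longrightarrow> D' x \<le> D x" "R x \<noteq> 0 \<Longrightarrow> R' x \<noteq> 0" for x using upd cc(3) by auto
    have 2: "R' x \<noteq> 0 \<and> D' x \<le> cost w p"
      if wp: "walk F x p v" and l: "length p \<le> k + 1 \<or> length p = k + 2 \<and> (\<exists>i<Suc j. es ! i = (p ! 0, p
          ! 1))" for x p
    proof (cases "length p \<le> k + 1 \<or> length p = k + 2 \<and> (\<exists>i<j. es ! i = (p ! 0, p ! 1))")
      case True then show ?thesis using i2[OF wp] le[of x] by fastforce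
    next
      case f: False
      then have "length p = k + 2" "es ! j = (p ! 0, p ! 1)" using l less_Suc_eq by auto
      then show ?thesis using split[OF wp] upd by auto
    qed
    have 3: "(x, N' x) \<in> F \<and> R' (N' x) \<noteq> 0 \<and> w (x, N' x) + D' (N' x) \<le> D' x"
      if "x < n" "R' x \<noteq> 0" "x \<noteq> v" for x
    proof (cases "x = a")
      case True then show ?thesis using cc upd an by auto
    next
      case False
      then show ?thesis using i3[of x] that upd le[of "N x"] by fastforce
    qed
    show ?thesis using True 1 2 3 i4 av upd unfolding bf_inv_def by auto
  qed
qed

lemma bf_inv_round:
  assumes F: "F \<subseteq> set es" and inv: "bf_inv F v k (length es) R D N"
  shows "bf_inv F v (Suc k) 0 R D N"
proof -
  have "\<exists>i<length es. es ! i = (p ! 0, p ! 1)" if wp: "walk F x p v" and l: "length p = k + 2" for x p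
  proof -
    obtain a b q where p: "p = a # b # q" using l by (cases p; cases "tl p") auto
    then have "(a, b) \<in> set es" using wp F by auto
    then show ?thesis using p by (auto simp: in_set_conv_nth)
  qed
  then show ?thesis using inv unfolding bf_inv_def
    by (simp add: le_Suc_eq)
qed

definition dist_spec :: "(nat \<times> nat) set \<Rightarrow> nat \<Rightarrow> (nat \<Rightarrow> nat) \<Rightarrow> (nat \<Rightarrow> real) \<Rightarrow> (nat \<Rightarrow> nat) \<Rightarrow> bool" where
  "dist_spec F v R D N \<longleftrightarrow> (\<forall>x<n. (R x \<noteq> 0 \<longleftrightarrow> (\<exists>p. walk F x p v)) \<and>
    (R x \<noteq> 0 \<longrightarrow> D x = wdist F w x v \<and>
      (x \<noteq> v \<longrightarrow> (x, N x) \<in> F \<and> R (N x) \<noteq> 0 \<and> D x = w (x, N x) + D (N x))))"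

text \<open>A path has at most \<open>n\<close> vertices, so after \<open>n\<close> rounds no label
  exceeds a distance, and labels are costs of walks. The pointer inequality becomes an equality
  because its left side is the cost of a walk as well.\<close>

lemma bf_inv_final:
  assumes F: "F \<subseteq> set es" and inv: "bf_inv F v n 0 R D N"
  shows "dist_spec F v R D N"
proof -
  have Fpos: "\<forall>e\<in>F. 0 < w e" and fin: "finite F" using F es_pos finite_subset by auto
  have i1: "\<exists>p. walk F x p v \<and> cost w p = D x" if "x < n" "R x \<noteq> 0" for x
    using inv that unfolding bf_inv_def by blast
  have i3: "(x, N x) \<in> F \<and> R (N x) \<noteq> 0 \<and> w (x, N x) + D (N x) \<le> D x" if "x < n" "R x \<noteq> 0" "x \<noteq> v" for x
    using inv that unfolding bf_inv_def by blast
  have low: "R x \<noteq> 0 \<and> D x \<le> cost w p" if x: "x < n" and p: "walk F x p v" for x p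
  proof -
    obtain q where q: "walk F x q v" "distinct q" "cost w q \<le> cost w p"
      using walk_to_path[OF p Fpos] by auto
    have "set q \<subseteq> {..<n}" using walk_verts[OF q(1), of "{..<n}"] F es_verts x by auto
    then have "length q \<le> n" using q(2) card_mono[of "{..<n}" "set q"] by (simp add: distinct_card)
    then have "R x \<noteq> 0 \<and> D x \<le> cost w q" using inv q(1) unfolding bf_inv_def by fastforce
    then show ?thesis using q(3) by simp
  qed
  have D: "D x = wdist F w x v" if x: "x < n" "R x \<noteq> 0" for x
  proof -
    obtain p where p: "walk F x p v" "cost w p = D x" using i1 x by blast
    obtain q where q: "walk F x q v" "cost w q = wdist F w x v" using wdist_attained[OF p(1) Fpos fin]
        by blast
    show ?thesis using wdist_le[OF p(1) Fpos fin] p(2) low[OF x(1) q(1)] q(2) by simp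
  qed
  have "D x = w (x, N x) + D (N x)" if x: "x < n" "R x \<noteq> 0" "x \<noteq> v" for x
  proof -
    note N = i3[OF x]
    have "N x < n" using N F es_verts by auto
    then obtain p where "walk F (N x) p v" "cost w p = D (N x)" using i1 N by blast
    then show ?thesis using walk_Cons[of F "N x" p v x w] N low[OF x(1), of "x # p"] by auto
  qed
  then show ?thesis unfolding dist_spec_def using D i1 i3 low by blast
qed

definition inp :: "state \<Rightarrow> bool" where
  "inp \<sigma> \<longleftrightarrow> nmem \<sigma> 0 0 = n \<and> nmem \<sigma> 0 1 = length es \<and> nmem \<sigma> 0 2 = s \<and> nmem \<sigma> 0 3 = t \<and>
    (\<forall>j<length es. nmem \<sigma> 1 j = fst (es ! j) \<and> nmem \<sigma> 2 j = snd (es ! j) \<and> rmem \<sigma> 0 j = w (es ! j))"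

definition usable :: "state \<Rightarrow> (nat \<times> nat) set" where
  "usable \<sigma> = {es ! j |j. j < length es \<and> nmem \<sigma> aMode 0 + nmem \<sigma> aTight j < 2 \<and>
    (snd (es ! j) = nmem \<sigma> aTarget 0 \<or> nmem \<sigma> aMode 0 + nmem \<sigma> aGood (snd (es ! j)) < 2)}"


lemma inp_cong:
  "nmem \<sigma>' 0 = nmem \<sigma> 0 \<Longrightarrow> nmem \<sigma>' 1 = nmem \<sigma> 1 \<Longrightarrow> nmem \<sigma>' 2 = nmem \<sigma> 2 \<Longrightarrow> rmem \<sigma>' 0 = rmem \<sigma> 0 \<Longrightarrow>
    inp \<sigma>' \<longleftrightarrow> inp \<sigma>"
  by (simp add: inp_def)

lemma usable_cong:
  "nmem \<sigma>' aMode = nmem \<sigma> aMode \<Longrightarrow> nmem \<sigma>' aTarget = nmem \<sigma> aTarget \<Longrightarrow>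
    nmem \<sigma>' aTight = nmem \<sigma> aTight \<Longrightarrow> nmem \<sigma>' aGood = nmem \<sigma> aGood \<Longrightarrow> usable \<sigma>' = usable \<sigma>"
  by (simp add: usable_def)

lemma usable_sub: "usable \<sigma> \<subseteq> set es" by (auto simp: usable_def)

lemma run_relax:
  assumes "inp \<sigma>" "j < length es" "nmem \<sigma> aJ 0 = j" "v = nmem \<sigma> aTarget 0" "v < n"
    and inv: "bf_inv (usable \<sigma>) v k j (nmem \<sigma> aReach) (rmem \<sigma> rDist) (nmem \<sigma> aNext)"
  shows "run relax \<sigma> (\<lambda>l \<sigma>'. l \<le> 4 \<and>
    bf_inv (usable \<sigma>) v k (Suc j) (nmem \<sigma>' aReach) (rmem \<sigma>' rDist) (nmem \<sigma>' aNext))"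
proof -
  obtain a b where e: "es ! j = (a, b)" by fastforce
  have ab: "a \<noteq> b" using es_irrefl nth_mem[OF assms(2)] e by auto
  have io: "nmem \<sigma> 1 j = a" "nmem \<sigma> 2 j = b" "rmem \<sigma> 0 j = w (a, b)" using assms(1,2) e by (auto simp:
      inp_def)
  \<comment> \<open>\<open>usable\<close> is a set of edges whereas \<open>aTight\<close> marks
    positions; distinctness of the edge list identifies the two.\<close>
  have us: "(a, b) \<in> usable \<sigma> \<longleftrightarrow> nmem \<sigma> aMode 0 + nmem \<sigma> aTight j < 2 \<and>
    (b = v \<or> nmem \<sigma> aMode 0 + nmem \<sigma> aGood b < 2)"
    using assms(2,4) e es_distinct unfolding usable_def
    by (auto simp: nth_eq_iff_index_eq) (metis nth_eq_iff_index_eq snd_conv)+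
  let ?c = "(a, b) \<in> usable \<sigma> \<and> nmem \<sigma> aReach b \<noteq> 0 \<and>
    (nmem \<sigma> aReach a = 0 \<or> w (a, b) + rmem \<sigma> rDist b < rmem \<sigma> rDist a)"
  note bf = bf_inv_relax[OF usable_sub inv assms(2,5) e refl refl refl, of ?c]
  show ?thesis
  proof (cases ?c)
    case True
    then show ?thesis using bf ab assms(3,4) unfolding us by (simp add: relax_def io)
  next
    case False
    then show ?thesis using bf ab assms(3,4) unfolding us by (auto simp: relax_def io)
  qed
qed

text \<open>With \<open>m\<close> edges the steps add up to at most
  \<open>6 * m * n + 7 * n + 6\<close>. As \<open>n\<close> is positive, the constant 20 leaves
  ample room.\<close>

definition tD :: nat where "tD = 20 * (n * (length es + 1))"

lemma n_pos: "0 < n" using s_less by simp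

lemma run_dist_to:
  assumes i: "inp \<sigma>" and v: "nmem \<sigma> aTarget 0 < n"
  shows "run dist_to \<sigma> (\<lambda>l \<sigma>'. l \<le> tD \<and>
    dist_spec (usable \<sigma>) (nmem \<sigma> aTarget 0) (nmem \<sigma>' aReach) (rmem \<sigma>' rDist) (nmem \<sigma>' aNext) \<and>
    keeps dist_to \<sigma> \<sigma>')"
proof -
  let ?v = "nmem \<sigma> aTarget 0" and ?F = "usable \<sigma>" and ?m = "length es"
  have "run (For aI xN (NWrite aReach (sc aI) (NConst 0))) \<sigma>
    (\<lambda>l \<sigma>'. l \<le> n * (1 + 2) + 2 \<and> (\<forall>x<n. nmem \<sigma>' aReach x = 0) \<and>
      keeps (For aI xN (NWrite aReach (sc aI) (NConst 0))) \<sigma> \<sigma>')"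
    by (rule run_For[where I = "\<lambda>j \<sigma>. \<forall>x<j. nmem \<sigma> aReach x = 0"]) (use i in \<open>auto simp: keeps_def
        inp_def less_Suc_eq\<close>)
  note init = this
  have rounds: "run (For aK xN (For aJ xM relax)) \<tau>
      (\<lambda>l \<sigma>'. l \<le> n * ((?m * (4 + 2) + 2) + 2) + 2 \<and>
        bf_inv ?F ?v n 0 (nmem \<sigma>' aReach) (rmem \<sigma>' rDist) (nmem \<sigma>' aNext) \<and>
        keeps (For aK xN (For aJ xM relax)) \<tau> \<sigma>')"
    if \<tau>: "inp \<tau>" "usable \<tau> = ?F" "nmem \<tau> aTarget = nmem \<sigma> aTarget"
      "bf_inv ?F ?v 0 0 (nmem \<tau> aReach) (rmem \<tau> rDist) (nmem \<tau> aNext)" for \<tau>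
  proof (rule run_For[where I = "\<lambda>k \<sigma>. bf_inv ?F ?v k 0 (nmem \<sigma> aReach) (rmem \<sigma> rDist) (nmem \<sigma> aNext)"])
    fix k \<tau>1
    assume k: "k < n" "bf_inv ?F ?v k 0 (nmem \<tau>1 aReach) (rmem \<tau>1 rDist) (nmem \<tau>1 aNext)"
      "nmem \<tau>1 aK 0 = k" "keeps (For aK xN (For aJ xM relax)) \<tau> \<tau>1"
    have 1: "inp \<tau>1" "usable \<tau>1 = ?F" "nmem \<tau>1 aTarget 0 = ?v"
      using k(4) \<tau> inp_cong[of \<tau>1 \<tau>] usable_cong[of \<tau>1 \<tau>] by (auto simp: keeps_def)
    have "run (For aJ xM relax) \<tau>1 (\<lambda>l \<sigma>'. l \<le> ?m * (4 + 2) + 2 \<and>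
        bf_inv ?F ?v k ?m (nmem \<sigma>' aReach) (rmem \<sigma>' rDist) (nmem \<sigma>' aNext) \<and>
        keeps (For aJ xM relax) \<tau>1 \<sigma>')"
    proof (rule run_For[where I = "\<lambda>j \<sigma>. bf_inv ?F ?v k j (nmem \<sigma> aReach) (rmem \<sigma> rDist) (nmem \<sigma> aNext)"])
      fix j \<tau>2
      assume j: "j < ?m" "bf_inv ?F ?v k j (nmem \<tau>2 aReach) (rmem \<tau>2 rDist) (nmem \<tau>2 aNext)"
        "nmem \<tau>2 aJ 0 = j" "keeps (For aJ xM relax) \<tau>1 \<tau>2"
      have 2: "inp \<tau>2" "usable \<tau>2 = ?F" "nmem \<tau>2 aTarget 0 = ?v"
        using j(4) 1 inp_cong[of \<tau>2 \<tau>1] usable_cong[of \<tau>2 \<tau>1] by (auto simp: keeps_def)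
      then show "run relax \<tau>2 (\<lambda>l \<sigma>'. l \<le> 4 \<and>
          bf_inv ?F ?v k (Suc j) (nmem (nwrite aJ 0 (Suc j) \<sigma>') aReach)
            (rmem (nwrite aJ 0 (Suc j) \<sigma>') rDist) (nmem (nwrite aJ 0 (Suc j) \<sigma>') aNext))"
        using run_relax[OF 2(1) j(1,3), of ?v k] j(2) v by simp
    qed (use 1 k in \<open>auto simp: keeps_def inp_def\<close>)
    then show "run (For aJ xM relax) \<tau>1 (\<lambda>l \<sigma>'. l \<le> ?m * (4 + 2) + 2 \<and>
        bf_inv ?F ?v (Suc k) 0 (nmem (nwrite aK 0 (Suc k) \<sigma>') aReach)
          (rmem (nwrite aK 0 (Suc k) \<sigma>') rDist) (nmem (nwrite aK 0 (Suc k) \<sigma>') aNext))"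
      by (rule run_mono) (auto intro: bf_inv_round[OF usable_sub])
  qed (use \<tau> in \<open>auto simp: keeps_def inp_def\<close>)
  have "run dist_to \<sigma> (\<lambda>l \<sigma>'. l \<le> tD \<and>
    dist_spec ?F ?v (nmem \<sigma>' aReach) (rmem \<sigma>' rDist) (nmem \<sigma>' aNext))"
    unfolding dist_to_def
  proof (rule run_SeqI[OF init], goal_cases)
    case (1 k \<sigma>1)
    then have z: "\<forall>x<n. nmem \<sigma>1 aReach x = 0" and kp: "keeps (For aI xN (NWrite aReach (sc aI) (NConst
        0))) \<sigma> \<sigma>1"
      and k: "k \<le> n * (1 + 2) + 2" by auto
    let ?\<tau> = "rwrite rDist ?v 0 (nwrite aReach ?v 1 \<sigma>1)"
    have \<tau>: "inp ?\<tau>" "usable ?\<tau> = ?F" "nmem ?\<tau> aTarget = nmem \<sigma> aTarget"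
      using kp i inp_cong[of ?\<tau> \<sigma>] usable_cong[of ?\<tau> \<sigma>] by (auto simp: keeps_def)
    have bf: "bf_inv ?F ?v 0 0 (nmem ?\<tau> aReach) (rmem ?\<tau> rDist) (nmem ?\<tau> aNext)"
      by (rule bf_inv_init) (use v z in auto)
    have tgt: "nmem \<sigma>1 aTarget 0 = ?v" using kp by (simp add: keeps_def)
    have tm: "k + (1 + (1 + l)) \<le> tD" if l: "l \<le> n * ((?m * (4 + 2) + 2) + 2) + 2" for l
      using l k n_pos unfolding tD_def by (simp add: algebra_simps)
    have "run (For aK xN (For aJ xM relax)) ?\<tau> (\<lambda>l \<sigma>'. k + (1 + (1 + l)) \<le> tD \<and>
        dist_spec ?F ?v (nmem \<sigma>' aReach) (rmem \<sigma>' rDist) (nmem \<sigma>' aNext))"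
      by (rule run_mono[OF rounds[OF \<tau> bf]]) (use tm bf_inv_final[OF usable_sub] in auto)
    then show ?case by (simp add: tgt)
  qed
  then show ?thesis using run_keeps by fastforce
qed

lemma outl_snoc:
  "outl \<sigma> xs \<Longrightarrow> nmem \<sigma>' aCount 0 = Suc (length xs) \<Longrightarrow> nmem \<sigma>' 3 = (nmem \<sigma> 3)(Suc (length xs) := y) \<Longrightarrow>
    outl \<sigma>' (xs @ [y])"
  by (auto simp: outl_def nth_append less_Suc_eq)

lemma outl_cong:
  "nmem \<sigma>' aCount = nmem \<sigma> aCount \<Longrightarrow> nmem \<sigma>' 3 = nmem \<sigma> 3 \<Longrightarrow> outl \<sigma>' xs \<longleftrightarrow> outl \<sigma> xs"
  by (simp add: outl_def)

text \<open>Along a pointer the label drops by a positive weight. So the number of vertices with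
  smaller label is a variant, and since all visited vertices have labels at least the current one,
  the next vertex is new.\<close>

lemma run_chase:
  assumes F: "F \<subseteq> set es" and x0: "x0 = nmem \<sigma> aCur 0" "x0 < n" "nmem \<sigma> aReach x0 \<noteq> 0"
    and v: "v = nmem \<sigma> aTarget 0"
    and D: "dist_spec F v (nmem \<sigma> aReach) (rmem \<sigma> rDist) (nmem \<sigma> aNext)" and o: "outl \<sigma> xs"
  shows "run chase \<sigma> (\<lambda>k \<sigma>'. k \<le> n * 4 + 1 \<and> nmem \<sigma>' aCur 0 = v \<and>
    (\<exists>p. walk F x0 p v \<and> distinct p \<and> cost w p = rmem \<sigma> rDist x0 \<and> outl \<sigma>' (xs @ tl p)) \<and> keeps chase \<sigma> \<sigma>')"
proof -
  let ?D = "rmem \<sigma> rDist" and ?R = "nmem \<sigma> aReach" and ?N = "nmem \<sigma> aNext"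
  let ?X = "\<lambda>\<sigma>. nmem \<sigma> aCur 0"
  let ?I = "\<lambda>\<sigma>'. ?X \<sigma>' < n \<and> ?R (?X \<sigma>') \<noteq> 0 \<and> nmem \<sigma>' aTarget 0 = v \<and> nmem \<sigma>' aNext = ?N \<and>
    (\<exists>p. walk F x0 p (?X \<sigma>') \<and> distinct p \<and> cost w p + ?D (?X \<sigma>') = ?D x0 \<and>
      (\<forall>y\<in>set p. ?D (?X \<sigma>') \<le> ?D y) \<and> outl \<sigma>' (xs @ tl p))"
  let ?f = "\<lambda>\<sigma>'. card {y. y < n \<and> ?D y < ?D (?X \<sigma>')}"
  let ?c = "Seq (put aCur (NRead aNext (sc aCur)))
     (Seq (put aCount (NAdd (sc aCount) (NConst 1))) (NWrite 3 (sc aCount) (sc aCur)))"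
  have Dv: "?D v = 0" if "v < n" "?R v \<noteq> 0"
    using D that wdist_refl[of F w v] F es_pos unfolding dist_spec_def by (metis finite_set
        finite_subset subsetD)
  have "run (While (neq (sc aCur) (sc aTarget)) ?c) \<sigma>
    (\<lambda>k \<sigma>'. k \<le> ?f \<sigma> * (3 + 1) + 1 \<and> ?I \<sigma>' \<and> \<not> bval (neq (sc aCur) (sc aTarget)) \<sigma>')"
  proof (rule run_While[where I = ?I and f = ?f])
    show "?I \<sigma>" using x0 v o by (auto intro!: exI[of _ "[x0]"])
  next
    fix \<sigma>' assume I: "?I \<sigma>'" and b: "bval (neq (sc aCur) (sc aTarget)) \<sigma>'"
    then obtain p where p: "walk F x0 p (?X \<sigma>')" "distinct p" "cost w p + ?D (?X \<sigma>') = ?D x0"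
      "\<forall>y\<in>set p. ?D (?X \<sigma>') \<le> ?D y" "outl \<sigma>' (xs @ tl p)" by blast
    let ?x = "?X \<sigma>'" let ?y = "?N ?x"
    have ne: "?x \<noteq> v" using b I by auto
    have y: "(?x, ?y) \<in> F" "?R ?y \<noteq> 0" "?D ?x = w (?x, ?y) + ?D ?y"
      using D I ne unfolding dist_spec_def by auto
    have yn: "?y < n" and wp: "0 < w (?x, ?y)" using y(1) F es_verts es_pos by auto
    then have lt: "?D ?y < ?D ?x" using y(3) by simp
    have q: "walk F x0 (p @ [?y]) ?y" "cost w (p @ [?y]) = cost w p + w (?x, ?y)"
      using walk_snoc[OF p(1) y(1), of w] by auto
    have "?y \<notin> set p" using p(4) lt by auto
    have card: "card {z. z < n \<and> ?D z < ?D ?y} < card {z. z < n \<and> ?D z < ?D ?x}"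
      by (rule psubset_card_mono) (use lt yn in auto)
    have tl: "tl (p @ [?y]) = tl p @ [?y]" using p(1) by (cases p) auto
    let ?\<sigma>2 = "nwrite 3 (Suc (length (xs @ tl p))) ?y (nwrite aCount 0 (Suc (length (xs @ tl p)))
        (nwrite aCur 0 ?y \<sigma>'))"
    have ol: "outl ?\<sigma>2 (xs @ tl (p @ [?y]))"
      using outl_snoc[OF p(5), of ?\<sigma>2 ?y] tl by simp
    have "\<forall>z\<in>set (p @ [?y]). ?D ?y \<le> ?D z" using p(4) lt by (auto intro: order_trans less_imp_le)
    then have "?I ?\<sigma>2"
      using I y yn q p(2,3) \<open>?y \<notin> set p\<close> ol
      by (intro conjI exI[of _ "p @ [?y]"]) auto
    moreover have "nmem \<sigma>' aCount 0 = length (xs @ tl p)" using p(5) by (simp add: outl_def)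
    ultimately show "run ?c \<sigma>' (\<lambda>k \<sigma>''. k \<le> 3 \<and> ?I \<sigma>'' \<and> ?f \<sigma>'' < ?f \<sigma>')"
      using I card by simp
  qed
  moreover have "?f \<sigma> \<le> n" using card_mono[of "{..<n}" "{y. y < n \<and> ?D y < ?D (?X \<sigma>)}"] by auto
  ultimately have "run chase \<sigma> (\<lambda>k \<sigma>'. k \<le> n * 4 + 1 \<and> nmem \<sigma>' aCur 0 = v \<and>
    (\<exists>p. walk F x0 p v \<and> distinct p \<and> cost w p = ?D x0 \<and> outl \<sigma>' (xs @ tl p)))"
    unfolding chase_def
  proof (elim run_mono, goal_cases)
    case (1 k \<sigma>')
    then have X: "?X \<sigma>' = v" "k \<le> n * 4 + 1" by auto
    obtain p where p: "walk F x0 p (?X \<sigma>')" "distinct p" "cost w p + ?D (?X \<sigma>') = ?D x0"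
      "outl \<sigma>' (xs @ tl p)" using 1 by blast
    have "?X \<sigma>' < n" "?R (?X \<sigma>') \<noteq> 0" using 1 by blast+
    then have "?D v = 0" using Dv unfolding X(1) by blast
    then show ?case using X p by (intro conjI exI[of _ p]) simp_all
  qed
  from run_keeps[OF this] show ?thesis by (rule run_mono) blast
qed

end

section \<open>Classifying vertices and edges\<close>

abbreviation (input) "aIdx \<equiv> 16 :: nat"
abbreviation (input) "aLab \<equiv> 17 :: nat"
abbreviation (input) "aUp \<equiv> 18 :: nat"
abbreviation (input) "aNV \<equiv> 19 :: nat"
abbreviation (input) "aNE \<equiv> 20 :: nat"
abbreviation (input) "aPos \<equiv> 21 :: nat"
abbreviation (input) "aId \<equiv> 22 :: nat"
abbreviation (input) "aHas \<equiv> 23 :: nat"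
abbreviation (input) "aBestU \<equiv> 24 :: nat"
abbreviation (input) "aBestV \<equiv> 25 :: nat"
abbreviation (input) "aP \<equiv> 26 :: nat"
abbreviation (input) "aQ \<equiv> 27 :: nat"
abbreviation (input) "aB \<equiv> 28 :: nat"
abbreviation (input) "rDS \<equiv> 2 :: nat"
abbreviation (input) "rDT \<equiv> 3 :: nat"
abbreviation (input) "rBest \<equiv> 4 :: nat"
abbreviation (input) "rCost \<equiv> 5 :: nat"

text \<open>Distances from \<open>s\<close> come from the same backward routine: it is run once for
  every target, and only the entry at \<open>s\<close> is kept.\<close>

definition find_ds :: com where
  "find_ds = For aP xN (Seq (put aTarget (sc aP)) (Seq dist_to
     (Seq (RWrite rDS (sc aP) (RRead rDist xS)) (NWrite aFromS (sc aP) (NRead aReach xS)))))"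

text \<open>Reals can only be compared by \<open><\<close>. The triangle inequality excludes one
  direction, so the negated comparison is a test for equality; \<open>mark_tight\<close> uses the
  same device. The arrays \<open>aReach\<close> and \<open>rDist\<close> must still hold the
  distances to \<open>t\<close>.\<close>

definition mark_good :: com where
  "mark_good = For aP xN (If (And (nz (NRead aFromS (sc aP))) (And (nz (NRead aReach (sc aP)))
      (Not (RLess (RRead rDS xT) (RAdd (RRead rDS (sc aP)) (RRead rDist (sc aP)))))))
    (Seq (NWrite aGood (sc aP) (NConst 1)) (RWrite rDT (sc aP) (RRead rDist (sc aP)))) Skip)"

definition mark_tight :: com where
  "mark_tight = For aP xM (If (And (nz (NRead aGood (tailOf aP))) (And (nz (NRead aGood (headOf aP)))
      (Not (RLess (RRead rDS (headOf aP)) (RAdd (RRead rDS (tailOf aP)) (RRead 0 (sc aP)))))))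
    (NWrite aTight (sc aP) (NConst 1)) Skip)"

text \<open>Labels are shifted by one so that 0, the initial content of a cell, can stand for a
  subdivision point.\<close>

definition number_good :: com where
  "number_good = For aP xN (If (nz (NRead aGood (sc aP)))
    (Seq (NWrite aIdx (sc aP) (sc aNV)) (Seq (NWrite aLab (sc aNV) (NAdd (sc aP) (NConst 1)))
      (put aNV (NAdd (sc aNV) (NConst 1))))) Skip)"

text \<open>A level is represented by any good vertex on it. \<open>aUp\<close> stores, shifted by
  one, a representative of the next higher level, and 0 if there is none.\<close>

definition find_up :: com where
  "find_up = For aP xN (For aQ xN (If (And (nz (NRead aGood (sc aQ)))
      (And (RLess (RRead rDS (sc aP)) (RRead rDS (sc aQ)))
        (Or (Not (nz (NRead aUp (sc aP))))
          (RLess (RRead rDS (sc aQ)) (RRead rDS (NSub (NRead aUp (sc aP)) (NConst 1)))))))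
    (NWrite aUp (sc aP) (NAdd (sc aQ) (NConst 1))) Skip))"

lemma mods_find_ds [simp]: "nmods find_ds = {aP, aTarget, aFromS, aI, aReach, aK, aJ, aNext}" "rmods
    find_ds = {rDist, rDS}"
  by (auto simp: find_ds_def)
lemma mods_mark_good [simp]: "nmods mark_good = {aP, aGood}" "rmods mark_good = {rDT}"
  by (auto simp: mark_good_def)
lemma mods_mark_tight [simp]: "nmods mark_tight = {aP, aTight}" "rmods mark_tight = {}"
  by (auto simp: mark_tight_def)
lemma mods_number_good [simp]: "nmods number_good = {aP, aIdx, aLab, aNV}" "rmods number_good = {}"
  by (auto simp: number_good_def)
lemma mods_find_up [simp]: "nmods find_up = {aP, aQ, aUp}" "rmods find_up = {}"
  by (auto simp: find_up_def)

section \<open>Correctness of the classification\<close>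

context instance_data
begin

lemma usable_all:
  assumes "nmem \<sigma> aMode 0 = 0" "\<And>j. nmem \<sigma> aTight j < 2" "\<And>x. nmem \<sigma> aGood x < 2"
  shows "usable \<sigma> = set es"
  using assms by (auto simp: usable_def set_conv_nth)

lemma run_find_ds:
  assumes "inp \<sigma>" "nmem \<sigma> aMode 0 = 0" "\<And>j. nmem \<sigma> aTight j < 2" "\<And>x. nmem \<sigma> aGood x < 2"
  shows "run find_ds \<sigma> (\<lambda>k \<sigma>'. k \<le> n * (tD + 3 + 2) + 2 \<and>
    (\<forall>v<n. (nmem \<sigma>' aFromS v \<noteq> 0 \<longleftrightarrow> (\<exists>p. walk (set es) s p v)) \<and>
      (nmem \<sigma>' aFromS v \<noteq> 0 \<longrightarrow> rmem \<sigma>' rDS v = wdist (set es) w s v)) \<and> keeps find_ds \<sigma> \<sigma>')"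
  unfolding find_ds_def
proof (rule run_For[where I = "\<lambda>j \<sigma>'. \<forall>v<j. (nmem \<sigma>' aFromS v \<noteq> 0 \<longleftrightarrow> (\<exists>p. walk (set es) s p v)) \<and>
      (nmem \<sigma>' aFromS v \<noteq> 0 \<longrightarrow> rmem \<sigma>' rDS v = wdist (set es) w s v)"], goal_cases)
  case (1 \<sigma>') then show ?case using assms(1) by (simp add: keeps_def inp_def)
next
  case 2 then show ?case by simp
next
  case 3 then show ?case by simp
next
  case (4 v \<tau>)
  let ?\<tau> = "nwrite aTarget 0 v \<tau>"
  have kp: "keeps find_ds \<sigma> \<tau>" using 4(4) by (simp add: find_ds_def)
  then have i: "inp ?\<tau>" using assms(1) inp_cong[of ?\<tau> \<sigma>] by (simp add: keeps_def)
  have u: "usable ?\<tau> = set es" by (rule usable_all) (use kp assms in \<open>auto simp: keeps_def\<close>)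
  have "run dist_to ?\<tau> (\<lambda>l \<tau>'. l \<le> tD \<and>
    dist_spec (set es) v (nmem \<tau>' aReach) (rmem \<tau>' rDist) (nmem \<tau>' aNext) \<and> keeps dist_to ?\<tau> \<tau>')"
    using run_dist_to[OF i] u 4(1) by simp
  then have "run dist_to ?\<tau> (\<lambda>l \<tau>'. run (Seq (RWrite rDS (sc aP) (RRead rDist xS)) (NWrite aFromS (sc
      aP) (NRead aReach xS))) \<tau>'
    (\<lambda>k \<tau>''. 1 + (l + k) \<le> tD + 3 \<and> (\<forall>u<Suc v. (nmem \<tau>'' aFromS u \<noteq> 0 \<longleftrightarrow> (\<exists>p. walk (set es) s p u)) \<and>
      (nmem \<tau>'' aFromS u \<noteq> 0 \<longrightarrow> rmem \<tau>'' rDS u = wdist (set es) w s u))))"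
  proof (rule run_mono, goal_cases)
    case (1 l \<tau>')
    have k: "nmem \<tau>' aP 0 = v" "nmem \<tau>' 0 2 = s" "nmem \<tau>' aFromS = nmem \<tau> aFromS" "rmem \<tau>' rDS = rmem \<tau> rDS"
      using 1 4(3) i by (auto simp: keeps_def inp_def)
    have "(nmem \<tau>' aReach s \<noteq> 0 \<longleftrightarrow> (\<exists>p. walk (set es) s p v)) \<and>
      (nmem \<tau>' aReach s \<noteq> 0 \<longrightarrow> rmem \<tau>' rDist s = wdist (set es) w s v)"
      using 1 s_less unfolding dist_spec_def by blast
    then show ?case using 1 4(2) k by (auto simp: less_Suc_eq)
  qed
  then show ?case by (simp add: 4(3))
qed

end

locale connected_instance = instance_data +
  assumes st_conn: "\<exists>p. walk (set es) s p t" and st_ne: "s \<noteq> t"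
begin

sublocale reduction "set es" w s t
  by unfold_locales (use es_pos es_irrefl st_conn st_ne in auto)

lemma good_less: "good x \<Longrightarrow> x < n"
proof (cases "x = s")
  case False
  assume "good x"
  then obtain u where "(u, x) \<in> Tight" using tight_in False by blast
  then show ?thesis using es_verts by (auto simp: Tight_def)
qed (use s_less in simp)

lemma card_Good_n: "card Good \<le> n"
  using card_mono[of "{..<n}" Good] good_less by (auto simp: Good_def)

definition base :: "state \<Rightarrow> bool" where
  "base \<sigma> \<longleftrightarrow> inp \<sigma> \<and> (\<forall>x. nmem \<sigma> aGood x = of_bool (good x)) \<and>
    (\<forall>j. nmem \<sigma> aTight j = of_bool (j < length es \<and> es ! j \<in> Tight)) \<and>
    (\<forall>x. good x \<longrightarrow> rmem \<sigma> rDS x = ds x \<and> rmem \<sigma> rDT x = dt x)"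

lemma base_cong:
  assumes "nmem \<sigma>' 0 = nmem \<sigma> 0" "nmem \<sigma>' 1 = nmem \<sigma> 1" "nmem \<sigma>' 2 = nmem \<sigma> 2" "rmem \<sigma>' 0 = rmem \<sigma> 0"
    "nmem \<sigma>' aGood = nmem \<sigma> aGood" "nmem \<sigma>' aTight = nmem \<sigma> aTight"
    "rmem \<sigma>' rDS = rmem \<sigma> rDS" "rmem \<sigma>' rDT = rmem \<sigma> rDT"
  shows "base \<sigma>' \<longleftrightarrow> base \<sigma>"
  using assms inp_cong[of \<sigma>' \<sigma>] by (simp add: base_def)

lemma base_inp: "base \<sigma> \<Longrightarrow> inp \<sigma>" by (simp add: base_def)

lemma usable_base:
  assumes "base \<sigma>"
  shows "nmem \<sigma> aMode 0 = 0 \<Longrightarrow> usable \<sigma> = set es"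
    "nmem \<sigma> aMode 0 = 1 \<Longrightarrow> usable \<sigma> = Det (nmem \<sigma> aTarget 0)"
proof -
  show "nmem \<sigma> aMode 0 = 0 \<Longrightarrow> usable \<sigma> = set es"
    by (rule usable_all) (use assms in \<open>auto simp: base_def\<close>)
  assume m: "nmem \<sigma> aMode 0 = 1"
  have "usable \<sigma> = {es ! j |j. j < length es \<and> es ! j \<notin> Tight \<and>
      (snd (es ! j) = nmem \<sigma> aTarget 0 \<or> \<not> good (snd (es ! j)))}"
    using assms unfolding usable_def m base_def by (intro Collect_cong ex_cong1) auto
  also have "\<dots> = Det (nmem \<sigma> aTarget 0)" unfolding Det_def
    by (auto simp: in_set_conv_nth) (metis snd_conv)+
  finally show "usable \<sigma> = Det (nmem \<sigma> aTarget 0)" .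
qed

lemma run_mark_good:
  assumes i: "inp \<sigma>" and z: "\<And>x. nmem \<sigma> aGood x = 0"
    and S: "\<forall>v<n. (nmem \<sigma> aFromS v \<noteq> 0 \<longleftrightarrow> (\<exists>p. walk (set es) s p v)) \<and>
      (nmem \<sigma> aFromS v \<noteq> 0 \<longrightarrow> rmem \<sigma> rDS v = wdist (set es) w s v)"
    and T: "\<forall>v<n. (nmem \<sigma> aReach v \<noteq> 0 \<longleftrightarrow> (\<exists>p. walk (set es) v p t)) \<and>
      (nmem \<sigma> aReach v \<noteq> 0 \<longrightarrow> rmem \<sigma> rDist v = wdist (set es) w v t)"
  shows "run mark_good \<sigma> (\<lambda>k \<sigma>'. k \<le> n * (3 + 2) + 2 \<and> ((\<forall>x. nmem \<sigma>' aGood x = of_bool (x < n \<and> good x)) \<and>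
    (\<forall>x<n. good x \<longrightarrow> rmem \<sigma>' rDT x = dt x)) \<and> keeps mark_good \<sigma> \<sigma>')"
  unfolding mark_good_def
proof (rule run_For[where I = "\<lambda>j \<sigma>'. (\<forall>x. nmem \<sigma>' aGood x = of_bool (x < j \<and> good x)) \<and>
    (\<forall>x<j. good x \<longrightarrow> rmem \<sigma>' rDT x = dt x)"], goal_cases)
  case (1 \<sigma>') then show ?case using i by (simp add: keeps_def inp_def)
next
  case 2 then show ?case by simp
next
  case 3 then show ?case using z by simp
next
  case (4 x \<tau>)
  have kp: "keeps mark_good \<sigma> \<tau>" using 4(4) by (simp add: mark_good_def)
  then have it: "nmem \<tau> 0 3 = t" "nmem \<tau> aFromS = nmem \<sigma> aFromS" "nmem \<tau> aReach = nmem \<sigma> aReach"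
    "rmem \<tau> rDS = rmem \<sigma> rDS" "rmem \<tau> rDist = rmem \<sigma> rDist" using i by (auto simp: keeps_def inp_def)
  have tt: "rmem \<sigma> rDS t = ds t" using S t_less st_conn by (auto simp: ds_def)
  have "0 < nmem \<sigma> aFromS x \<and> 0 < nmem \<sigma> aReach x \<and> \<not> rmem \<sigma> rDS t < rmem \<sigma> rDS x + rmem \<sigma> rDist x \<longleftrightarrow> good x"
  proof (cases "nmem \<sigma> aFromS x \<noteq> 0 \<and> nmem \<sigma> aReach x \<noteq> 0")
    case True
    then obtain p q where pq: "walk (set es) s p x" "walk (set es) x q t" using S T 4(1) by blast
    have "rmem \<sigma> rDS x = ds x" "rmem \<sigma> rDist x = dt x" using S T 4(1) True by (auto simp: ds_def dt_def)
    then show ?thesis using True ds_dt_ge[OF pq] pq tt unfolding good_def by auto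
  next
    case False
    then show ?thesis using S T 4(1) unfolding good_def by auto
  qed
  moreover have "good x \<Longrightarrow> rmem \<sigma> rDist x = dt x" using T 4(1) unfolding good_def dt_def by blast
  ultimately show ?case using 4(2,3) it by (auto simp: less_Suc_eq)
qed

lemma run_mark_tight:
  assumes i: "inp \<sigma>" and z: "\<And>x. nmem \<sigma> aTight x = 0" and g: "\<And>x. nmem \<sigma> aGood x = of_bool (good x)"
    and d: "\<And>x. good x \<Longrightarrow> rmem \<sigma> rDS x = ds x"
  shows "run mark_tight \<sigma> (\<lambda>k \<sigma>'. k \<le> length es * (2 + 2) + 2 \<and>
    (\<forall>j. nmem \<sigma>' aTight j = of_bool (j < length es \<and> es ! j \<in> Tight)) \<and> keeps mark_tight \<sigma> \<sigma>')"
  unfolding mark_tight_def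
proof (rule run_For[where I = "\<lambda>i \<sigma>'. \<forall>j. nmem \<sigma>' aTight j = of_bool (j < i \<and> es ! j \<in> Tight)"], goal_cases)
  case (1 \<sigma>') then show ?case using i by (simp add: keeps_def inp_def)
next
  case 2 then show ?case by simp
next
  case 3 then show ?case using z by simp
next
  case (4 j \<tau>)
  have kp: "keeps mark_tight \<sigma> \<tau>" using 4(4) by (simp add: mark_tight_def)
  obtain u v where e: "es ! j = (u, v)" by fastforce
  then have uv: "(u, v) \<in> set es" using 4(1) nth_mem by metis
  have it: "nmem \<tau> 1 j = u" "nmem \<tau> 2 j = v" "rmem \<tau> 0 j = w (u, v)" "nmem \<tau> aGood = nmem \<sigma> aGood"
    "rmem \<tau> rDS = rmem \<sigma> rDS" using kp i 4(1) e by (auto simp: keeps_def inp_def)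
  have "good u \<Longrightarrow> ds v \<le> ds u + w (u, v)"
    using ds_step[of _ u "[u, v]" v] uv unfolding good_def by auto
  then have "good u \<and> good v \<and> \<not> rmem \<sigma> rDS v < rmem \<sigma> rDS u + w (u, v) \<longleftrightarrow> (u, v) \<in> Tight"
    using uv d unfolding Tight_def by auto
  then show ?case using 4(2,3) it g e by (auto simp: less_Suc_eq)
qed

lemma run_number_good:
  assumes b: "base \<sigma>" and z: "nmem \<sigma> aNV 0 = 0" "\<And>i. nmem \<sigma> aLab i = 0"
  shows "run number_good \<sigma> (\<lambda>k \<sigma>'. k \<le> n * (4 + 2) + 2 \<and>
    (let g = filter good [0..<n] in nmem \<sigma>' aNV 0 = length g \<and> (\<forall>i<length g. nmem \<sigma>' aIdx (g ! i) = i) \<and>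
      (\<forall>i. nmem \<sigma>' aLab i = (if i < length g then Suc (g ! i) else 0))) \<and> keeps number_good \<sigma> \<sigma>')"
  unfolding number_good_def
proof (rule run_For[where I = "\<lambda>j \<sigma>'. let g = filter good [0..<j] in nmem \<sigma>' aNV 0 = length g \<and>
      (\<forall>i<length g. nmem \<sigma>' aIdx (g ! i) = i) \<and>
      (\<forall>i. nmem \<sigma>' aLab i = (if i < length g then Suc (g ! i) else 0))"], goal_cases)
  case (1 \<sigma>') then show ?case using b by (simp add: keeps_def base_def inp_def)
next
  case 2 then show ?case by simp
next
  case 3 then show ?case using z by simp
next
  case (4 x \<tau>)
  have gd: "nmem \<tau> aGood x = of_bool (good x)" using 4(4) b by (auto simp: keeps_def base_def)
  have ne: "filter good [0..<x] ! i \<noteq> x" if "i < length (filter good [0..<x])" for i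
    using nth_mem[OF that] by auto
  show ?case using 4(2,3) gd ne by (auto simp: Let_def less_Suc_eq nth_append)
qed

lemma run_find_up:
  assumes b: "base \<sigma>" and z: "\<And>x. nmem \<sigma> aUp x = 0"
  shows "run find_up \<sigma> (\<lambda>k \<sigma>'. k \<le> n * ((n * (2 + 2) + 2) + 2) + 2 \<and>
    (\<forall>x y. good x \<and> good y \<and> ds x < ds y \<longrightarrow> nmem \<sigma>' aUp x \<noteq> 0 \<and> good (nmem \<sigma>' aUp x - 1) \<and>
      nextl (ds x) (ds (nmem \<sigma>' aUp x - 1))) \<and> keeps find_up \<sigma> \<sigma>')"
proof -
  \<comment> \<open>Here \<open>r\<close> is 0 or the successor of a vertex on the lowest level
    above \<open>ds x\<close> among the good vertices below \<open>j\<close>.\<close>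
  define upto where "upto = (\<lambda>j x (r::nat). (r = 0 \<longrightarrow> (\<forall>y<j. good y \<longrightarrow> ds y \<le> ds x)) \<and>
    (r \<noteq> 0 \<longrightarrow> good (r - 1) \<and> ds x < ds (r - 1) \<and> (\<forall>y<j. good y \<longrightarrow> ds y \<le> ds x \<or> ds (r - 1) \<le> ds y)))"
  have "run find_up \<sigma> (\<lambda>k \<sigma>'. k \<le> n * ((n * (2 + 2) + 2) + 2) + 2 \<and>
    ((\<forall>x<n. good x \<longrightarrow> upto n x (nmem \<sigma>' aUp x)) \<and> (\<forall>x\<ge>n. nmem \<sigma>' aUp x = 0)) \<and> keeps find_up \<sigma> \<sigma>')"
    unfolding find_up_def
  proof (rule run_For[where I = "\<lambda>j \<sigma>'. (\<forall>x<j. good x \<longrightarrow> upto n x (nmem \<sigma>' aUp x)) \<and> (\<forall>x\<ge>j. nmem \<sigma>' aUp x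
      = 0)"], goal_cases)
    case (1 \<sigma>') then show ?case using b by (simp add: keeps_def base_def inp_def)
  next
    case 2 then show ?case by simp
  next
    case 3 then show ?case using z by simp
  next
    case (4 x \<tau>)
    have bt: "base \<tau>" using b 4(4) base_cong[of \<tau> \<sigma>] by (auto simp: keeps_def)
    let ?body = "If (And (nz (NRead aGood (sc aQ)))
      (And (RLess (RRead rDS (sc aP)) (RRead rDS (sc aQ)))
        (Or (Not (nz (NRead aUp (sc aP))))
          (RLess (RRead rDS (sc aQ)) (RRead rDS (NSub (NRead aUp (sc aP)) (NConst 1)))))))
      (NWrite aUp (sc aP) (NAdd (sc aQ) (NConst 1))) Skip"
    have "run (For aQ xN ?body) \<tau> (\<lambda>k \<sigma>'. k \<le> n * (2 + 2) + 2 \<and>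
      ((good x \<longrightarrow> upto n x (nmem \<sigma>' aUp x)) \<and> (\<forall>x'. x' \<noteq> x \<longrightarrow> nmem \<sigma>' aUp x' = nmem \<tau> aUp x')) \<and>
      keeps (For aQ xN ?body) \<tau> \<sigma>')"
    proof (rule run_For[where I = "\<lambda>j \<sigma>'. (good x \<longrightarrow> upto j x (nmem \<sigma>' aUp x)) \<and> (\<forall>x'. x' \<noteq> x \<longrightarrow> nmem \<sigma>'
        aUp x' = nmem \<tau> aUp x')"], goal_cases)
      case (1 \<sigma>') then show ?case using bt by (simp add: keeps_def base_def inp_def)
    next
      case 2 then show ?case by simp
    next
      case 3 then show ?case using 4(2) by (simp add: upto_def)
    next
      case (4 y \<tau>2)
      have k2: "base \<tau>2" "nmem \<tau>2 aP 0 = x" using bt \<open>nmem \<tau> aP 0 = x\<close> 4(4) base_cong[of \<tau>2 \<tau>] by (auto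
          simp: keeps_def)
      show ?case
      proof (cases "good x")
        case False then show ?thesis using 4(2,3) k2 by auto
      next
        case True
        have u: "upto y x (nmem \<tau>2 aUp x)" using 4(2) True by simp
        let ?c = "good y \<and> ds x < ds y \<and> (nmem \<tau>2 aUp x = 0 \<or> ds y < ds (nmem \<tau>2 aUp x - 1))"
        have c: "bval (And (nz (NRead aGood (sc aQ)))
          (And (RLess (RRead rDS (sc aP)) (RRead rDS (sc aQ)))
            (Or (Not (nz (NRead aUp (sc aP))))
              (RLess (RRead rDS (sc aQ)) (RRead rDS (NSub (NRead aUp (sc aP)) (NConst 1))))))) \<tau>2 \<longleftrightarrow> ?c"
          using k2 4(3) True u by (auto simp: base_def upto_def)
        have "upto (Suc y) x (if ?c then Suc y else nmem \<tau>2 aUp x)"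
          using u unfolding upto_def by (auto simp: less_Suc_eq)
        then show ?thesis unfolding run_If c using 4(2,3) k2 by auto
      qed
    qed
    then show ?case
      by (rule run_mono) (use 4 in \<open>auto simp: less_Suc_eq\<close>)
  qed
  then show ?thesis
  proof (rule run_mono, goal_cases)
    case (1 k \<sigma>')
    have "nmem \<sigma>' aUp x \<noteq> 0 \<and> good (nmem \<sigma>' aUp x - 1) \<and> nextl (ds x) (ds (nmem \<sigma>' aUp x - 1))"
      if x: "good x" "good y" "ds x < ds y" for x y
    proof -
      have u: "upto n x (nmem \<sigma>' aUp x)" using 1 x(1) good_less by blast
      then have "nmem \<sigma>' aUp x \<noteq> 0" using x good_less[OF x(2)] unfolding upto_def by force
      then show ?thesis using u x(1) good_less unfolding upto_def nextl_def Lev_def Good_def by auto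
    qed
    then show ?case using 1 by blast
  qed
qed

end

section \<open>Building the layered graph\<close>

text \<open>The arrays of the assumed algorithm are relocated by 40, so its input is written to the natural
  arrays 40, 41, 42 and the real array 40.\<close>

abbreviation (input) "sh \<equiv> 40 :: nat"
abbreviation (input) "aTails \<equiv> 41 :: nat"
abbreviation (input) "aHeads \<equiv> 42 :: nat"
abbreviation (input) "rWeights \<equiv> 40 :: nat"

definition add_edge :: "nexp \<Rightarrow> nexp \<Rightarrow> rexp \<Rightarrow> com" where
  "add_edge a b r = Seq (NWrite aTails (sc aNE) a) (Seq (NWrite aHeads (sc aNE) b)
     (Seq (RWrite rWeights (sc aNE) r) (put aNE (NAdd (sc aNE) (NConst 1)))))"

abbreviation (input) "upPos \<equiv> NSub (NRead aUp (sc aPos)) (NConst 1)"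

text \<open>\<open>aPos\<close> is a good vertex that serves only as a name for the current level
  and need not touch the edge; \<open>aId\<close> is the number of the point of the edge on that
  level.\<close>

definition chain_step :: com where
  "chain_step = Seq (add_edge (sc aId) (sc aNV) (RSub (RRead rDS upPos) (RRead rDS (sc aPos))))
     (Seq (put aPos upPos) (Seq (put aId (sc aNV)) (put aNV (NAdd (sc aNV) (NConst 1)))))"

definition add_chain :: com where
  "add_chain = Seq (put aPos (tailOf aP)) (Seq (put aId (NRead aIdx (tailOf aP)))
     (Seq (While (RLess (RRead rDS upPos) (RRead rDS (headOf aP))) chain_step)
       (add_edge (sc aId) (NRead aIdx (headOf aP)) (RSub (RRead rDS (headOf aP)) (RRead rDS (sc aPos))))))"

definition add_chains :: com where
  "add_chains = For aP xM (If (nz (NRead aTight (sc aP))) add_chain Skip)"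

abbreviation (input) "pairCost \<equiv> RAdd (RAdd (RRead rDS (sc aQ)) (RRead rDist (sc aQ))) (RRead rDT (sc aP))"

text \<open>Only the pair and its cost are recorded. The distance arrays are overwritten for the
  next target, so \<open>write_up\<close> computes the path afresh.\<close>

definition candidate :: com where
  "candidate = If (Or (Not (nz (sc aHas))) (RLess pairCost (RRead rBest (NConst 0))))
     (Seq (put aHas (NConst 1)) (Seq (RWrite rBest (NConst 0) pairCost)
       (Seq (put aBestU (sc aQ)) (put aBestV (sc aP))))) Skip"

definition do_pair :: com where
  "do_pair = If (And (nz (NRead aGood (sc aQ))) (And (nz (NRead aReach (sc aQ))) (neq (sc aQ) (sc aP))))
     (If (RLess (RRead rDS (sc aP)) (RRead rDS (sc aQ)))
       (add_edge (NRead aIdx (sc aQ)) (NRead aIdx (sc aP)) (RRead rDist (sc aQ))) candidate) Skip"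

definition add_detours :: com where
  "add_detours = For aP xN (If (nz (NRead aGood (sc aP)))
     (Seq (put aTarget (sc aP)) (Seq dist_to (For aQ xN do_pair))) Skip)"

lemma mods_add_edge [simp]: "nmods (add_edge a b r) = {aTails, aHeads, aNE}" "rmods (add_edge a b r) =
    {rWeights}"
  by (auto simp: add_edge_def)
lemma mods_chain_step [simp]: "nmods chain_step = {aTails, aHeads, aNE, aPos, aId, aNV}" "rmods
    chain_step = {rWeights}"
  by (auto simp: chain_step_def)
lemma mods_add_chain [simp]: "nmods add_chain = {aTails, aHeads, aNE, aPos, aId, aNV}" "rmods add_chain
    = {rWeights}"
  by (auto simp: add_chain_def)
lemma mods_add_chains [simp]: "nmods add_chains = {aP, aTails, aHeads, aNE, aPos, aId, aNV}" "rmods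
    add_chains = {rWeights}"
  by (auto simp: add_chains_def)
lemma mods_candidate [simp]: "nmods candidate = {aHas, aBestU, aBestV}" "rmods candidate = {rBest}"
  by (auto simp: candidate_def)
lemma mods_do_pair [simp]: "nmods do_pair = {aTails, aHeads, aNE, aHas, aBestU, aBestV}" "rmods do_pair
    = {rWeights, rBest}"
  by (auto simp: do_pair_def)
lemma mods_add_detours [simp]:
  "nmods add_detours = {aP, aQ, aTarget, aI, aReach, aK, aJ, aNext, aTails, aHeads, aNE, aHas, aBestU,
      aBestV}"
  "rmods add_detours = {rDist, rWeights, rBest}"
  by (auto simp: add_detours_def)

section \<open>Subdividing the tight edges in memory\<close>

context connected_instance
begin

text \<open>The cells beyond the edge list are required to be 0 because the memory handed to the
  assumed algorithm must equal an input state exactly. The distinctness of both lists becomes that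
  of the vertex numbering and of the input edge list.\<close>

definition rep :: "state \<Rightarrow> nat lvert list \<Rightarrow> (nat lvert \<times> nat lvert) list \<Rightarrow> bool" where
  "rep \<sigma> VL EL \<longleftrightarrow> distinct VL \<and> distinct EL \<and> nmem \<sigma> aNV 0 = length VL \<and> nmem \<sigma> aNE 0 = length EL \<and>
    (\<forall>i<length EL. nmem \<sigma> aTails i < length VL \<and> nmem \<sigma> aHeads i < length VL \<and>
      EL ! i = (VL ! nmem \<sigma> aTails i, VL ! nmem \<sigma> aHeads i) \<and> rmem \<sigma> rWeights i = WA (EL ! i)) \<and>
    (\<forall>i\<ge>length EL. nmem \<sigma> aTails i = 0 \<and> nmem \<sigma> aHeads i = 0 \<and> rmem \<sigma> rWeights i = 0) \<and>
    (\<forall>x. good x \<longrightarrow> nmem \<sigma> aIdx x < length VL \<and> VL ! nmem \<sigma> aIdx x = Inl x) \<and>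
    (\<forall>i. nmem \<sigma> aLab i = (if i < length VL then (case VL ! i of Inl x \<Rightarrow> Suc x | Inr _ \<Rightarrow> 0) else 0))"

lemma rep_cong:
  assumes "nmem \<sigma>' aNV = nmem \<sigma> aNV" "nmem \<sigma>' aNE = nmem \<sigma> aNE" "nmem \<sigma>' aTails = nmem \<sigma> aTails"
    "nmem \<sigma>' aHeads = nmem \<sigma> aHeads" "rmem \<sigma>' rWeights = rmem \<sigma> rWeights" "nmem \<sigma>' aIdx = nmem \<sigma> aIdx"
    "nmem \<sigma>' aLab = nmem \<sigma> aLab"
  shows "rep \<sigma>' VL EL \<longleftrightarrow> rep \<sigma> VL EL"
  unfolding rep_def assms ..

lemma rep_edge:
  assumes r: "rep \<sigma> VL EL" and ab: "a < length VL" "b < length VL" "(VL ! a, VL ! b) \<notin> set EL" "x = WA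
      (VL ! a, VL ! b)"
    and \<sigma>': "nmem \<sigma>' aTails = (nmem \<sigma> aTails)(length EL := a)" "nmem \<sigma>' aHeads = (nmem \<sigma> aHeads)(length
        EL := b)"
      "rmem \<sigma>' rWeights = (rmem \<sigma> rWeights)(length EL := x)" "nmem \<sigma>' aNE 0 = Suc (length EL)"
      "nmem \<sigma>' aNV = nmem \<sigma> aNV" "nmem \<sigma>' aIdx = nmem \<sigma> aIdx" "nmem \<sigma>' aLab = nmem \<sigma> aLab"
  shows "rep \<sigma>' VL (EL @ [(VL ! a, VL ! b)])"
  using r ab unfolding rep_def \<sigma>' by (simp add: nth_append less_Suc_eq)

lemma rep_vert:
  assumes r: "rep \<sigma> VL EL" and z: "Inr z \<notin> set VL"
    and \<sigma>': "nmem \<sigma>' aTails = nmem \<sigma> aTails" "nmem \<sigma>' aHeads = nmem \<sigma> aHeads"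
      "rmem \<sigma>' rWeights = rmem \<sigma> rWeights" "nmem \<sigma>' aNE = nmem \<sigma> aNE"
      "nmem \<sigma>' aNV 0 = Suc (length VL)" "nmem \<sigma>' aIdx = nmem \<sigma> aIdx" "nmem \<sigma>' aLab = nmem \<sigma> aLab"
  shows "rep \<sigma>' (VL @ [Inr z]) EL"
  using r z unfolding rep_def \<sigma>' by (auto simp: nth_append less_Suc_eq)

text \<open>\<open>b\<close> and \<open>r\<close> are evaluated after the first writes of the
  command, hence the independence hypotheses.\<close>

lemma run_add_edge:
  assumes "rep \<sigma> VL EL" "nval a \<sigma> < length VL" "nval b \<sigma> < length VL" "(VL ! nval a \<sigma>, VL ! nval b \<sigma>) \<notin>
      set EL"
    and "rval r \<sigma> = WA (VL ! nval a \<sigma>, VL ! nval b \<sigma>)"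
    and indep: "\<And>i x \<tau>. nval b (nwrite aTails i x \<tau>) = nval b \<tau>"
      "\<And>i x \<tau>. rval r (nwrite aTails i x \<tau>) = rval r \<tau>" "\<And>i x \<tau>. rval r (nwrite aHeads i x \<tau>) = rval r \<tau>"
  shows "run (add_edge a b r) \<sigma> (\<lambda>k \<sigma>'. k \<le> 4 \<and> rep \<sigma>' VL (EL @ [(VL ! nval a \<sigma>, VL ! nval b \<sigma>)]) \<and>
    keeps (add_edge a b r) \<sigma> \<sigma>')"
proof -
  have "nmem \<sigma> aNE 0 = length EL" using assms(1) by (simp add: rep_def)
  then have "run (add_edge a b r) \<sigma> (\<lambda>k \<sigma>'. k \<le> 4 \<and> rep \<sigma>' VL (EL @ [(VL ! nval a \<sigma>, VL ! nval b \<sigma>)]))"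
    unfolding add_edge_def
    by (simp add: indep) (rule rep_edge[OF assms(1-5)], simp_all)
  from run_keeps[OF this] show ?thesis by (rule run_mono) blast
qed

definition upspec :: "state \<Rightarrow> bool" where
  "upspec \<sigma> \<longleftrightarrow> (\<forall>x y. good x \<and> good y \<and> ds x < ds y \<longrightarrow> good (nmem \<sigma> aUp x - 1) \<and> nextl (ds x) (ds (nmem \<sigma>
      aUp x - 1)))"

definition VS :: "nat \<Rightarrow> nat lvert set" where
  "VS j = Inl ` Good \<union> {Inr (e, l) |e l. e \<in> set (take j es) \<and> e \<in> Tight \<and> l \<in> Lev \<and> ds (fst e) < l \<and> l
      < ds (snd e)}"

definition FS :: "nat \<Rightarrow> (nat lvert \<times> nat lvert) set" where
  "FS j = (\<Union>e\<in>set (take j es) \<inter> Tight. FAe e)"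

lemma VS_all: "VS (length es) = VA" and FS_all: "FS (length es) = FA"
  unfolding VS_def FS_def VA_def FA_def by (auto simp: Tight_def)

lemma FAe_edge:
  assumes "(a, b) \<in> FAe e"
  shows "own a = fst e \<and> (b = Inl (snd e) \<or> (\<exists>l. b = Inr (e, l)))"
proof -
  obtain l l' where l: "a = pt e l" "b = pt e l'" "l < l'" "ds (fst e) \<le> l" "l' \<le> ds (snd e)"
    using assms unfolding FAe_def nextl_def by blast
  then show ?thesis by (cases "l' = ds (snd e)") (auto simp: pt_def)
qed

text \<open>The owner of the tail is the first component of \<open>e\<close>, and the head is either
  the second component or a point that carries \<open>e\<close>. Thus chains can be appended without
  a search for duplicates.\<close>

lemma FAe_disjoint: "x \<in> FAe e \<Longrightarrow> x \<in> FAe e' \<Longrightarrow> e = e'"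
  using FAe_edge[of "fst x" "snd x" e] FAe_edge[of "fst x" "snd x" e'] by (auto simp: prod_eq_iff)

lemma Suc_sets:
  assumes "j < length es"
  shows "es ! j \<notin> Tight \<Longrightarrow> VS (Suc j) = VS j" "es ! j \<notin> Tight \<Longrightarrow> FS (Suc j) = FS j"
    "es ! j \<in> Tight \<Longrightarrow> VS (Suc j) = VS j \<union> {Inr (es ! j, l) |l. l \<in> Lev \<and> ds (fst (es ! j)) < l \<and> l < ds
        (snd (es ! j))}"
    "es ! j \<in> Tight \<Longrightarrow> FS (Suc j) = FS j \<union> FAe (es ! j)"
  using assms unfolding VS_def FS_def by (cases "es ! j"; auto simp: take_Suc_conv_app_nth)+

lemma take_fresh: "j < length es \<Longrightarrow> es ! j \<notin> set (take j es)"
  using es_distinct by (auto simp: in_set_conv_nth nth_eq_iff_index_eq)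

text \<open>Nothing lies between two consecutive levels, so raising the upper limit from
  \<open>a\<close> to \<open>b\<close> adds just one pair.\<close>

lemma nextl_split:
  assumes "nextl a b"
  shows "nextl l l' \<and> l' \<le> b \<longleftrightarrow> nextl l l' \<and> l' \<le> a \<or> l = a \<and> l' = b"
proof (cases "l' \<le> a")
  case True
  then show ?thesis using assms unfolding nextl_def by auto
next
  case False
  have "l = a \<and> l' = b" if n: "nextl l l'" "l' \<le> b"
  proof -
    have "b \<le> l'" using assms n(1) False unfolding nextl_def by force
    then have "l' = b" using n(2) by simp
    moreover have "l \<le> a" "a \<le> l" using assms n(1) False calculation unfolding nextl_def by force+
    ultimately show ?thesis by simp
  qed
  then show ?thesis using False assms by auto
qed

lemma nextl_pairs:
  assumes "nextl a b" "lo \<le> a"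
  shows "{(f l, f l') |l l'. nextl l l' \<and> lo \<le> l \<and> l' \<le> b} =
    insert (f a, f b) {(f l, f l') |l l'. nextl l l' \<and> lo \<le> l \<and> l' \<le> a}"
proof -
  have "nextl l l' \<and> lo \<le> l \<and> l' \<le> b \<longleftrightarrow> nextl l l' \<and> lo \<le> l \<and> l' \<le> a \<or> l = a \<and> l' = b" for l l'
    using nextl_split[OF assms(1), of l l'] assms(2) by blast
  then show ?thesis by (simp only:) blast
qed

definition chain_inv :: "nat \<Rightarrow> state \<Rightarrow> bool" where
  "chain_inv j \<sigma> \<longleftrightarrow> base \<sigma> \<and> upspec \<sigma> \<and> nmem \<sigma> aP 0 = j \<and>
    (let c = nmem \<sigma> aPos 0; e = es ! j in good c \<and> ds (fst e) \<le> ds c \<and> ds c < ds (snd e) \<and>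
      (\<exists>VL EL. rep \<sigma> VL EL \<and> nmem \<sigma> aId 0 < length VL \<and> VL ! nmem \<sigma> aId 0 = pt e (ds c) \<and>
        set VL = VS j \<union> {Inr (e, l) |l. l \<in> Lev \<and> ds (fst e) < l \<and> l \<le> ds c} \<and>
        set EL = FS j \<union> {(pt e l, pt e l') |l l'. nextl l l' \<and> ds (fst e) \<le> l \<and> l' \<le> ds c}))"

text \<open>Edges of earlier chains belong to other tight edges; earlier edges of the same chain
  start on lower levels, and \<open>pt e\<close> is injective because \<open>lev\<close> inverts
  it.\<close>

lemma chain_new_edge:
  assumes j: "j < length es" and e: "e = es ! j" "e \<in> Tight" and n: "nextl l l'" "ds (fst e) \<le> l" "l' \<le>
      ds (snd e)"
  shows "(pt e l, pt e l') \<notin> FS j \<union> {(pt e k, pt e k') |k k'. nextl k k' \<and> ds (fst e) \<le> k \<and> k' \<le> l}"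
proof
  assume "(pt e l, pt e l') \<in> FS j \<union> {(pt e k, pt e k') |k k'. nextl k k' \<and> ds (fst e) \<le> k \<and> k' \<le> l}"
  then show False
  proof
    assume "(pt e l, pt e l') \<in> FS j"
    then obtain e' where e': "e' \<in> set (take j es)" "(pt e l, pt e l') \<in> FAe e'" unfolding FS_def by auto
    have "(pt e l, pt e l') \<in> FAe e" using n unfolding FAe_def by blast
    then show False using FAe_disjoint[OF e'(2)] e'(1) take_fresh[OF j] e(1) by auto
  next
    assume "(pt e l, pt e l') \<in> {(pt e k, pt e k') |k k'. nextl k k' \<and> ds (fst e) \<le> k \<and> k' \<le> l}"
    then obtain k k' where k: "pt e l = pt e k" "nextl k k'" "k' \<le> l" by auto
    have "l = k" using k(1) lev_pt by metis
    then show False using k(2,3) by (simp add: nextl_def)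
  qed
qed

lemma run_chain_step:
  assumes j: "j < length es" and e: "es ! j \<in> Tight" and I: "chain_inv j \<sigma>"
    and b: "bval (RLess (RRead rDS upPos) (RRead rDS (headOf aP))) \<sigma>"
  shows "run chain_step \<sigma> (\<lambda>k \<sigma>'. k \<le> 7 \<and> chain_inv j \<sigma>' \<and>
    card {l \<in> Lev. ds (nmem \<sigma>' aPos 0) < l} < card {l \<in> Lev. ds (nmem \<sigma> aPos 0) < l})"
proof -
  define c e where "c = nmem \<sigma> aPos 0" and "e = es ! j"
  define c' where "c' = nmem \<sigma> aUp c - 1"
  have I': "base \<sigma>" "upspec \<sigma>" "nmem \<sigma> aP 0 = j" "good c" "ds (fst e) \<le> ds c" "ds c < ds (snd e)"
    using I by (auto simp: chain_inv_def Let_def c_def e_def)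
  obtain VL EL where R: "rep \<sigma> VL EL" "nmem \<sigma> aId 0 < length VL" "VL ! nmem \<sigma> aId 0 = pt e (ds c)"
    "set VL = VS j \<union> {Inr (e, l) |l. l \<in> Lev \<and> ds (fst e) < l \<and> l \<le> ds c}"
    "set EL = FS j \<union> {(pt e l, pt e l') |l l'. nextl l l' \<and> ds (fst e) \<le> l \<and> l' \<le> ds c}"
    using I by (auto simp: chain_inv_def Let_def c_def e_def)
  have eT: "e \<in> Tight" using e by (simp add: e_def)
  have gv: "good (fst e)" "good (snd e)" "ds (snd e) \<in> Lev" using TightD[of "fst e" "snd e"] eT by auto
  have c': "good c'" "nextl (ds c) (ds c')" using I'(2,4,6) gv(2) unfolding upspec_def c'_def by blast+
  have io: "nmem \<sigma> 2 j = snd e" using I'(1) j by (auto simp: base_def inp_def e_def)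
  have dsv: "rmem \<sigma> rDS c' = ds c'" "rmem \<sigma> rDS (snd e) = ds (snd e)" "rmem \<sigma> rDS c = ds c"
    using I'(1,4) c'(1) gv by (auto simp: base_def)
  have lt: "ds c' < ds (snd e)" using b io I'(3) dsv by (simp add: c_def[symmetric] c'_def[symmetric])
  have lt2: "ds c < ds c'" "ds c' \<in> Lev" using c'(2) by (auto simp: nextl_def)
  have p: "pt e (ds c') = Inr (e, ds c')" using lt lt2 I'(5) by (simp add: pt_def)
  have fresh: "Inr (e, ds c') \<notin> set VL" using R(4) lt2 take_fresh[OF j] by (auto simp: VS_def e_def)
  let ?VL = "VL @ [Inr (e, ds c')]" and ?EL = "EL @ [(pt e (ds c), pt e (ds c'))]"
  let ?N = "length VL" and ?M = "length EL"
  have NM: "nmem \<sigma> aNV 0 = ?N" "nmem \<sigma> aNE 0 = ?M" using R(1) by (auto simp: rep_def)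
  \<comment> \<open>The program writes the edge before it counts the new vertex, but
    \<open>rep\<close> requires the vertex first. This auxiliary state, which the program never
    reaches, reorders the two updates.\<close>
  let ?\<sigma>0 = "nwrite aNV 0 (Suc ?N) \<sigma>"
  let ?\<sigma>1 = "nwrite aNE 0 (Suc ?M) (rwrite rWeights ?M (ds c' - ds c) (nwrite aHeads ?M ?N (nwrite
      aTails ?M (nmem \<sigma> aId 0) \<sigma>)))"
  let ?\<sigma>2 = "nwrite aNV 0 (Suc ?N) (nwrite aId 0 ?N (nwrite aPos 0 c' ?\<sigma>1))"
  have new: "(pt e (ds c), pt e (ds c')) \<notin> set EL" unfolding R(5)
    using chain_new_edge[OF j e_def eT c'(2) I'(5) less_imp_le[OF lt]] .
  have W: "WA (pt e (ds c), pt e (ds c')) = ds c' - ds c" using lt2 by (simp add: WA_def)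
  have r0: "rep ?\<sigma>0 ?VL EL" by (rule rep_vert[OF R(1) fresh]) simp_all
  have "rep ?\<sigma>2 ?VL (EL @ [(?VL ! nmem \<sigma> aId 0, ?VL ! ?N)])"
    by (rule rep_edge[OF r0, where x = "ds c' - ds c"]) (use R(2,3) new p W in \<open>auto simp: nth_append\<close>)
  then have r2: "rep ?\<sigma>2 ?VL ?EL" using R(2,3) p by (simp add: nth_append)
  have sV: "set ?VL = VS j \<union> {Inr (e, l) |l. l \<in> Lev \<and> ds (fst e) < l \<and> l \<le> ds c'}"
    using R(4) lt2 I'(5) c'(2) unfolding nextl_def by force
  have sE: "set ?EL = FS j \<union> {(pt e l, pt e l') |l l'. nextl l l' \<and> ds (fst e) \<le> l \<and> l' \<le> ds c'}"
    unfolding nextl_pairs[OF c'(2) I'(5)] using R(5) by auto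
  have bs: "base ?\<sigma>2" "upspec ?\<sigma>2" using I'(1,2) base_cong[of ?\<sigma>2 \<sigma>] by (auto simp: upspec_def)
  have "chain_inv j ?\<sigma>2" unfolding chain_inv_def Let_def e_def[symmetric]
    using bs I'(3,5) c'(1) lt lt2 p
    by (intro conjI exI[of _ ?VL] exI[of _ ?EL]) (use r2 sV sE in \<open>auto simp: nth_append\<close>)
  moreover have "card {l \<in> Lev. ds c' < l} < card {l \<in> Lev. ds c < l}"
    by (rule psubset_card_mono) (use finLev lt2 in auto)
  ultimately show ?thesis
    unfolding chain_step_def add_edge_def
    by (simp add: NM dsv c_def[symmetric] c'_def[symmetric])
qed

definition built :: "nat \<Rightarrow> state \<Rightarrow> bool" where
  "built j \<sigma> \<longleftrightarrow> base \<sigma> \<and> upspec \<sigma> \<and> (\<exists>VL EL. rep \<sigma> VL EL \<and> set VL = VS j \<and> set EL = FS j)"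

text \<open>There are at most \<open>n\<close> levels, each costing 7 steps and a test. The final 7
  consists of two initial writes, the failing test and the four steps for the last edge.\<close>

lemma run_add_chain:
  assumes j: "j < length es" and e: "es ! j \<in> Tight" and B: "built j \<sigma>" and p: "nmem \<sigma> aP 0 = j"
  shows "run add_chain \<sigma> (\<lambda>k \<sigma>'. k \<le> 8 * n + 7 \<and> built (Suc j) \<sigma>')"
proof -
  define u v where "u = fst (es ! j)" and "v = snd (es ! j)"
  have uv: "es ! j = (u, v)" by (simp add: u_def v_def)
  have T: "(u, v) \<in> Tight" using e uv by simp
  have g: "good u" "good v" "ds u < ds v" "ds v \<in> Lev" "ds u \<in> Lev" using TightD[OF T] tight_less[OF T]
      by auto
  have b: "base \<sigma>" "upspec \<sigma>" using B by (auto simp: built_def)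
  obtain VL EL where R: "rep \<sigma> VL EL" "set VL = VS j" "set EL = FS j" using B by (auto simp: built_def)
  have io: "nmem \<sigma> 1 j = u" "nmem \<sigma> 2 j = v" using b(1) j by (auto simp: base_def inp_def u_def v_def)
  let ?\<sigma>1 = "nwrite aId 0 (nmem \<sigma> aIdx u) (nwrite aPos 0 u \<sigma>)"
  have r1: "rep ?\<sigma>1 VL EL" using R(1) rep_cong[of ?\<sigma>1 \<sigma>] by simp
  have "nmem \<sigma> aIdx u < length VL" "VL ! nmem \<sigma> aIdx u = Inl u" using R(1) g(1) by (auto simp: rep_def)
  moreover have "{(pt (u, v) l, pt (u, v) l') |l l'. nextl l l' \<and> ds u \<le> l \<and> l' \<le> ds u} = {}"
    by (auto simp: nextl_def)
  moreover have "pt (u, v) (ds u) = Inl u" by (simp add: pt_def)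
  ultimately have I1: "chain_inv j ?\<sigma>1" unfolding chain_inv_def Let_def uv
    using b base_cong[of ?\<sigma>1 \<sigma>] g p r1 R(2,3)
    by (intro conjI exI[of _ VL] exI[of _ EL]) (auto simp: upspec_def)
  let ?f = "\<lambda>\<sigma>. card {l \<in> Lev. ds (nmem \<sigma> aPos 0) < l}"
  let ?b = "RLess (RRead rDS upPos) (RRead rDS (headOf aP))"
  have loop: "run (While ?b chain_step) ?\<sigma>1 (\<lambda>k \<sigma>'. k \<le> ?f ?\<sigma>1 * (7 + 1) + 1 \<and> chain_inv j \<sigma>' \<and> \<not> bval ?b \<sigma>')"
    by (rule run_While[where I = "chain_inv j" and f = ?f, OF I1 run_chain_step[OF j e]])
  have "?f ?\<sigma>1 \<le> card Lev" using finLev by (auto intro: card_mono)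
  then have fle: "?f ?\<sigma>1 \<le> n" using card_Lev card_Good_n by linarith
  have fin: "run (add_edge (sc aId) (NRead aIdx (headOf aP)) (RSub (RRead rDS (headOf aP)) (RRead rDS
      (sc aPos)))) \<sigma>'
      (\<lambda>k \<sigma>''. k \<le> 4 \<and> built (Suc j) \<sigma>'')" if I: "chain_inv j \<sigma>'" and nb: "\<not> bval ?b \<sigma>'" for \<sigma>'
  proof -
    define c where "c = nmem \<sigma>' aPos 0"
    define c' where "c' = nmem \<sigma>' aUp c - 1"
    have I': "base \<sigma>'" "upspec \<sigma>'" "nmem \<sigma>' aP 0 = j" "good c" "ds u \<le> ds c" "ds c < ds v"
      using I by (auto simp: chain_inv_def Let_def c_def uv)
    obtain VL EL where R: "rep \<sigma>' VL EL" "nmem \<sigma>' aId 0 < length VL" "VL ! nmem \<sigma>' aId 0 = pt (u, v) (ds c)"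
      "set VL = VS j \<union> {Inr ((u, v), l) |l. l \<in> Lev \<and> ds u < l \<and> l \<le> ds c}"
      "set EL = FS j \<union> {(pt (u, v) l, pt (u, v) l') |l l'. nextl l l' \<and> ds u \<le> l \<and> l' \<le> ds c}"
      using I by (auto simp: chain_inv_def Let_def c_def uv)
    have c': "good c'" "nextl (ds c) (ds c')" using I'(2,4,6) g(2) unfolding upspec_def c'_def by blast+
    have io: "nmem \<sigma>' 2 j = v" using I'(1) j by (auto simp: base_def inp_def v_def)
    have dsv: "rmem \<sigma>' rDS c' = ds c'" "rmem \<sigma>' rDS v = ds v" "rmem \<sigma>' rDS c = ds c"
      using I'(1,4) c'(1) g by (auto simp: base_def)
    have "\<not> ds c' < ds v" using nb io I'(3) dsv by (simp add: c_def[symmetric] c'_def[symmetric])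
    \<comment> \<open>On exit the next level is not below that of the head. It is not above it
      either, since the head itself lies on an occurring level above \<open>ds c\<close>.\<close>
    then have eq: "ds c' = ds v" using c'(2) g(4) I'(6) unfolding nextl_def by force
    then have nv: "nextl (ds c) (ds v)" using c'(2) by simp
    have pv: "pt (u, v) (ds v) = Inl v" using g(3) by (simp add: pt_def)
    have new: "(pt (u, v) (ds c), Inl v) \<notin> set EL" unfolding R(5)
      using chain_new_edge[OF j, of "(u, v)", OF _ T nv] I'(5) uv pv by auto
    have ix: "nmem \<sigma>' aIdx v < length VL" "VL ! nmem \<sigma>' aIdx v = Inl v" using R(1) g(2) by (auto simp:
        rep_def)
    have W: "WA (pt (u, v) (ds c), Inl v) = ds v - ds c" using I'(6) by (simp add: WA_def)
    let ?E = "EL @ [(pt (u, v) (ds c), Inl v)]"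
    let ?e = "add_edge (sc aId) (NRead aIdx (headOf aP)) (RSub (RRead rDS (headOf aP)) (RRead rDS (sc aPos)))"
    have run: "run ?e \<sigma>' (\<lambda>k \<sigma>''. k \<le> 4 \<and> rep \<sigma>'' VL ?E \<and> keeps ?e \<sigma>' \<sigma>'')"
      using run_add_edge[OF R(1), of "sc aId" "NRead aIdx (headOf aP)" "RSub (RRead rDS (headOf aP))
          (RRead rDS (sc aPos))"]
        R(2,3) ix new W io I'(3) dsv by (simp add: c_def[symmetric])
    have "l \<in> Lev \<and> ds u < l \<and> l \<le> ds c \<longleftrightarrow> l \<in> Lev \<and> ds u < l \<and> l < ds v" for l
      using nv I'(6) unfolding nextl_def by force
    then have sV: "set VL = VS (Suc j)" using R(4) Suc_sets(3)[OF j e] uv by simp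
    have "FAe (u, v) = insert (pt (u, v) (ds c), Inl v) {(pt (u, v) l, pt (u, v) l') |l l'. nextl l l' \<and>
        ds u \<le> l \<and> l' \<le> ds c}"
      unfolding FAe_def fst_conv snd_conv nextl_pairs[OF nv I'(5)] pv ..
    then have sE: "set ?E = FS (Suc j)" using R(5) Suc_sets(4)[OF j e] uv by auto
    show ?thesis
    proof (rule run_mono[OF run], goal_cases)
      case (1 k \<sigma>'')
      then have "base \<sigma>''" "upspec \<sigma>''" using I'(1,2) base_cong[of \<sigma>'' \<sigma>'] by (auto simp: keeps_def
          upspec_def)
      then show ?case using 1 sV sE unfolding built_def by blast
    qed
  qed
  have "run (Seq (While ?b chain_step) (add_edge (sc aId) (NRead aIdx (headOf aP)) (RSub (RRead rDS
      (headOf aP)) (RRead rDS (sc aPos))))) ?\<sigma>1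
    (\<lambda>k \<sigma>'. 2 + k \<le> 8 * n + 7 \<and> built (Suc j) \<sigma>')"
    by (rule run_SeqI[OF loop], rule run_mono[OF fin]) (use fle in auto)
  then show ?thesis unfolding add_chain_def by (simp add: p io)
qed

lemma run_add_chains:
  assumes "built 0 \<sigma>"
  shows "run add_chains \<sigma> (\<lambda>k \<sigma>'. k \<le> length es * ((8 * n + 8) + 2) + 2 \<and> built (length es) \<sigma>' \<and> keeps
      add_chains \<sigma> \<sigma>')"
  unfolding add_chains_def
proof (rule run_For[where I = built], goal_cases)
  case (1 \<sigma>') then show ?case using assms by (simp add: keeps_def built_def base_def inp_def)
next
  case 2 then show ?case by simp
next
  case 3
  have "built 0 (nwrite aP 0 0 \<sigma>) \<longleftrightarrow> built 0 \<sigma>" unfolding built_def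
    using base_cong[of "nwrite aP 0 0 \<sigma>" \<sigma>] rep_cong[of "nwrite aP 0 0 \<sigma>" \<sigma>] by (simp add: upspec_def)
  then show ?case using assms by simp
next
  case (4 j \<tau>)
  have cg: "built (Suc j) (nwrite aP 0 (Suc j) \<tau>') \<longleftrightarrow> built (Suc j) \<tau>'" for \<tau>' unfolding built_def
    using base_cong[of "nwrite aP 0 (Suc j) \<tau>'" \<tau>'] rep_cong[of "nwrite aP 0 (Suc j) \<tau>'" \<tau>'] by (simp
        add: upspec_def)
  have tj: "nmem \<tau> aTight j = of_bool (es ! j \<in> Tight)" using 4(1,2) by (simp add: built_def base_def)
  show ?case
  proof (cases "es ! j \<in> Tight")
    case True
    then show ?thesis using tj run_mono[OF run_add_chain[OF 4(1) True 4(2,3)]] by (simp add: 4(3) cg)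
  next
    case False
    then have "built (Suc j) \<tau>" using 4(2) Suc_sets(1,2)[OF 4(1) False] by (simp add: built_def)
    then show ?thesis using tj False by (simp add: 4(3) cg)
  qed
qed

end

section \<open>Back-edges and the direct candidate\<close>

context connected_instance
begin

definition updet :: "nat \<Rightarrow> nat \<Rightarrow> bool" where
  "updet u v \<longleftrightarrow> good u \<and> good v \<and> u \<noteq> v \<and> ds u \<le> ds v \<and> (\<exists>p. walk (Det v) u p v)"

definition upval :: "nat \<Rightarrow> nat \<Rightarrow> real" where
  "upval u v = ds u + detour u v + dt v"

definition cand :: "state \<Rightarrow> (nat \<times> nat) set \<Rightarrow> bool" where
  "cand \<sigma> Pr \<longleftrightarrow> (nmem \<sigma> aHas 0 \<noteq> 0 \<longleftrightarrow> (\<exists>(a, b)\<in>Pr. updet a b)) \<and>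
    (nmem \<sigma> aHas 0 \<noteq> 0 \<longrightarrow> updet (nmem \<sigma> aBestU 0) (nmem \<sigma> aBestV 0) \<and>
      rmem \<sigma> rBest 0 = upval (nmem \<sigma> aBestU 0) (nmem \<sigma> aBestV 0) \<and>
      (\<forall>(a, b)\<in>Pr. updet a b \<longrightarrow> rmem \<sigma> rBest 0 \<le> upval a b))"

definition detinv :: "state \<Rightarrow> (nat \<times> nat) set \<Rightarrow> bool" where
  "detinv \<sigma> Pr \<longleftrightarrow> base \<sigma> \<and> cand \<sigma> Pr \<and> (\<exists>VL EL. rep \<sigma> VL EL \<and> set VL = VA \<and>
    set EL = FA \<union> (BA \<inter> {(Inl a, Inl b) |a b. (a, b) \<in> Pr}))"

text \<open>Only pairs of good vertices matter. This identifies a completed row with the start of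
  the next one, and the end of the loops with \<open>UNIV\<close>.\<close>

lemma detinv_cong:
  assumes "\<And>a b. good a \<Longrightarrow> good b \<Longrightarrow> (a, b) \<in> Pr \<longleftrightarrow> (a, b) \<in> Pr'"
  shows "detinv \<sigma> Pr \<longleftrightarrow> detinv \<sigma> Pr'"
proof -
  have "BA \<inter> {(Inl a, Inl b) |a b. (a, b) \<in> Pr} = BA \<inter> {(Inl a, Inl b) |a b. (a, b) \<in> Pr'}"
    using assms unfolding BA_def by blast
  moreover have u: "updet a b \<Longrightarrow> (a, b) \<in> Pr \<longleftrightarrow> (a, b) \<in> Pr'" for a b using assms unfolding updet_def by blast
  have "(\<exists>(a, b)\<in>Pr. updet a b) \<longleftrightarrow> (\<exists>(a, b)\<in>Pr'. updet a b)"
    "(\<forall>(a, b)\<in>Pr. updet a b \<longrightarrow> x \<le> upval a b) \<longleftrightarrow> (\<forall>(a, b)\<in>Pr'. updet a b \<longrightarrow> x \<le> upval a b)" for x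
    using u by blast+
  then have "cand \<sigma> Pr \<longleftrightarrow> cand \<sigma> Pr'" unfolding cand_def by simp
  ultimately show ?thesis unfolding detinv_def by simp
qed

lemma detinv_state_cong:
  assumes "nmem \<sigma>' 0 = nmem \<sigma> 0" "nmem \<sigma>' 1 = nmem \<sigma> 1" "nmem \<sigma>' 2 = nmem \<sigma> 2" "rmem \<sigma>' 0 = rmem \<sigma> 0"
    "nmem \<sigma>' aGood = nmem \<sigma> aGood" "nmem \<sigma>' aTight = nmem \<sigma> aTight"
    "rmem \<sigma>' rDS = rmem \<sigma> rDS" "rmem \<sigma>' rDT = rmem \<sigma> rDT"
    "nmem \<sigma>' aNV = nmem \<sigma> aNV" "nmem \<sigma>' aNE = nmem \<sigma> aNE" "nmem \<sigma>' aTails = nmem \<sigma> aTails"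
    "nmem \<sigma>' aHeads = nmem \<sigma> aHeads" "rmem \<sigma>' rWeights = rmem \<sigma> rWeights" "nmem \<sigma>' aIdx = nmem \<sigma> aIdx"
    "nmem \<sigma>' aLab = nmem \<sigma> aLab" "nmem \<sigma>' aHas = nmem \<sigma> aHas" "nmem \<sigma>' aBestU = nmem \<sigma> aBestU"
    "nmem \<sigma>' aBestV = nmem \<sigma> aBestV" "rmem \<sigma>' rBest = rmem \<sigma> rBest"
  shows "detinv \<sigma>' Pr \<longleftrightarrow> detinv \<sigma> Pr"
  unfolding detinv_def cand_def base_cong[OF assms(1-8)] rep_cong[OF assms(9-15)] using assms(16-) by simp

text \<open>Pairs of start and target in the order of treatment. The target is the outer loop
  because one distance computation serves one target.\<close>

definition proc :: "nat \<Rightarrow> nat \<Rightarrow> (nat \<times> nat) set" where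
  "proc v u = {(a, b). b < v \<or> b = v \<and> a < u}"

lemma proc_Suc: "proc v (Suc u) = insert (u, v) (proc v u)"
  by (auto simp: proc_def less_Suc_eq)

lemma run_do_pair:
  assumes I: "detinv \<sigma> (proc v u)" and v: "nmem \<sigma> aP 0 = v" "good v" and u: "nmem \<sigma> aQ 0 = u" "u < n"
    and D: "dist_spec (Det v) v (nmem \<sigma> aReach) (rmem \<sigma> rDist) (nmem \<sigma> aNext)"
  shows "run do_pair \<sigma> (\<lambda>k \<sigma>'. k \<le> 7 \<and> detinv \<sigma>' (proc v (Suc u)))"
proof -
  obtain VL EL where R: "rep \<sigma> VL EL" "set VL = VA" "set EL = FA \<union> (BA \<inter> {(Inl a, Inl b) |a b. (a, b) \<in>
      proc v u})"
    and b: "base \<sigma>" and c: "cand \<sigma> (proc v u)" using I unfolding detinv_def by blast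
  let ?P = "proc v u"
  have gu: "nmem \<sigma> aGood u = of_bool (good u)" using b by (simp add: base_def)
  have ru: "nmem \<sigma> aReach u \<noteq> 0 \<longleftrightarrow> (\<exists>p. walk (Det v) u p v)" using D u(2) unfolding dist_spec_def by blast
  have du: "rmem \<sigma> rDist u = detour u v" if "nmem \<sigma> aReach u \<noteq> 0"
    using D u(2) that unfolding dist_spec_def detour_def by blast
  have dsv: "good x \<Longrightarrow> rmem \<sigma> rDS x = ds x" "good x \<Longrightarrow> rmem \<sigma> rDT x = dt x" for x using b by (auto simp:
      base_def)
  have fresh: "(u, v) \<notin> ?P" by (simp add: proc_def)
  show ?thesis
  proof (cases "good u \<and> nmem \<sigma> aReach u \<noteq> 0 \<and> u \<noteq> v")
    case False
    have "\<not> updet u v" "(Inl u, Inl v) \<notin> BA" using False ru by (auto simp: updet_def BA_def)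
    then have "detinv \<sigma> (proc v (Suc u))" unfolding detinv_def proc_Suc
      using b c R by (intro conjI exI[of _ VL] exI[of _ EL]) (auto simp: cand_def)
    then show ?thesis using False gu v(1) u(1) unfolding do_pair_def by auto
  next
    case True
    then have cnd: "bval (And (nz (NRead aGood (sc aQ))) (And (nz (NRead aReach (sc aQ))) (neq (sc aQ)
        (sc aP)))) \<sigma>"
      using gu v(1) u(1) by auto
    obtain p where p: "walk (Det v) u p v" using True ru by blast
    show ?thesis
    proof (cases "ds v < ds u")
      case lt: True
      have B: "(Inl u, Inl v) \<in> BA" using lt True v(2) p by (auto simp: BA_def)
      have new: "(Inl u, Inl v) \<notin> set EL" using R(3) fresh FA_next[of "Inl u" "Inl v"] lt by (auto simp:
          nextl_def)
      have ix: "nmem \<sigma> aIdx u < length VL" "VL ! nmem \<sigma> aIdx u = Inl u" "nmem \<sigma> aIdx v < length VL"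
        "VL ! nmem \<sigma> aIdx v = Inl v" using R(1) v(2) True by (auto simp: rep_def)
      let ?e = "add_edge (NRead aIdx (sc aQ)) (NRead aIdx (sc aP)) (RRead rDist (sc aQ))"
      have run: "run ?e \<sigma> (\<lambda>k \<sigma>'. k \<le> 4 \<and> rep \<sigma>' VL (EL @ [(Inl u, Inl v)]) \<and> keeps ?e \<sigma> \<sigma>')"
        using run_add_edge[OF R(1), of "NRead aIdx (sc aQ)" "NRead aIdx (sc aP)" "RRead rDist (sc aQ)"]
          ix new WA_BA[OF B] du True v(1) u(1) by simp
      have nu: "\<not> updet u v" using lt by (simp add: updet_def)
      have "run ?e \<sigma> (\<lambda>k \<sigma>'. 2 + k \<le> 7 \<and> detinv \<sigma>' (proc v (Suc u)))"
      proof (rule run_mono[OF run], goal_cases)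
        case (1 k \<sigma>')
        then have "base \<sigma>'" "cand \<sigma>' ?P" using b c base_cong[of \<sigma>' \<sigma>] by (auto simp: keeps_def cand_def)
        moreover have "set (EL @ [(Inl u, Inl v)]) = FA \<union> (BA \<inter> {(Inl a, Inl b) |a b. (a, b) \<in> proc v
            (Suc u)})"
          using R(3) B unfolding proc_Suc by auto
        ultimately show ?case using 1 R(2) nu unfolding detinv_def
          by (intro conjI exI[of _ VL] exI[of _ "EL @ [(Inl u, Inl v)]"]) (auto simp: cand_def proc_Suc)
      qed
      then show ?thesis unfolding do_pair_def run_If using cnd lt dsv True v u by simp
    next
      case ge: False
      have U: "updet u v" using ge True v(2) p by (auto simp: updet_def)
      have nB: "(Inl u, Inl v) \<notin> BA" using ge by (auto simp: BA_def)
      have sE: "set EL = FA \<union> (BA \<inter> {(Inl a, Inl b) |a b. (a, b) \<in> proc v (Suc u)})"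
        using R(3) nB unfolding proc_Suc by auto
      have pc: "rval pairCost \<sigma> = upval u v" using dsv True v u du by (simp add: upval_def)
      show ?thesis
      proof (cases "nmem \<sigma> aHas 0 = 0 \<or> upval u v < rmem \<sigma> rBest 0")
        case better: True
        let ?\<sigma>' = "nwrite aBestV 0 v (nwrite aBestU 0 u (rwrite rBest 0 (upval u v) (nwrite aHas 0 1 \<sigma>)))"
        have "base ?\<sigma>'" "rep ?\<sigma>' VL EL" using b R(1) base_cong[of ?\<sigma>' \<sigma>] rep_cong[of ?\<sigma>' \<sigma>] by auto
        moreover have "cand ?\<sigma>' (proc v (Suc u))" using c U better unfolding cand_def proc_Suc by force
        ultimately have "detinv ?\<sigma>' (proc v (Suc u))" using R(2) sE unfolding detinv_def by blast
        then show ?thesis unfolding do_pair_def candidate_def run_If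
          using cnd ge dsv True v u pc better by simp
      next
        case worse: False
        have "cand \<sigma> (proc v (Suc u))" using c U worse unfolding cand_def proc_Suc by auto
        then have "detinv \<sigma> (proc v (Suc u))" using b R(1,2) sE unfolding detinv_def by blast
        then show ?thesis unfolding do_pair_def candidate_def run_If
          using cnd ge dsv True v u pc worse by simp
      qed
    qed
  qed
qed

lemma run_add_detours:
  assumes I: "detinv \<sigma> {}" and m: "nmem \<sigma> aMode 0 = 1"
  shows "run add_detours \<sigma> (\<lambda>k \<sigma>'. k \<le> n * ((tD + 9 * n + 4) + 2) + 2 \<and> detinv \<sigma>' UNIV \<and> keeps
      add_detours \<sigma> \<sigma>')"
proof -
  have "run add_detours \<sigma> (\<lambda>k \<sigma>'. k \<le> n * ((tD + 9 * n + 4) + 2) + 2 \<and> detinv \<sigma>' (proc n 0) \<and> keeps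
      add_detours \<sigma> \<sigma>')"
    unfolding add_detours_def
  proof (rule run_For[where I = "\<lambda>v \<sigma>. detinv \<sigma> (proc v 0)"], goal_cases)
    case (1 \<sigma>') then show ?case using I by (simp add: keeps_def detinv_def base_def inp_def)
  next
    case 2 then show ?case by simp
  next
    case 3
    have "detinv (nwrite aP 0 0 \<sigma>) {}" using I detinv_state_cong[of "nwrite aP 0 0 \<sigma>" \<sigma>] by simp
    then show ?case by (simp add: proc_def)
  next
    case (4 v \<tau>)
    have md: "nmem \<tau> aMode 0 = 1" using 4(4) m by (simp add: keeps_def)
    have b: "base \<tau>" using 4(2) by (simp add: detinv_def)
    have gv: "nmem \<tau> aGood v = of_bool (good v)" using b by (simp add: base_def)
    have cg: "detinv (nwrite aP 0 (Suc v) \<tau>') (proc (Suc v) 0) \<longleftrightarrow> detinv \<tau>' (proc v n)" for \<tau>'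
    proof -
      have "detinv (nwrite aP 0 (Suc v) \<tau>') (proc (Suc v) 0) \<longleftrightarrow> detinv \<tau>' (proc (Suc v) 0)"
        by (rule detinv_state_cong) auto
      also have "\<dots> \<longleftrightarrow> detinv \<tau>' (proc v n)"
        by (rule detinv_cong) (use good_less in \<open>auto simp: proc_def less_Suc_eq\<close>)
      finally show ?thesis .
    qed
    show ?case
    proof (cases "good v")
      case False
      have "detinv \<tau> (proc v 0) \<longleftrightarrow> detinv \<tau> (proc v n)"
        by (rule detinv_cong) (use False in \<open>auto simp: proc_def\<close>)
      then show ?thesis using 4(2) gv False by (simp add: 4(3) cg)
    next
      case True
      let ?\<tau> = "nwrite aTarget 0 v \<tau>"
      have b1: "base ?\<tau>" "detinv ?\<tau> (proc v 0)" using b base_cong[of ?\<tau> \<tau>] 4(2) detinv_state_cong[of ?\<tau>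
          \<tau>] by auto
      have u1: "usable ?\<tau> = Det v" using usable_base(2)[OF b1(1)] md by simp
      have dist: "run dist_to ?\<tau> (\<lambda>l \<tau>'. l \<le> tD \<and>
        dist_spec (Det v) v (nmem \<tau>' aReach) (rmem \<tau>' rDist) (nmem \<tau>' aNext) \<and> keeps dist_to ?\<tau> \<tau>')"
        using run_dist_to[OF base_inp[OF b1(1)]] u1 4(1) by simp
      have inner: "run (For aQ xN do_pair) \<tau>1 (\<lambda>k \<tau>'. k \<le> n * (7 + 2) + 2 \<and> detinv \<tau>' (proc v n) \<and> keeps
          (For aQ xN do_pair) \<tau>1 \<tau>')"
        if d1: "dist_spec (Det v) v (nmem \<tau>1 aReach) (rmem \<tau>1 rDist) (nmem \<tau>1 aNext)" and k1: "keeps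
            dist_to ?\<tau> \<tau>1" for \<tau>1
      proof (rule run_For[where I = "\<lambda>u \<tau>. detinv \<tau> (proc v u)"], goal_cases)
        case (1 \<sigma>') then show ?case using b k1 by (simp add: keeps_def base_def inp_def)
      next
        case 2 then show ?case by simp
      next
        case 3
        have "detinv (nwrite aQ 0 0 \<tau>1) (proc v 0) \<longleftrightarrow> detinv ?\<tau> (proc v 0)"
          by (rule detinv_state_cong) (use k1 in \<open>auto simp: keeps_def\<close>)
        then show ?case using b1 by simp
      next
        case (4 u \<tau>2)
        have "run do_pair \<tau>2 (\<lambda>k \<sigma>'. k \<le> 7 \<and> detinv \<sigma>' (proc v (Suc u)))"
          by (rule run_do_pair[OF 4(2) _ True 4(3) 4(1)])
            (use 4(4) k1 d1 \<open>nmem \<tau> aP 0 = v\<close> in \<open>auto simp: keeps_def\<close>)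
        then show ?case
        proof (rule run_mono, goal_cases)
          case (1 k \<sigma>')
          have "detinv (nwrite aQ 0 (Suc u) \<sigma>') (proc v (Suc u)) \<longleftrightarrow> detinv \<sigma>' (proc v (Suc u))"
            by (rule detinv_state_cong) auto
          then show ?case using 1 by simp
        qed
      qed
      have "run (Seq dist_to (For aQ xN do_pair)) ?\<tau> (\<lambda>k \<tau>'. 2 + k \<le> tD + 9 * n + 4 \<and> detinv \<tau>' (proc v n))"
        by (rule run_SeqI[OF dist], rule run_mono[OF inner]) auto
      then show ?thesis using gv True by (simp add: 4(3) cg)
    qed
  qed
  moreover have "detinv \<sigma>' (proc n 0) \<longleftrightarrow> detinv \<sigma>' UNIV" for \<sigma>'
    by (rule detinv_cong) (use good_less in \<open>auto simp: proc_def\<close>)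
  ultimately show ?thesis by simp
qed

end

definition prepare :: com where
  "prepare = Seq mark_good (Seq mark_tight (Seq (put aMode (NConst 1)) (Seq number_good (Seq find_up
     (Seq add_chains (Seq add_detours
     (Seq (NWrite sh (NConst 0) (sc aNV)) (Seq (NWrite sh (NConst 1) (sc aNE))
     (Seq (NWrite sh (NConst 2) (NRead aIdx xS)) (NWrite sh (NConst 3) (NRead aIdx xT)))))))))))"

lemma mods_prepare [simp]:
  "nmods prepare = {aP, aQ, aGood, aTight, aMode, aIdx, aLab, aNV, aUp, aTails, aHeads, aNE, aPos, aId,
     aTarget, aI, aReach, aK, aJ, aNext, aHas, aBestU, aBestV, sh}"
  "rmods prepare = {rDT, rWeights, rDist, rBest}"
  by (auto simp: prepare_def)

context connected_instance
begin

definition tP :: nat where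
  "tP = (n * (3 + 2) + 2) + (length es * (2 + 2) + 2) + (n * (4 + 2) + 2) + (n * ((n * (2 + 2) + 2) + 2)
      + 2) +
    (length es * ((8 * n + 8) + 2) + 2) + (n * ((tD + 9 * n + 4) + 2) + 2) + 5"

lemma run_prepare:
  assumes i: "inp \<sigma>"
    and z: "nmem \<sigma> aGood = (\<lambda>_. 0)" "nmem \<sigma> aTight = (\<lambda>_. 0)" "nmem \<sigma> aNV = (\<lambda>_. 0)" "nmem \<sigma> aLab = (\<lambda>_. 0)"
      "nmem \<sigma> aUp = (\<lambda>_. 0)" "nmem \<sigma> aNE = (\<lambda>_. 0)" "nmem \<sigma> aTails = (\<lambda>_. 0)" "nmem \<sigma> aHeads = (\<lambda>_. 0)"
      "nmem \<sigma> aHas = (\<lambda>_. 0)" "rmem \<sigma> rWeights = (\<lambda>_. 0)" "nmem \<sigma> sh = (\<lambda>_. 0)"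
    and S: "\<forall>v<n. (nmem \<sigma> aFromS v \<noteq> 0 \<longleftrightarrow> (\<exists>p. walk (set es) s p v)) \<and>
      (nmem \<sigma> aFromS v \<noteq> 0 \<longrightarrow> rmem \<sigma> rDS v = wdist (set es) w s v)"
    and T: "\<forall>v<n. (nmem \<sigma> aReach v \<noteq> 0 \<longleftrightarrow> (\<exists>p. walk (set es) v p t)) \<and>
      (nmem \<sigma> aReach v \<noteq> 0 \<longrightarrow> rmem \<sigma> rDist v = wdist (set es) w v t)"
  shows "run prepare \<sigma> (\<lambda>k \<sigma>'. k \<le> tP \<and> detinv \<sigma>' UNIV \<and> nmem \<sigma>' aMode 0 = 1 \<and>
    nmem \<sigma>' sh = array_of [nmem \<sigma>' aNV 0, nmem \<sigma>' aNE 0, nmem \<sigma>' aIdx s, nmem \<sigma>' aIdx t])"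
proof -
  have dsg: "good x \<Longrightarrow> rmem \<sigma> rDS x = ds x" for x
    using S good_less unfolding good_def ds_def by blast
  show ?thesis unfolding prepare_def
  proof (rule run_SeqI[OF run_mark_good[OF i _ S T]], simp add: z(1), goal_cases)
    case (1 k1 \<sigma>1)
    have g1: "nmem \<sigma>1 aGood x = of_bool (good x)" for x using 1 good_less by auto
    have i1: "inp \<sigma>1" using 1 i inp_cong[of \<sigma>1 \<sigma>] by (auto simp: keeps_def)
    have d1: "good x \<Longrightarrow> rmem \<sigma>1 rDS x = ds x" "good x \<Longrightarrow> rmem \<sigma>1 rDT x = dt x" for x
      using 1 dsg good_less by (auto simp: keeps_def)
    have z1: "nmem \<sigma>1 aTight x = 0" for x using 1 z(2) by (simp add: keeps_def)
    show ?case
    proof (rule run_SeqI[OF run_mark_tight[OF i1 z1 g1 d1(1)]], assumption, goal_cases)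
      case (1 k2 \<sigma>2)
      note k2 = this and k1 = \<open>k1 \<le> _ \<and> _\<close>
      let ?\<sigma>3 = "nwrite aMode 0 1 \<sigma>2"
      have b2: "base \<sigma>2" unfolding base_def
        using 1 g1 d1 i1 inp_cong[of \<sigma>2 \<sigma>1] by (auto simp: keeps_def)
      then have b3: "base ?\<sigma>3" using base_cong[of ?\<sigma>3 \<sigma>2] by simp
      have z3: "nmem ?\<sigma>3 aNV 0 = 0" "nmem ?\<sigma>3 aLab i = 0" for i
        using z k1 k2 by (auto simp: keeps_def)
      have "run (Seq number_good (Seq find_up (Seq add_chains (Seq add_detours
         (Seq (NWrite sh (NConst 0) (sc aNV)) (Seq (NWrite sh (NConst 1) (sc aNE))
         (Seq (NWrite sh (NConst 2) (NRead aIdx xS)) (NWrite sh (NConst 3) (NRead aIdx xT)))))))) ) ?\<sigma>3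
         (\<lambda>l \<sigma>'. k1 + (k2 + (1 + l)) \<le> tP \<and> detinv \<sigma>' UNIV \<and> nmem \<sigma>' aMode 0 = 1 \<and>
          nmem \<sigma>' sh = array_of [nmem \<sigma>' aNV 0, nmem \<sigma>' aNE 0, nmem \<sigma>' aIdx s, nmem \<sigma>' aIdx t])"
      proof (rule run_SeqI[OF run_number_good[OF b3 z3]], goal_cases)
        case (1 k4 \<sigma>4)
        note k4 = this
        have b4: "base \<sigma>4" using b3 k4 base_cong[of \<sigma>4 ?\<sigma>3] by (auto simp: keeps_def)
        have z4: "nmem \<sigma>4 aUp x = 0" for x using z k1 k2 k4 by (auto simp: keeps_def)
        show ?case
        proof (rule run_SeqI[OF run_find_up[OF b4 z4]], goal_cases)
          case (1 k5 \<sigma>5)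
          note k5 = this
          have b5: "base \<sigma>5" using b4 k5 base_cong[of \<sigma>5 \<sigma>4] by (auto simp: keeps_def)
          have up5: "upspec \<sigma>5" using k5 unfolding upspec_def by blast
          let ?g = "filter good [0..<n]"
          have "rep \<sigma>5 (map Inl ?g) []"
          proof -
            have sg: "set ?g = Good" using good_less by (auto simp: Good_def)
            have "nmem \<sigma>5 aIdx x < length ?g \<and> ?g ! nmem \<sigma>5 aIdx x = x" if gx: "good x" for x
            proof -
              obtain i where i: "i < length ?g" "x = ?g ! i" using gx sg unfolding Good_def
                by (metis in_set_conv_nth mem_Collect_eq)
              then have "nmem \<sigma>4 aIdx x = i" using k4 unfolding Let_def by blast
              then show ?thesis using i k5 by (simp add: keeps_def)
            qed
            moreover have "nmem \<sigma>5 aNV 0 = length ?g" "\<And>i. nmem \<sigma>5 aLab i = (if i < length ?g then Suc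
                (?g ! i) else 0)"
              using k4 k5 by (auto simp: keeps_def Let_def)
            moreover have "nmem \<sigma>5 aNE 0 = 0" "\<And>i. nmem \<sigma>5 aTails i = 0 \<and> nmem \<sigma>5 aHeads i = 0 \<and> rmem \<sigma>5
                rWeights i = 0"
              using z k1 k2 k4 k5 by (auto simp: keeps_def)
            ultimately show ?thesis unfolding rep_def by (auto simp: distinct_map)
          qed
          moreover have "set (map Inl ?g) = VS 0" "set [] = FS 0" using good_less by (auto simp: VS_def
              FS_def Good_def)
          ultimately have B5: "built 0 \<sigma>5" using b5 up5 unfolding built_def by blast
          show ?case
          proof (rule run_SeqI[OF run_add_chains[OF B5]], goal_cases)
            case (1 k6 \<sigma>6)
            note k6 = this
            have "nmem \<sigma>6 aHas 0 = 0" using z k1 k2 k4 k5 k6 by (auto simp: keeps_def)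
            then have D6: "detinv \<sigma>6 {}" using k6 unfolding detinv_def built_def cand_def VS_all FS_all
                by auto
            have m6: "nmem \<sigma>6 aMode 0 = 1" using k4 k5 k6 by (simp add: keeps_def)
            show ?case
            proof (rule run_SeqI[OF run_add_detours[OF D6 m6]], goal_cases)
              case (1 k7 \<sigma>7)
              note k7 = this
              have b7: "base \<sigma>7" using k7 by (simp add: detinv_def)
              then have st: "nmem \<sigma>7 0 2 = s" "nmem \<sigma>7 0 3 = t" by (auto simp: base_def inp_def)
              have m7: "nmem \<sigma>7 aMode 0 = 1" using m6 k7 by (simp add: keeps_def)
              have z7: "nmem \<sigma>7 sh = (\<lambda>_. 0)" using z k1 k2 k4 k5 k6 k7 by (auto simp: keeps_def)
              let ?\<sigma>8 = "nwrite sh 3 (nmem \<sigma>7 aIdx t) (nwrite sh 2 (nmem \<sigma>7 aIdx s)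
                (nwrite sh 1 (nmem \<sigma>7 aNE 0) (nwrite sh 0 (nmem \<sigma>7 aNV 0) \<sigma>7)))"
              have "detinv ?\<sigma>8 UNIV \<longleftrightarrow> detinv \<sigma>7 UNIV" by (rule detinv_state_cong) auto
              moreover have "nmem ?\<sigma>8 sh = array_of [nmem \<sigma>7 aNV 0, nmem \<sigma>7 aNE 0, nmem \<sigma>7 aIdx s, nmem
                  \<sigma>7 aIdx t]"
                using z7 by (auto simp: fun_eq_iff array_of_def nth_Cons' less_Suc_eq numeral_eq_Suc
                    One_nat_def)
              moreover have "k1 + (k2 + (1 + (k4 + (k5 + (k6 + (k7 + 4)))))) \<le> tP"
                using k1 k2 k4 k5 k6 k7 unfolding tP_def by linarith
              ultimately show ?case using k7 m7 st by (simp add: add.assoc)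
            qed
          qed
        qed
      qed
      then show ?case by simp
    qed
  qed
qed

end

section \<open>Calling the algorithm for layered graphs\<close>

context connected_instance
begin

text \<open>Inputs have the vertices 0 to n - 1, so the layered graph is copied along the numbering
  \<open>VL\<close> that the program happened to produce.\<close>

definition GL :: "nat lvert list \<Rightarrow> nat pair_pre_digraph" where
  "GL VL = \<lparr>pverts = {..<length VL},
     parcs = {(i, j). i < length VL \<and> j < length VL \<and> (VL ! i, VL ! j) \<in> EA}\<rparr>"

definition wL :: "nat lvert list \<Rightarrow> nat \<times> nat \<Rightarrow> real" where
  "wL VL = (\<lambda>(i, j). WA (VL ! i, VL ! j))"

definition layP :: "nat lvert list \<Rightarrow> bool" where
  "layP P \<longleftrightarrow> walk EA (Inl s) P (Inl t) \<and> distinct P \<and> ds t < cost WA P"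

context
  fixes VL sL tL
  assumes dV: "distinct VL" and sV: "set VL = VA"
    and sL: "sL < length VL" "VL ! sL = Inl s" and tL: "tL < length VL" "VL ! tL = Inl t"
begin

lemma EA_lev: "(a, b) \<in> EA \<Longrightarrow> lev b < lev a \<or>
    lev a < lev b \<and> WA (a, b) = lev b - lev a \<and> (\<forall>x\<in>VA. lev x \<le> lev a \<or> lev b \<le> lev x)"
  using BA_less[of a b] FA_next[of a b] WA_FA[of a b] VA_lev unfolding EA_def nextl_def by blast

lemma VL_ex: "a \<in> VA \<Longrightarrow> \<exists>i<length VL. VL ! i = a"
  using sV by (metis in_set_conv_nth)

lemma VL_inj: "i < length VL \<Longrightarrow> j < length VL \<Longrightarrow> VL ! i = VL ! j \<Longrightarrow> i = j"
  using dV by (simp add: nth_eq_iff_index_eq)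

lemma GL_st_digraph: "st_digraph (GL VL) (wL VL) sL tL"
proof
  show "finite (parcs (GL VL))"
    by (rule finite_subset[of _ "{..<length VL} \<times> {..<length VL}"]) (auto simp: GL_def)
  show "fst e \<noteq> snd e" if "e \<in> parcs (GL VL)" for e
    using that EA_lev by (force simp: GL_def)
qed (use sL tL WA_pos in \<open>auto simp: GL_def wL_def\<close>)

interpretation gl: st_digraph "GL VL" "wL VL" sL tL by (rule GL_st_digraph)

lemma GL_layered: "st_digraph.layered (GL VL) (wL VL) sL tL"
  and GL_dist: "i < length VL \<Longrightarrow> gl.dist_G sL i = ereal (lev (VL ! i))"
  and GL_wdist: "wdist (parcs (GL VL)) (wL VL) sL tL = ds t"
proof -
  have mem: "i < length VL \<Longrightarrow> VL ! i \<in> VA" for i using sV nth_mem by blast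
  have e: "(u, v) \<in> parcs (GL VL) \<Longrightarrow> lev (VL ! v) < lev (VL ! u) \<or> lev (VL ! u) < lev (VL ! v) \<and>
      wL VL (u, v) = lev (VL ! v) - lev (VL ! u) \<and>
      (\<forall>x\<in>pverts (GL VL). lev (VL ! x) \<le> lev (VL ! u) \<or> lev (VL ! v) \<le> lev (VL ! x))" for u v
    using EA_lev[of "VL ! u" "VL ! v"] mem by (auto simp: GL_def wL_def)
  have p: "\<exists>u. (u, x) \<in> parcs (GL VL) \<and> lev (VL ! u) < lev (VL ! x)" if x: "x \<in> pverts (GL VL)" "x \<noteq> sL" for x
  proof -
    have "VL ! x \<in> VA" "VL ! x \<noteq> Inl s" using x sL VL_inj[of x sL] mem by (auto simp: GL_def)
    then obtain b where b: "(b, VL ! x) \<in> FA" using FA_pred by blast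
    then have "b \<in> VA" using EA_VA by (auto simp: EA_def)
    then obtain i where "i < length VL" "VL ! i = b" using VL_ex by blast
    then show ?thesis using b FA_next[OF b] x by (auto simp: GL_def EA_def nextl_def intro!: exI[of _ i])
  qed
  have q: "\<exists>v. (x, v) \<in> parcs (GL VL) \<and> lev (VL ! x) < lev (VL ! v)" if x: "x \<in> pverts (GL VL)" "x \<noteq> tL" for x
  proof -
    have "VL ! x \<in> VA" "VL ! x \<noteq> Inl t" using x tL VL_inj[of x tL] mem by (auto simp: GL_def)
    then obtain b where b: "(VL ! x, b) \<in> FA" using FA_succ by blast
    then have "b \<in> VA" using EA_VA by (auto simp: EA_def)
    then obtain i where "i < length VL" "VL ! i = b" using VL_ex by blast
    then show ?thesis using b FA_next[OF b] x by (auto simp: GL_def EA_def nextl_def intro!: exI[of _ i])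
  qed
  have s0: "lev (VL ! sL) = 0" using sL ds_s by simp
  show "st_digraph.layered (GL VL) (wL VL) sL tL"
    by (rule gl.layered_by_levels(1)[of "\<lambda>i. lev (VL ! i)", OF s0 e p q])
  show "i < length VL \<Longrightarrow> gl.dist_G sL i = ereal (lev (VL ! i))"
    using gl.layered_by_levels(2)[of "\<lambda>i. lev (VL ! i)", OF s0 e p q] by (simp add: GL_def)
  show "wdist (parcs (GL VL)) (wL VL) sL tL = ds t"
    using gl.layered_by_levels(3)[of "\<lambda>i. lev (VL ! i)", OF s0 e p q] tL by simp
qed

lemma GL_nsp: "set p \<subseteq> {..<length VL} \<Longrightarrow> gl.nsp p \<longleftrightarrow> layP (map ((!) VL) p)"
  and GL_cost: "cost (wL VL) p = cost WA (map ((!) VL) p)"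
proof -
  let ?f = "(!) VL" and ?V = "{..<length VL}"
  have inj: "inj_on ?f ?V" using VL_inj by (auto simp: inj_on_def)
  show c: "cost (wL VL) p = cost WA (map ?f p)" unfolding cost_map wL_def ..
  assume p: "set p \<subseteq> ?V"
  have "map_prod ?f ?f ` parcs (GL VL) = EA"
  proof
    show "map_prod ?f ?f ` parcs (GL VL) \<subseteq> EA" by (auto simp: GL_def)
    show "EA \<subseteq> map_prod ?f ?f ` parcs (GL VL)"
    proof
      fix z assume z: "z \<in> EA"
      then have "fst z \<in> VA" "snd z \<in> VA" using EA_VA by auto
      then obtain i j where "i < length VL" "VL ! i = fst z" "j < length VL" "VL ! j = snd z" using
          VL_ex by metis
      then show "z \<in> map_prod ?f ?f ` parcs (GL VL)" using z
        by (intro image_eqI[of _ _ "(i, j)"]) (auto simp: GL_def)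
    qed
  qed
  then have "walk (parcs (GL VL)) sL p tL \<longleftrightarrow> walk EA (Inl s) (map ?f p) (Inl t)"
    using walk_pair_map[OF inj p, of "parcs (GL VL)" sL tL] sL tL by (auto simp: GL_def)
  moreover have "distinct (map ?f p) \<longleftrightarrow> distinct p"
    using inj p by (simp add: distinct_map inj_on_subset)
  ultimately show "gl.nsp p \<longleftrightarrow> layP (map ?f p)" unfolding gl.nsp_def layP_def c GL_wdist by simp
qed

lemma layP_verts:
  assumes "layP P"
  obtains p where "set p \<subseteq> {..<length VL}" "P = map ((!) VL) p"
proof -
  have "Inl s \<in> VA" using good_s by (auto simp: VA_def Good_def)
  then have "set P \<subseteq> VA" using walk_verts[of EA "Inl s" P "Inl t" VA] assms EA_VA by (auto simp: layP_def)
  then have "\<forall>a\<in>set P. \<exists>i<length VL. VL ! i = a" using VL_ex by blast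
  then obtain g where "\<forall>a\<in>set P. g a < length VL \<and> VL ! g a = a" by metis
  then show thesis using that[of "map g P"] by (auto simp: map_idI)
qed

text \<open>Reads the answer back along \<open>VL\<close>. Length 0 means failure, and as a minimum
  exists whenever there is a not-shortest path, failure means that there is none.\<close>

lemma GL_output:
  assumes "correct_output (GL VL) (wL VL) sL tL \<tau>"
  shows "nmem \<tau> 3 0 = 0 \<and> (\<forall>P. \<not> layP P) \<or>
    (\<exists>P. layP P \<and> (\<forall>P'. layP P' \<longrightarrow> cost WA P \<le> cost WA P') \<and> nmem \<tau> 3 0 = length P \<and>
      (\<forall>i<length P. nmem \<tau> 3 (Suc i) < length VL \<and> VL ! nmem \<tau> 3 (Suc i) = P ! i))"
proof (cases "\<exists>p. gl.next_to_shortest p")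
  case False
  have "\<not> layP P" for P
  proof
    assume P: "layP P"
    obtain p where "set p \<subseteq> {..<length VL}" "P = map ((!) VL) p" using layP_verts[OF P] .
    then have "gl.nsp p" using GL_nsp P by blast
    then show False using gl.nsp_imp_next_to_shortest False by blast
  qed
  then show ?thesis using assms False by (simp add: correct_output_def outputs_def)
next
  case True
  then obtain a where a: "gl.next_to_shortest a" "outputs \<tau> (pawalk_verts sL a)"
    using assms unfolding correct_output_def by auto
  let ?p = "pawalk_verts sL a"
  have n: "gl.nsp ?p" using gl.next_to_shortestD(1)[OF a(1)] .
  have sub: "set ?p \<subseteq> {..<length VL}"
    using n walk_verts[of "parcs (GL VL)" sL ?p tL "{..<length VL}"] sL unfolding gl.nsp_def by (auto
        simp: GL_def)
  let ?P = "map ((!) VL) ?p"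
  have min: "cost WA ?P \<le> cost WA P'" if P': "layP P'" for P'
  proof -
    obtain p' where p': "set p' \<subseteq> {..<length VL}" "P' = map ((!) VL) p'" using layP_verts[OF P'] .
    then have "gl.nsp p'" using GL_nsp P' by blast
    then show ?thesis using gl.next_to_shortestD(2)[OF a(1)] p'(2) by (simp add: GL_cost)
  qed
  have "layP ?P" using GL_nsp[OF sub] n by blast
  moreover have "nmem \<tau> 3 0 = length ?P" "\<forall>i<length ?P. nmem \<tau> 3 (Suc i) < length VL \<and> VL ! nmem \<tau> 3
      (Suc i) = ?P ! i"
    using a(2) sub nth_mem by (fastforce simp: outputs_def)+
  ultimately show ?thesis using min by blast
qed

text \<open>Edges in \<open>FA\<close> weigh exactly the difference of levels, so only those in
  \<open>BA\<close> are back-edges, and their ends are good vertices. Subdivision points do not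
  enter the count.\<close>

lemma card_V_B: "card (st_digraph.V_B (GL VL) (wL VL) sL) \<le> card Good"
proof (rule card_inj_on_le)
  have "VL ! x \<in> Inl ` Good" "x < length VL" if "x \<in> gl.V_B" for x
  proof -
    obtain u v where uv: "(u, v) \<in> gl.back_edges" "x = u \<or> x = v" using \<open>x \<in> gl.V_B\<close> unfolding
        gl.V_B_def by auto
    then have *: "u < length VL" "v < length VL" "(VL ! u, VL ! v) \<in> EA"
      "lev (VL ! u) + WA (VL ! u, VL ! v) > lev (VL ! v)"
      unfolding gl.back_edges_def using GL_dist by (auto simp: GL_def wL_def)
    then have "(VL ! u, VL ! v) \<in> BA" using WA_FA by (auto simp: EA_def)
    then show "VL ! x \<in> Inl ` Good" "x < length VL" using uv(2) * by (auto simp: BA_def Good_def)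
  qed
  note V = this
  show "(\<lambda>i. projl (VL ! i)) ` gl.V_B \<subseteq> Good" using V(1) by force
  show "inj_on (\<lambda>i. projl (VL ! i)) gl.V_B"
  proof (rule inj_onI)
    fix x y assume x: "x \<in> gl.V_B" and y: "y \<in> gl.V_B" and eq: "projl (VL ! x) = projl (VL ! y)"
    have "VL ! x = VL ! y" using V(1)[OF x] V(1)[OF y] eq by auto
    then show "x = y" using VL_inj V(2)[OF x] V(2)[OF y] by blast
  qed
qed (rule finGood)

text \<open>Edges in \<open>BA\<close> descend at positive cost and cannot be forward-edges, so the
  count reduces to pairs in \<open>FA\<close> whose tails share a level.\<close>

lemma card_E_FP: "card (st_digraph.E_FP (GL VL) (wL VL) sL) \<le> card Good * (card (set es) * card (set es))"
proof -
  let ?f = "\<lambda>((a, b), (c, d)). ((VL ! a, VL ! b), (VL ! c, VL ! d))"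
  let ?FP = "{(x, y) \<in> FA \<times> FA. lev (fst x) = lev (fst y)}"
  have fw: "a < length VL \<and> b < length VL \<and> (VL ! a, VL ! b) \<in> FA" if "(a, b) \<in> gl.forward_edges" for a b
  proof -
    have *: "a < length VL" "b < length VL" "(VL ! a, VL ! b) \<in> EA"
      "lev (VL ! a) + WA (VL ! a, VL ! b) = lev (VL ! b)"
      using that GL_dist unfolding gl.forward_edges_def by (auto simp: GL_def wL_def)
    then have "(VL ! a, VL ! b) \<notin> BA" using WA_pos[of "(VL ! a, VL ! b)"] BA_less by force
    then show ?thesis using * by (simp add: EA_def)
  qed
  have "card gl.E_FP \<le> card ?FP"
  proof (rule card_inj_on_le)
    show "inj_on ?f gl.E_FP" using VL_inj fw unfolding inj_on_def gl.E_FP_def by (fastforce)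
    show "?f ` gl.E_FP \<subseteq> ?FP" using fw GL_dist unfolding gl.E_FP_def by fastforce
    show "finite ?FP" by (rule finite_subset[of _ "FA \<times> FA"]) (use finFA in auto)
  qed
  then show ?thesis using card_FP by linarith
qed

lemma card_parcs: "card (parcs (GL VL)) \<le> card (set es) * card Good + card Good * card Good"
proof -
  have "card (parcs (GL VL)) \<le> card EA"
  proof (rule card_inj_on_le[of "\<lambda>(a, b). (VL ! a, VL ! b)"])
    show "inj_on (\<lambda>(a, b). (VL ! a, VL ! b)) (parcs (GL VL))" using VL_inj by (auto simp: inj_on_def GL_def)
  qed (use finFA finBA in \<open>auto simp: GL_def EA_def\<close>)
  also have "\<dots> \<le> card FA + card BA" unfolding EA_def by (rule card_Un_le)
  finally show ?thesis using card_FA card_BA by linarith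
qed

end

text \<open>The copy has at most \<open>3 * m * n\<close> edges, and at most
  \<open>2 * m * n\<close> vertices with a logarithm of at most \<open>4 * log 2 n\<close>. This
  gives 3 + 8 = 11, and the other two factors contribute no constant.\<close>

lemma layered_time_bound:
  assumes "distinct VL" "set VL = VA" "sL < length VL" "VL ! sL = Inl s" "tL < length VL" "VL ! tL = Inl t"
  shows "layered_time (GL VL) (wL VL) sL tL \<le>
    11 * (real n ^ 4 * max 1 (real (length es)) ^ 3 * max 1 (log 2 (real n)))"
proof -
  define m where "m = card (set es)"
  have m: "m = length es" unfolding m_def using es_distinct by (simp add: distinct_card)
  have n2: "2 \<le> n" using s_less t_less s_ne_t by linarith
  have m1: "1 \<le> m"
  proof -
    obtain u where "(u, t) \<in> Tight" using tight_in[OF good_t] s_ne_t by auto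
    then have "(u, t) \<in> set es" by (auto simp: Tight_def)
    then show ?thesis unfolding m_def by (metis One_nat_def Suc_leI card_gt_0_iff emptyE finite_set)
  qed
  have mn: "m \<le> n * n" unfolding m_def
    using card_mono[of "{..<n} \<times> {..<n}" "set es"] es_verts by (simp add: card_cartesian_product)
  let ?g = "card Good"
  have g: "?g \<le> n" "?g \<le> 2 * m" using card_Good_n card_Good m1 unfolding m_def by auto
  have V: "card (pverts (GL VL)) \<le> 2 * (m * n)"
  proof -
    have "card (pverts (GL VL)) = card VA" using assms(1,2) by (simp add: GL_def distinct_card[symmetric])
    also have "\<dots> \<le> ?g + m * ?g" using card_VA m_def by simp
    also have "\<dots> \<le> n + m * n" using g by (simp add: add_mono)
    also have "\<dots> \<le> 2 * (m * n)" using m1 by simp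
    finally show ?thesis .
  qed
  have E: "card (parcs (GL VL)) \<le> 3 * (m * n)"
  proof -
    have "card (parcs (GL VL)) \<le> m * ?g + ?g * ?g" using card_parcs[OF assms] m_def by simp
    also have "\<dots> \<le> m * n + (2 * m) * n" using g by (intro add_mono mult_le_mono) auto
    finally show ?thesis by simp
  qed
  have B: "card (st_digraph.V_B (GL VL) (wL VL) sL) \<le> n" using card_V_B[OF assms] g by linarith
  have P: "card (st_digraph.E_FP (GL VL) (wL VL) sL) \<le> n * (m * m)"
    using order_trans[OF card_E_FP[OF assms] mult_le_mono1[OF g(1)]] unfolding m_def .
  let ?N = "real (card (pverts (GL VL)))" and ?L = "log 2 (real n)"
  have L1: "1 \<le> ?L" using n2 by (simp add: le_log_iff)
  have N1: "1 \<le> ?N" using assms(3) by (cases "length VL") (auto simp: GL_def)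
  \<comment> \<open>A power of \<open>n\<close> is needed here so that the logarithm of the number
    of vertices is a multiple of that of \<open>n\<close>.\<close>
  have "2 * (m * n) \<le> n ^ 4"
  proof -
    have "2 * (m * n) \<le> n * ((n * n) * n)" using n2 mn by (intro mult_le_mono) auto
    then show ?thesis by (simp add: power4_eq_xxxx)
  qed
  then have "?N \<le> real n ^ 4" using V by (metis le_trans of_nat_le_iff of_nat_power)
  then have "log 2 ?N \<le> log 2 (real n ^ 4)" using N1 by (intro log_mono) linarith+
  also have "\<dots> = 4 * ?L" using n2 by (simp add: log_nat_power)
  finally have lN: "log 2 ?N \<le> 4 * ?L" .
  have lN0: "0 \<le> log 2 ?N" using N1 by simp
  let ?mn = "real m * real n"
  have mn1: "1 \<le> ?mn" using mult_mono[of 1 "real m" 1 "real n"] m1 n2 by simp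
  have "?N \<le> 2 * ?mn" using of_nat_mono[OF V, where 'a = real] by simp
  then have "?N * log 2 ?N \<le> (2 * ?mn) * (4 * ?L)"
    using lN lN0 mn1 by (intro mult_mono) linarith+
  moreover have "real (card (parcs (GL VL))) \<le> 3 * ?mn"
    using of_nat_mono[OF E, where 'a = real] by simp
  moreover have "3 * ?mn \<le> 3 * ?mn * ?L" using L1 mn1 by (simp add: mult_le_cancel_left1)
  ultimately have "real (card (parcs (GL VL))) + ?N * log 2 ?N \<le> 11 * (?mn * ?L)" by simp
  moreover have "1 \<le> 11 * (?mn * ?L)" using mult_mono[OF mn1 L1] by simp
  ultimately have X3: "max 1 (real (card (parcs (GL VL))) + ?N * log 2 ?N) \<le> 11 * (?mn * ?L)" by simp
  have X1: "max 1 (real (card (st_digraph.V_B (GL VL) (wL VL) sL))) ^ 2 \<le> real n ^ 2"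
    using B n2 by (intro power_mono) auto
  have "1 \<le> n * (m * m)" using m1 n2 by (simp add: One_nat_def Suc_le_eq)
  then have X2: "max 1 (real (card (st_digraph.E_FP (GL VL) (wL VL) sL))) \<le> real n * (real m * real m)"
    using of_nat_mono[OF P, where 'a = real] of_nat_mono[of 1 "n * (m * m)", where 'a = real] by simp
  have "layered_time (GL VL) (wL VL) sL tL \<le> (real n ^ 2 * (real n * (real m * real m))) * (11 * (?mn * ?L))"
    unfolding layered_time_def
    using X1 X2 X3 by (intro mult_mono) auto
  also have "\<dots> = 11 * (real n ^ 4 * real m ^ 3 * ?L)"
    by (simp add: power2_eq_square power3_eq_cube power4_eq_xxxx)
  finally show ?thesis using m m1 L1 by (simp add: max_def)
qed

definition edge_list :: "state \<Rightarrow> nat \<Rightarrow> (nat \<times> nat) list" where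
  "edge_list \<sigma> k = map (\<lambda>i. (nmem \<sigma> aTails i, nmem \<sigma> aHeads i)) [0..<k]"

lemma edge_list_correct:
  assumes r: "rep \<sigma> VL EL" and "set EL = EA"
  shows "set (edge_list \<sigma> (length EL)) = parcs (GL VL)" "distinct (edge_list \<sigma> (length EL))"
proof -
  have e: "nmem \<sigma> aTails i < length VL" "nmem \<sigma> aHeads i < length VL"
    "EL ! i = (VL ! nmem \<sigma> aTails i, VL ! nmem \<sigma> aHeads i)" if "i < length EL" for i
    using r that unfolding rep_def by blast+
  have d: "distinct VL" "distinct EL" using r unfolding rep_def by auto
  show "set (edge_list \<sigma> (length EL)) = parcs (GL VL)"
  proof (intro equalityI subsetI)
    fix x assume "x \<in> set (edge_list \<sigma> (length EL))"
    then obtain i where i: "i < length EL" "x = (nmem \<sigma> aTails i, nmem \<sigma> aHeads i)" by (auto simp: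
        edge_list_def)
    moreover have "EL ! i \<in> EA" using i(1) assms(2) nth_mem by blast
    ultimately show "x \<in> parcs (GL VL)" using e[OF i(1)] by (simp add: GL_def)
  next
    fix x assume "x \<in> parcs (GL VL)"
    then obtain a b where x: "x = (a, b)" "a < length VL" "b < length VL" "(VL ! a, VL ! b) \<in> set EL"
      using assms(2) by (auto simp: GL_def)
    then obtain i where i: "i < length EL" "EL ! i = (VL ! a, VL ! b)" by (metis in_set_conv_nth)
    then have "nmem \<sigma> aTails i = a" "nmem \<sigma> aHeads i = b" using e[OF i(1)] x d(1) by (auto simp:
        nth_eq_iff_index_eq)
    then show "x \<in> set (edge_list \<sigma> (length EL))" using i(1) x(1) by (auto simp: edge_list_def)
  qed
  show "distinct (edge_list \<sigma> (length EL))" unfolding edge_list_def distinct_map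
  proof (intro conjI inj_onI)
    fix i j assume "i \<in> set [0..<length EL]" "j \<in> set [0..<length EL]"
      "(nmem \<sigma> aTails i, nmem \<sigma> aHeads i) = (nmem \<sigma> aTails j, nmem \<sigma> aHeads j)"
    then have "EL ! i = EL ! j" "i < length EL" "j < length EL" using e[of i] e[of j] by auto
    then show "i = j" using d(2) by (simp add: nth_eq_iff_index_eq)
  qed simp
qed

text \<open>Execution is specified from the complete input state, so all cells matter:
  \<open>rep\<close> settles the ends of the lists, and the higher arrays must be untouched.\<close>

lemma view_input:
  assumes r: "rep \<sigma> VL EL"
    and sh0: "nmem \<sigma> sh = array_of [nmem \<sigma> aNV 0, nmem \<sigma> aNE 0, nmem \<sigma> aIdx s, nmem \<sigma> aIdx t]"
    and z: "\<And>a. 42 < a \<Longrightarrow> nmem \<sigma> a = (\<lambda>_. 0)" "\<And>a. 40 < a \<Longrightarrow> rmem \<sigma> a = (\<lambda>_. 0)"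
  shows "view sh \<sigma> = input_state (length VL) (edge_list \<sigma> (length EL)) (wL VL) (nmem \<sigma> aIdx s) (nmem \<sigma>
      aIdx t)"
proof -
  let ?es = "edge_list \<sigma> (length EL)"
  have e: "rmem \<sigma> rWeights i = wL VL (nmem \<sigma> aTails i, nmem \<sigma> aHeads i)" if "i < length EL" for i
    using r that unfolding rep_def wL_def by auto
  have NM: "nmem \<sigma> aNV 0 = length VL" "nmem \<sigma> aNE 0 = length EL"
    and tz: "\<And>i. length EL \<le> i \<Longrightarrow> nmem \<sigma> aTails i = 0 \<and> nmem \<sigma> aHeads i = 0 \<and> rmem \<sigma> rWeights i = 0"
    using r unfolding rep_def by auto
  have l: "length ?es = length EL" by (simp add: edge_list_def)
  have 1: "nmem \<sigma> aTails = array_of (map fst ?es)" "nmem \<sigma> aHeads = array_of (map snd ?es)"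
    "rmem \<sigma> rWeights = array_of (map (wL VL) ?es)"
    using tz e by (auto simp: array_of_def fun_eq_iff edge_list_def not_less)
  have 2: "nmem \<sigma> (a + 40) = (if a = 0 then array_of [length VL, length ?es, nmem \<sigma> aIdx s, nmem \<sigma> aIdx t]
      else if a = 1 then array_of (map fst ?es) else if a = 2 then array_of (map snd ?es) else (\<lambda>_. 0))" for a
    using sh0 NM l 1(1,2) z(1)[of "a + 40"] by (cases "a = 0"; cases "a = 1"; cases "a = 2") (auto simp:
        add.commute)
  have 3: "rmem \<sigma> (a + 40) = (if a = 0 then array_of (map (wL VL) ?es) else (\<lambda>_. 0))" for a
    using 1(3) z(2)[of "a + 40"] by (cases "a = 0") auto
  show ?thesis unfolding view_def input_state_def 2 3 by (auto simp: fun_eq_iff)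
qed

end

section \<open>Translating the answer\<close>

abbreviation (input) "aAns \<equiv> 43 :: nat"

definition start_path :: com where
  "start_path = Seq (put aCur xS) (Seq (put aCount (NConst 1)) (NWrite 3 (NConst 1) xS))"

text \<open>The direction suffices to see how two consecutive original vertices are linked: a rise
  comes from a tight edge, a descent from a back-edge whose detour is recomputed. The test against
  \<open>aCur\<close> skips the first vertex, which is already written.\<close>

definition hop :: com where
  "hop = Seq (put aB (NRead aLab (NRead aAns (NAdd (sc aP) (NConst 1)))))
    (If (And (nz (sc aB)) (neq (NSub (sc aB) (NConst 1)) (sc aCur)))
      (Seq (put aTarget (NSub (sc aB) (NConst 1)))
        (If (RLess (RRead rDS (sc aCur)) (RRead rDS (sc aTarget)))
          (Seq (RWrite rCost (NConst 0) (RAdd (RRead rCost (NConst 0)) (RSub (RRead rDS (sc aTarget))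
              (RRead rDS (sc aCur)))))
            (Seq (put aCur (sc aTarget)) (Seq (put aCount (NAdd (sc aCount) (NConst 1))) (NWrite 3 (sc
                aCount) (sc aCur)))))
          (Seq dist_to (Seq (RWrite rCost (NConst 0) (RAdd (RRead rCost (NConst 0)) (RRead rDist (sc
              aCur)))) chase))))
      Skip)"

definition translate :: com where
  "translate = Seq start_path (Seq (RWrite rCost (NConst 0) RZero)
     (Seq (For aP (NRead aAns (NConst 0)) hop) (NWrite 3 (NConst 0) (sc aCount))))"

definition emit :: "nexp \<Rightarrow> nexp \<Rightarrow> com" where
  "emit md v = Seq (put aMode md) (Seq (put aTarget v) (Seq dist_to chase))"

definition write_up :: com where
  "write_up = Seq start_path (Seq (emit (NConst 0) (sc aBestU)) (Seq (emit (NConst 1) (sc aBestV))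
     (Seq (emit (NConst 0) xT) (NWrite 3 (NConst 0) (sc aCount)))))"

definition choose_path :: com where
  "choose_path = If (And (nz (sc aHas)) (Or (Not (nz (sc aAns))) (RLess (RRead rBest (NConst 0)) (RRead
      rCost (NConst 0)))))
     write_up Skip"

lemma mods_start_path [simp]: "nmods start_path = {aCur, aCount, 3}" "rmods start_path = {}"
  by (auto simp: start_path_def)
lemma mods_hop [simp]: "nmods hop = {aB, aTarget, aCur, aCount, 3, aI, aReach, aK, aJ, aNext}" "rmods
    hop = {rCost, rDist}"
  by (auto simp: hop_def)
lemma mods_translate [simp]: "nmods translate = {aP, aB, aTarget, aCur, aCount, 3, aI, aReach, aK, aJ,
    aNext}" "rmods translate = {rCost, rDist}"
  by (auto simp: translate_def)
lemma mods_emit [simp]: "nmods (emit md v) = {aMode, aTarget, aCur, aCount, 3, aI, aReach, aK, aJ,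
    aNext}" "rmods (emit md v) = {rDist}"
  by (auto simp: emit_def)

section \<open>Optimality of the two candidates and expansion of layered paths\<close>

context connected_instance
begin

definition nspE :: "nat list \<Rightarrow> bool" where
  "nspE p \<longleftrightarrow> walk (set es) s p t \<and> distinct p \<and> ds t < cost w p"

text \<open>The lower bound: no not-shortest path is cheaper than the better candidate. It remains
  to show that this candidate is realised by a simple path.\<close>

lemma nspE_cases:
  assumes "nspE q"
  shows "(\<exists>u v. updet u v \<and> upval u v \<le> cost w q) \<or> (\<exists>P. layP P \<and> cost WA P \<le> cost w q)"
proof -
  have q: "walk (set es) s q t" "distinct q" "ds t < cost w q" using assms by (auto simp: nspE_def)
  from path_dichotomy[OF q(1) good_s q(2)] show ?thesis
  proof (elim disjE exE conjE, goal_cases)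
    case (1 u v a m b)
    have "updet u v" using 1 by (auto simp: updet_def)
    moreover have "upval u v \<le> cost w q" unfolding upval_def
      using ds_le[of a u] detour_le[of v u m] dt_le[of v b] 1 by linarith
    ultimately show ?case by blast
  next
    case (2 P)
    then show ?case using q(3) ds_s by (auto simp: layP_def)
  qed
qed

lemma up_optimal:
  assumes up: "updet u v" and min: "\<And>a b. updet a b \<Longrightarrow> upval u v \<le> upval a b"
    and lay: "\<And>P. layP P \<Longrightarrow> upval u v \<le> cost WA P"
    and a: "walk (set es) s a u" "distinct a" "cost w a = ds u"
    and m: "walk (Det v) u m v" "distinct m" "cost w m = detour u v"
    and b: "walk (set es) v b t" "distinct b" "cost w b = dt v"
  shows "nspE (a @ tl m @ tl b)" "nspE q \<Longrightarrow> cost w (a @ tl m @ tl b) \<le> cost w q"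
proof -
  have g: "good u" "good v" "u \<noteq> v" "ds u \<le> ds v" using up by (auto simp: updet_def)
  note p = up_detour_path[OF g a m(1,2) b]
  show "nspE (a @ tl m @ tl b)" using p by (simp add: nspE_def)
  show "nspE q \<Longrightarrow> cost w (a @ tl m @ tl b) \<le> cost w q"
    using nspE_cases[of q] min lay p(3) m(3) unfolding upval_def by fastforce
qed

text \<open>Under the hypothesis on direct candidates \<open>x\<close> costs no more than any
  not-shortest path. A repeated vertex would allow a strictly cheaper one, so \<open>x\<close> is
  already simple and the program never has to cut.\<close>

lemma lay_optimal:
  assumes P: "layP P" "\<And>P'. layP P' \<Longrightarrow> cost WA P \<le> cost WA P'"
    and up: "\<And>a b. updet a b \<Longrightarrow> cost WA P \<le> upval a b"
    and x: "walk (set es) s x t" "cost w x = cost WA P" "distinct (filter good x)"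
  shows "nspE x" "nspE q \<Longrightarrow> cost w x \<le> cost w q"
proof -
  have low: "cost w x \<le> cost w q" if "nspE q" for q
    using nspE_cases[OF that] P(2) up x(2) by fastforce
  then show "nspE q \<Longrightarrow> cost w x \<le> cost w q" .
  have lt: "ds t < cost w x" using P(1) x(2) by (simp add: layP_def)
  show "nspE x"
  proof (cases "distinct x")
    case False
    then obtain q where "nspE q" "cost w q < cost w x" using shortcut_at_bad[OF x(1,3) lt] by (auto
        simp: nspE_def)
    then show ?thesis using low[of q] by simp
  qed (use x lt in \<open>simp add: nspE_def\<close>)
qed

definition orig :: "nat lvert list \<Rightarrow> nat list" where
  "orig Q = map projl (filter isl Q)"

text \<open>\<open>max 1 i\<close> merges the first two positions, because \<open>s\<close> is
  written before the loop. Inside a chain the output lags behind: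
  \<open>lev (P ! (j - 1)) - ds c\<close> is the part of the current tight edge not yet paid for.
  The filter clause later yields the distinctness of the good vertices.\<close>

definition tr_inv :: "nat lvert list \<Rightarrow> nat \<Rightarrow> state \<Rightarrow> bool" where
  "tr_inv P i \<sigma> \<longleftrightarrow> base \<sigma> \<and> nmem \<sigma> aMode 0 = 1 \<and> (let j = max 1 i; c = nmem \<sigma> aCur 0; z = rmem \<sigma> rCost 0 in
    good c \<and> own (P ! (j - 1)) = c \<and> cost WA (take j P) = z + lev (P ! (j - 1)) - ds c \<and>
    (\<exists>xs. outl \<sigma> xs \<and> walk (set es) s xs c \<and> cost w xs = z \<and> filter good xs = orig (take j P)))"

lemma tr_inv_cong:
  assumes "nmem \<sigma>' 0 = nmem \<sigma> 0" "nmem \<sigma>' 1 = nmem \<sigma> 1" "nmem \<sigma>' 2 = nmem \<sigma> 2" "rmem \<sigma>' 0 = rmem \<sigma> 0"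
    "nmem \<sigma>' aGood = nmem \<sigma> aGood" "nmem \<sigma>' aTight = nmem \<sigma> aTight"
    "rmem \<sigma>' rDS = rmem \<sigma> rDS" "rmem \<sigma>' rDT = rmem \<sigma> rDT" "nmem \<sigma>' aCount = nmem \<sigma> aCount" "nmem \<sigma>' 3 =
        nmem \<sigma> 3"
    "nmem \<sigma>' aMode = nmem \<sigma> aMode" "nmem \<sigma>' aCur = nmem \<sigma> aCur" "rmem \<sigma>' rCost = rmem \<sigma> rCost"
  shows "tr_inv P i \<sigma>' \<longleftrightarrow> tr_inv P i \<sigma>"
  unfolding tr_inv_def base_cong[OF assms(1-8)] outl_cong[OF assms(9,10)] using assms(11-) by simp

definition tH :: nat where "tH = tD + (n * 4 + 1) + 7"

lemma run_hop:
  assumes P: "layP P" and i: "i < length P" "nmem \<sigma> aP 0 = i" and I: "tr_inv P i \<sigma>"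
    and lab: "nmem \<sigma> aLab (nmem \<sigma> aAns (Suc i)) = (case P ! i of Inl x \<Rightarrow> Suc x | Inr _ \<Rightarrow> 0)"
  shows "run hop \<sigma> (\<lambda>k \<sigma>'. k \<le> tH \<and> tr_inv P (Suc i) \<sigma>')"
proof -
  define c z where "c = nmem \<sigma> aCur 0" and "z = rmem \<sigma> rCost 0"
  define l where "l = (case P ! i of Inl x \<Rightarrow> Suc x | Inr _ \<Rightarrow> 0)"
  let ?\<sigma> = "nwrite aB 0 l \<sigma>"
  have cgB: "tr_inv P j (nwrite aB 0 x \<sigma>) \<longleftrightarrow> tr_inv P j \<sigma>" for j x by (rule tr_inv_cong) auto
  have start: "run hop \<sigma> Q \<longleftrightarrow> run (If (And (nz (sc aB)) (neq (NSub (sc aB) (NConst 1)) (sc aCur)))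
      (Seq (put aTarget (NSub (sc aB) (NConst 1)))
        (If (RLess (RRead rDS (sc aCur)) (RRead rDS (sc aTarget)))
          (Seq (RWrite rCost (NConst 0) (RAdd (RRead rCost (NConst 0)) (RSub (RRead rDS (sc aTarget))
              (RRead rDS (sc aCur)))))
            (Seq (put aCur (sc aTarget)) (Seq (put aCount (NAdd (sc aCount) (NConst 1))) (NWrite 3 (sc
                aCount) (sc aCur)))))
          (Seq dist_to (Seq (RWrite rCost (NConst 0) (RAdd (RRead rCost (NConst 0)) (RRead rDist (sc
              aCur)))) chase))))
      Skip) ?\<sigma> (\<lambda>k. Q (1 + k))" for Q
    unfolding hop_def run_Seq run_NWrite using lab i(2) by (simp add: l_def)
  have W: "walk EA (Inl s) P (Inl t)" using P by (simp add: layP_def)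
  have tH1: "3 \<le> tH" "8 \<le> tH" by (auto simp: tH_def One_nat_def)
  show ?thesis
  proof (cases "i = 0")
    case True
    have "P ! 0 = Inl s" using walk_hd[OF W] by auto
    then have l: "l = Suc s" "c = s" using I True by (auto simp: l_def c_def tr_inv_def Let_def)
    have "tr_inv P (Suc i) \<sigma>" using I True by (simp add: tr_inv_def One_nat_def)
    then show ?thesis unfolding start using l tH1 by (simp add: cgB c_def[symmetric])
  next
    case False
    then have mx: "max 1 i = i" "max 1 (Suc i) = Suc i" by auto
    obtain xs where I': "base \<sigma>" "nmem \<sigma> aMode 0 = 1" "good c" "own (P ! (i - 1)) = c"
      "cost WA (take i P) = z + lev (P ! (i - 1)) - ds c"
      and xs: "outl \<sigma> xs" "walk (set es) s xs c" "cost w xs = z" "filter good xs = orig (take i P)"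
      using I unfolding tr_inv_def Let_def mx c_def[symmetric] z_def[symmetric] by blast
    let ?a = "P ! (i - 1)" and ?b = "P ! i"
    have tk: "take (Suc i) P = take i P @ [?b]" using i(1) by (simp add: take_Suc_conv_app_nth)
    have tk1: "take i P = take (i - 1) P @ [?a]" using i(1) False by (metis Suc_diff_1 Suc_lessD
        neq0_conv take_Suc_conv_app_nth)
    have "P = (take (i - 1) P @ [?a]) @ ?b # drop (Suc i) P" using tk1 i(1) by (metis id_take_nth_drop)
    then have "walk EA (Inl s) (take (i - 1) P @ ?a # ?b # drop (Suc i) P) (Inl t)" using W by simp
    then have E: "(?a, ?b) \<in> EA" using walk_splitD(2) by fastforce
    have ct: "cost WA (take (Suc i) P) = z + lev ?a - ds c + WA (?a, ?b)"
      unfolding tk tk1 using cost_append[of WA "take (i - 1) P" ?a "[?b]"] I'(5) tk1 by simp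
    \<comment> \<open>The next vertex is a further point of the chain leaving \<open>c\<close>, the
      head of a tight edge from \<open>c\<close>, or the end of a back-edge. Only the last two
      produce output.\<close>
    note st = EA_step[OF E, unfolded I'(4)]
    show ?thesis
    proof (cases ?b)
      case (Inr y)
      have "own ?b = c" "WA (?a, ?b) = lev ?b - lev ?a" using st Inr by auto
      then have "tr_inv P (Suc i) \<sigma>" unfolding tr_inv_def Let_def mx c_def[symmetric] z_def[symmetric]
        using I'(1-3) xs ct Inr tk by (auto simp: orig_def)
      moreover have "l = 0" using Inr by (simp add: l_def)
      ultimately show ?thesis unfolding start using tH1 by (simp add: cgB)
    next
      case (Inl y)
      have l: "l = Suc y" using Inl by (simp add: l_def)
      have og: "orig (take (Suc i) P) = orig (take i P) @ [y]" unfolding tk orig_def using Inl by simp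
      have ds: "rmem \<sigma> rDS c = ds c" "good x \<Longrightarrow> rmem \<sigma> rDS x = ds x" for x using I'(1,3) by (auto simp:
          base_def)
      have "(c, y) \<in> Tight \<and> WA (?a, ?b) = ds y - lev ?a \<or> ?a = Inl c \<and> ds y < ds c \<and> good c \<and> good y \<and>
        (\<exists>p. walk (Det y) c p y) \<and> WA (?a, ?b) = detour c y" using st Inl by simp
      then show ?thesis
      proof (elim disjE conjE)
        assume T: "(c, y) \<in> Tight" and Wy: "WA (?a, ?b) = ds y - lev ?a"
        note Ty = TightD[OF T]
        have lt: "ds c < ds y" using tight_less[OF T] .
        let ?\<sigma>' = "nwrite 3 (Suc (length xs)) y (nwrite aCount 0 (Suc (length xs)) (nwrite aCur 0 y
          (rwrite rCost 0 (z + (ds y - ds c)) (nwrite aTarget 0 y ?\<sigma>))))"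
        have "outl ?\<sigma>' (xs @ [y])" by (rule outl_snoc[OF xs(1)]) auto
        moreover have "walk (set es) s (xs @ [y]) y" "cost w (xs @ [y]) = z + (ds y - ds c)"
          using walk_snoc[OF xs(2), of y w] Ty xs(3) by auto
        moreover have "base ?\<sigma>'" using I'(1) base_cong[of ?\<sigma>' \<sigma>] by simp
        ultimately have "tr_inv P (Suc i) ?\<sigma>'" unfolding tr_inv_def Let_def mx
          using I'(2) Ty ct Wy xs(4) og Inl by auto
        moreover have "nmem \<sigma> aCount 0 = length xs" using xs(1) by (simp add: outl_def)
        moreover have "y \<noteq> c" using lt by auto
        ultimately show ?thesis unfolding start using l tH1 ds Ty lt
          by (simp add: c_def[symmetric] z_def[symmetric])
      next
        assume B: "?a = Inl c" "ds y < ds c" "good c" "good y" "WA (?a, ?b) = detour c y"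
          and det: "\<exists>p. walk (Det y) c p y"
        let ?\<tau> = "nwrite aTarget 0 y ?\<sigma>"
        have b1: "base ?\<tau>" using I'(1) base_cong[of ?\<tau> \<sigma>] by simp
        have u1: "usable ?\<tau> = Det y" using usable_base(2)[OF b1] I'(2) by simp
        have dist: "run dist_to ?\<tau> (\<lambda>l \<tau>'. l \<le> tD \<and>
          dist_spec (Det y) y (nmem \<tau>' aReach) (rmem \<tau>' rDist) (nmem \<tau>' aNext) \<and> keeps dist_to ?\<tau> \<tau>')"
          using run_dist_to[OF base_inp[OF b1]] u1 good_less[OF B(4)] by simp
        have "run (Seq dist_to (Seq (RWrite rCost (NConst 0) (RAdd (RRead rCost (NConst 0)) (RRead rDist
            (sc aCur)))) chase)) ?\<tau>
          (\<lambda>k \<sigma>'. 4 + k \<le> tH \<and> tr_inv P (Suc i) \<sigma>')"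
        proof (rule run_SeqI[OF dist], goal_cases)
          case (1 k \<tau>1)
          have k1: "nmem \<tau>1 aCur 0 = c" "rmem \<tau>1 rCost 0 = z" "nmem \<tau>1 aTarget 0 = y"
            using 1 by (auto simp: keeps_def c_def z_def)
          have D1: "nmem \<tau>1 aReach c \<noteq> 0" "rmem \<tau>1 rDist c = detour c y"
            using 1 det good_less[OF B(3)] unfolding dist_spec_def detour_def by blast+
          let ?\<tau>2 = "rwrite rCost 0 (z + detour c y) \<tau>1"
          have o2: "outl ?\<tau>2 xs" using xs(1) 1 outl_cong[of ?\<tau>2 \<sigma>] by (simp add: keeps_def)
          have "run chase ?\<tau>2 (\<lambda>k \<sigma>'. k \<le> n * 4 + 1 \<and> nmem \<sigma>' aCur 0 = y \<and>
            (\<exists>p. walk (Det y) c p y \<and> distinct p \<and> cost w p = rmem ?\<tau>2 rDist c \<and> outl \<sigma>' (xs @ tl p)) \<and>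
                keeps chase ?\<tau>2 \<sigma>')"
            by (rule run_chase[OF Det_sub]) (use k1 D1 1 o2 good_less[OF B(3)] in auto)
          then have "run chase ?\<tau>2 (\<lambda>l \<sigma>'. 4 + (k + (1 + l)) \<le> tH \<and> tr_inv P (Suc i) \<sigma>')"
          proof (rule run_mono, goal_cases)
            case c2: (1 l \<sigma>')
            then obtain p where p: "walk (Det y) c p y" "distinct p" "cost w p = detour c y" "outl \<sigma>'
                (xs @ tl p)"
              using D1 by auto
            have cy: "c \<noteq> y" using B(2) by auto
            have "filter good p = [c, y]" using Det_walk_verts(1)[OF p(1,2) cy B(3,4)] .
            moreover obtain p' where "p = c # p'" using walk_hd[OF p(1)] by auto
            ultimately have f: "filter good (tl p) = [y]" using B(3) by simp
            have pE: "walk (set es) c p y" using walk_mono[OF p(1) Det_sub] .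
            have "walk (set es) s (xs @ tl p) y" "cost w (xs @ tl p) = z + detour c y"
              using walk_trans[OF xs(2) pE] xs(3) p(3) by auto
            moreover have "base \<sigma>'" "nmem \<sigma>' aMode 0 = 1" "rmem \<sigma>' rCost 0 = z + detour c y"
              using c2 1 b1 I'(2) base_cong[of \<sigma>' ?\<tau>] by (auto simp: keeps_def)
            ultimately have "tr_inv P (Suc i) \<sigma>'" unfolding tr_inv_def Let_def mx
              using c2 B ct p(4) xs(4) og f Inl by auto
            moreover have "4 + (k + (1 + l)) \<le> tH" using c2 1 unfolding tH_def by simp
            ultimately show ?case by blast
          qed
          then show ?case using k1 D1 by simp
        qed
        then show ?thesis unfolding start run_If using l B(2,3,4) ds
          by (auto simp: c_def[symmetric] elim!: run_mono)
      qed
    qed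
  qed
qed

lemma run_translate:
  assumes P: "layP P" and b: "base \<sigma>" "nmem \<sigma> aMode 0 = 1" and len: "nmem \<sigma> aAns 0 = length P"
    and lab: "\<And>i. i < length P \<Longrightarrow> nmem \<sigma> aLab (nmem \<sigma> aAns (Suc i)) = (case P ! i of Inl x \<Rightarrow> Suc x | Inr
        _ \<Rightarrow> 0)"
  shows "run translate \<sigma> (\<lambda>k \<sigma>'. k \<le> length P * (tH + 2) + 7 \<and>
    (\<exists>xs. outputs \<sigma>' xs \<and> walk (set es) s xs t \<and> cost w xs = cost WA P \<and> distinct (filter good xs)) \<and>
    rmem \<sigma>' rCost 0 = cost WA P \<and> keeps translate \<sigma> \<sigma>')"
proof -
  have W: "walk EA (Inl s) P (Inl t)" and dP: "distinct P" using P by (auto simp: layP_def)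
  obtain P' where P': "P = Inl s # P'" using walk_hd[OF W] by auto
  have st: "nmem \<sigma> 0 2 = s" using b(1) by (simp add: base_def inp_def)
  let ?\<tau> = "rwrite rCost 0 0 (nwrite 3 1 s (nwrite aCount 0 1 (nwrite aCur 0 s \<sigma>)))"
  have b1: "base ?\<tau>" using b(1) base_cong[of ?\<tau> \<sigma>] by simp
  have "outl ?\<tau> [s]" by (simp add: outl_def One_nat_def)
  then have I0: "tr_inv P 0 ?\<tau>" unfolding tr_inv_def Let_def
    using b1 b(2) good_s P' by (auto simp: orig_def One_nat_def intro!: exI[of _ "[s]"])
  have loop: "run (For aP (NRead aAns (NConst 0)) hop) ?\<tau> (\<lambda>k \<sigma>'. k \<le> length P * (tH + 2) + 2 \<and> tr_inv P
      (length P) \<sigma>' \<and>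
    keeps (For aP (NRead aAns (NConst 0)) hop) ?\<tau> \<sigma>')"
  proof (rule run_For[where I = "tr_inv P"], goal_cases)
    case (1 \<sigma>') then show ?case using len by (simp add: keeps_def)
  next
    case 2 then show ?case by simp
  next
    case 3
    have "tr_inv P 0 (nwrite aP 0 0 ?\<tau>) \<longleftrightarrow> tr_inv P 0 ?\<tau>" by (rule tr_inv_cong) auto
    then show ?case using I0 by simp
  next
    case (4 j \<tau>2)
    have "run hop \<tau>2 (\<lambda>k \<sigma>'. k \<le> tH \<and> tr_inv P (Suc j) \<sigma>')"
      by (rule run_hop[OF P 4(1,3,2)]) (use 4(4) lab[OF 4(1)] in \<open>auto simp: keeps_def\<close>)
    then show ?case
    proof (rule run_mono, goal_cases)
      case (1 k \<sigma>')
      have "tr_inv P (Suc j) (nwrite aP 0 (Suc j) \<sigma>') \<longleftrightarrow> tr_inv P (Suc j) \<sigma>'" by (rule tr_inv_cong) auto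
      then show ?case using 1 by simp
    qed
  qed
  have "run (Seq (For aP (NRead aAns (NConst 0)) hop) (NWrite 3 (NConst 0) (sc aCount))) ?\<tau> (\<lambda>k \<sigma>'. 4 +
      k \<le> length P * (tH + 2) + 7 \<and>
    (\<exists>xs. outputs \<sigma>' xs \<and> walk (set es) s xs t \<and> cost w xs = cost WA P \<and> distinct (filter good xs)) \<and>
    rmem \<sigma>' rCost 0 = cost WA P)"
  proof (rule run_SeqI[OF loop], goal_cases)
    case (1 k \<sigma>')
    have "P ! (length P - 1) = Inl t" using W last_conv_nth[of P] by (simp add: walk_def)
    moreover have "max 1 (length P) = length P" using P' by simp
    ultimately have c: "nmem \<sigma>' aCur 0 = t" and z: "cost WA P = rmem \<sigma>' rCost 0" and
      "\<exists>xs. outl \<sigma>' xs \<and> walk (set es) s xs t \<and> cost w xs = rmem \<sigma>' rCost 0 \<and> filter good xs = orig P"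
      using 1 unfolding tr_inv_def Let_def by auto
    then obtain xs where xs: "outl \<sigma>' xs" "walk (set es) s xs t" "cost w xs = cost WA P" "filter good xs
        = orig P" by auto
    have "distinct (orig P)" unfolding orig_def distinct_map using dP
      by (auto simp: inj_on_def dest!: isl_def[THEN iffD1])
    moreover have "outputs (nwrite 3 0 (nmem \<sigma>' aCount 0) \<sigma>') xs" using xs(1) by (auto simp: outputs_def
        outl_def)
    ultimately show ?case using 1 xs z by (auto intro!: exI[of _ xs])
  qed
  then have "run translate \<sigma> (\<lambda>k \<sigma>'. k \<le> length P * (tH + 2) + 7 \<and>
    (\<exists>xs. outputs \<sigma>' xs \<and> walk (set es) s xs t \<and> cost w xs = cost WA P \<and> distinct (filter good xs)) \<and>
    rmem \<sigma>' rCost 0 = cost WA P)"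
    unfolding translate_def start_path_def by (simp add: st)
  from run_keeps[OF this] show ?thesis by (rule run_mono) blast
qed

lemma run_emit:
  assumes b: "base \<sigma>" and md: "nval md \<sigma> = d" "d \<le> 1" and v: "\<And>x \<tau>. nval v (nwrite aMode 0 x \<tau>) = nval v
      \<tau>" "nval v \<sigma> < n"
    and F: "F = (if d = 0 then set es else Det (nval v \<sigma>))"
    and xc: "xc = nmem \<sigma> aCur 0" "xc < n" "walk F xc q (nval v \<sigma>)" and o: "outl \<sigma> xs"
  shows "run (emit md v) \<sigma> (\<lambda>k \<sigma>'. k \<le> tD + (n * 4 + 1) + 2 \<and> nmem \<sigma>' aCur 0 = nval v \<sigma> \<and>
    (\<exists>p. walk F xc p (nval v \<sigma>) \<and> distinct p \<and> cost w p = wdist F w xc (nval v \<sigma>) \<and> outl \<sigma>' (xs @ tl p)) \<and>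
    keeps (emit md v) \<sigma> \<sigma>')"
proof -
  let ?v = "nval v \<sigma>"
  let ?\<tau> = "nwrite aTarget 0 ?v (nwrite aMode 0 d \<sigma>)"
  have b1: "base ?\<tau>" using b base_cong[of ?\<tau> \<sigma>] by simp
  have u1: "usable ?\<tau> = F" using usable_base[OF b1] md(2) F by (cases "d = 0") auto
  have Fs: "F \<subseteq> set es" using F Det_sub by auto
  have dist: "run dist_to ?\<tau> (\<lambda>l \<tau>'. l \<le> tD \<and>
    dist_spec F ?v (nmem \<tau>' aReach) (rmem \<tau>' rDist) (nmem \<tau>' aNext) \<and> keeps dist_to ?\<tau> \<tau>')"
    using run_dist_to[OF base_inp[OF b1]] u1 v(2) by simp
  have "run (Seq dist_to chase) ?\<tau> (\<lambda>k \<sigma>'. 2 + k \<le> tD + (n * 4 + 1) + 2 \<and> nmem \<sigma>' aCur 0 = ?v \<and>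
    (\<exists>p. walk F xc p ?v \<and> distinct p \<and> cost w p = wdist F w xc ?v \<and> outl \<sigma>' (xs @ tl p)))"
  proof (rule run_SeqI[OF dist], goal_cases)
    case (1 k \<tau>1)
    have D1: "nmem \<tau>1 aReach xc \<noteq> 0" "rmem \<tau>1 rDist xc = wdist F w xc ?v"
      using 1 xc(2,3) unfolding dist_spec_def by blast+
    have o1: "outl \<tau>1 xs" using o 1 outl_cong[of \<tau>1 \<sigma>] by (simp add: keeps_def)
    have "run chase \<tau>1 (\<lambda>k \<sigma>'. k \<le> n * 4 + 1 \<and> nmem \<sigma>' aCur 0 = ?v \<and>
      (\<exists>p. walk F xc p ?v \<and> distinct p \<and> cost w p = rmem \<tau>1 rDist xc \<and> outl \<sigma>' (xs @ tl p)) \<and> keeps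
          chase \<tau>1 \<sigma>')"
      by (rule run_chase[OF Fs]) (use 1 D1 o1 xc(1,2) in \<open>auto simp: keeps_def\<close>)
    then show ?case by (rule run_mono) (use 1 D1 in auto)
  qed
  then have "run (emit md v) \<sigma> (\<lambda>k \<sigma>'. k \<le> tD + (n * 4 + 1) + 2 \<and> nmem \<sigma>' aCur 0 = ?v \<and>
    (\<exists>p. walk F xc p ?v \<and> distinct p \<and> cost w p = wdist F w xc ?v \<and> outl \<sigma>' (xs @ tl p)))"
    unfolding emit_def using md v(1) by (auto elim!: run_mono)
  from run_keeps[OF this] show ?thesis by (rule run_mono) blast
qed

lemma run_write_up:
  assumes b: "base \<sigma>" and up: "updet (nmem \<sigma> aBestU 0) (nmem \<sigma> aBestV 0)"
  shows "run write_up \<sigma> (\<lambda>k \<sigma>'. k \<le> 3 * (tD + (n * 4 + 1) + 2) + 4 \<and> (\<exists>a m b.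
    (let u = nmem \<sigma> aBestU 0; v = nmem \<sigma> aBestV 0 in
      walk (set es) s a u \<and> distinct a \<and> cost w a = ds u \<and> walk (Det v) u m v \<and> distinct m \<and> cost w m =
          detour u v \<and>
      walk (set es) v b t \<and> distinct b \<and> cost w b = dt v) \<and> outputs \<sigma>' (a @ tl m @ tl b)))"
proof -
  have sum3: "3 + (k1 + (k2 + (k3 + 1))) \<le> 3 * T + 4" if "k1 \<le> T" "k2 \<le> T" "k3 \<le> T" for k1 k2 k3 T :: nat
    using that by linarith
  define u v where "u = nmem \<sigma> aBestU 0" and "v = nmem \<sigma> aBestV 0"
  have U: "good u" "good v" "\<exists>p. walk (Det v) u p v" using up by (auto simp: updet_def u_def v_def)
  have un: "u < n" "v < n" using good_less U by auto
  obtain q1 q2 q3 where q: "walk (set es) s q1 u" "walk (Det v) u q2 v" "walk (set es) v q3 t"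
    using U unfolding good_def by blast
  have st: "nmem \<sigma> 0 2 = s" using b by (simp add: base_def inp_def)
  let ?T = "tD + (n * 4 + 1) + 2"
  let ?\<tau> = "nwrite 3 1 s (nwrite aCount 0 1 (nwrite aCur 0 s \<sigma>))"
  have b1: "base ?\<tau>" using b base_cong[of ?\<tau> \<sigma>] by simp
  have o1: "outl ?\<tau> [s]" by (simp add: outl_def One_nat_def)
  have "run (Seq (emit (NConst 0) (sc aBestU)) (Seq (emit (NConst 1) (sc aBestV))
     (Seq (emit (NConst 0) xT) (NWrite 3 (NConst 0) (sc aCount))))) ?\<tau> (\<lambda>k \<sigma>'. 3 + k \<le> 3 * ?T + 4 \<and> (\<exists>a m b.
     (walk (set es) s a u \<and> distinct a \<and> cost w a = ds u \<and> walk (Det v) u m v \<and> distinct m \<and> cost w m =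
         detour u v \<and>
      walk (set es) v b t \<and> distinct b \<and> cost w b = dt v) \<and> outputs \<sigma>' (a @ tl m @ tl b)))"
  proof (rule run_SeqI[OF run_emit[OF b1, where d = 0 and F = "set es" and xc = s and xs = "[s]" and q =
      q1]], goal_cases)
    case (10 k1 \<sigma>1)
    then obtain a where a: "walk (set es) s a u" "distinct a" "cost w a = ds u" "outl \<sigma>1 ([s] @ tl a)"
      by (auto simp: u_def ds_def)
    have oa: "outl \<sigma>1 a" using a(4) walk_hd[OF a(1)] by auto
    have b2: "base \<sigma>1" using b1 10 base_cong[of \<sigma>1 ?\<tau>] by (auto simp: keeps_def)
    have c1: "nmem \<sigma>1 aCur 0 = u" "nmem \<sigma>1 aBestV 0 = v" using 10 by (auto simp: u_def v_def keeps_def)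
    show ?case
    proof (rule run_SeqI[OF run_emit[OF b2, where d = 1 and F = "Det v" and xc = u and xs = a and q =
        q2]], goal_cases)
      case (10 k2 \<sigma>2)
      then obtain m where m: "walk (Det v) u m v" "distinct m" "cost w m = detour u v" "outl \<sigma>2 (a @ tl m)"
        using c1 by (auto simp: detour_def)
      have b3: "base \<sigma>2" using b2 10 base_cong[of \<sigma>2 \<sigma>1] by (auto simp: keeps_def)
      have c2: "nmem \<sigma>2 aCur 0 = v" "nmem \<sigma>2 0 3 = t" using 10 c1 b3 by (auto simp: base_def inp_def)
      show ?case
      proof (rule run_SeqI[OF run_emit[OF b3, where d = 0 and F = "set es" and xc = v and xs = "a @ tl
          m" and q = q3]], goal_cases)
        case (10 k3 \<sigma>3)
        then obtain b where bb: "walk (set es) v b t" "distinct b" "cost w b = dt v" "outl \<sigma>3 ((a @ tl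
            m) @ tl b)"
          using c2 by (auto simp: dt_def)
        have "outputs (nwrite 3 0 (nmem \<sigma>3 aCount 0) \<sigma>3) (a @ tl m @ tl b)"
          using bb(4) by (auto simp: outputs_def outl_def)
        moreover have kT: "k1 \<le> ?T" "k2 \<le> ?T" "k3 \<le> ?T" using 10 \<open>k1 \<le> _ \<and> _\<close> \<open>k2 \<le> _ \<and> _\<close> by blast+
        have "3 + (k1 + (k2 + (k3 + 1))) \<le> 3 * ?T + 4" by (rule sum3[OF kT])
        ultimately show ?case using a m bb by (simp, blast)
      qed (use c2 t_less un q m(4) in auto)
    qed (use c1 un q oa in auto)
  qed (use un s_less q o1 in \<open>auto simp: u_def\<close>)
  then show ?thesis unfolding write_up_def start_path_def by (simp add: st u_def v_def Let_def)
qed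

end

section \<open>The complete program\<close>

definition solve_connected :: "com \<Rightarrow> com" where
  "solve_connected A = Seq prepare (Seq (shift sh A) (Seq (If (nz (sc aAns)) translate Skip) choose_path))"

text \<open>\<open>find_ds\<close> overwrites \<open>aReach\<close> and \<open>rDist\<close>, so the
  distances to \<open>t\<close>, which \<open>mark_good\<close> reads there, are computed after it.
  In the degenerate cases nothing is written: array 3 is still 0, the encoding of the empty
  list.\<close>

definition solve :: "com \<Rightarrow> com" where
  "solve A = Seq find_ds (Seq (put aTarget xT) (Seq dist_to
     (If (And (nz (NRead aFromS xT)) (neq xS xT)) (solve_connected A) Skip)))"

section \<open>Combining the candidates and bounding the time\<close>

context connected_instance
begin

definition solved :: "state \<Rightarrow> bool" where
  "solved \<sigma> \<longleftrightarrow> (\<exists>p. nspE p \<and> (\<forall>q. nspE q \<longrightarrow> cost w p \<le> cost w q) \<and> outputs \<sigma> p) \<or> (\<forall>p. \<not> nspE p) \<and> outputs \<sigma> []"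

definition tQ :: nat where
  "tQ = (n + length es * n) * (tH + 2) + 3 * (tD + (n * 4 + 1) + 2) + 13"

text \<open>The comparison is strict. If the direct candidate wins, it is below every layered path;
  otherwise the layered path is at most every direct value, as \<open>lay_optimal\<close>
  demands.\<close>

lemma run_finish:
  assumes b: "base \<sigma>" and cd: "cand \<sigma> UNIV" and md: "nmem \<sigma> aMode 0 = 1" and z: "nmem \<sigma> 3 0 = 0"
    and labels: "\<And>i. i < length VL \<Longrightarrow> nmem \<sigma> aLab i = (case VL ! i of Inl x \<Rightarrow> Suc x | Inr _ \<Rightarrow> 0)"
    and ans: "nmem \<sigma> aAns 0 = 0 \<and> (\<forall>P. \<not> layP P) \<or>
    (\<exists>P. layP P \<and> (\<forall>P'. layP P' \<longrightarrow> cost WA P \<le> cost WA P') \<and> nmem \<sigma> aAns 0 = length P \<and>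
      (\<forall>i<length P. nmem \<sigma> aAns (Suc i) < length VL \<and> VL ! nmem \<sigma> aAns (Suc i) = P ! i))"
  shows "run (Seq (If (nz (sc aAns)) translate Skip) choose_path) \<sigma> (\<lambda>k \<sigma>'. k \<le> tQ \<and> solved \<sigma>')"
proof -
  let ?T = "3 * (tD + (n * 4 + 1) + 2) + 4"
  define u v where "u = nmem \<sigma> aBestU 0" and "v = nmem \<sigma> aBestV 0"
  have has: "nmem \<sigma> aHas 0 \<noteq> 0 \<longleftrightarrow> (\<exists>a b. updet a b)"
    and best: "nmem \<sigma> aHas 0 \<noteq> 0 \<Longrightarrow> updet u v \<and> rmem \<sigma> rBest 0 = upval u v \<and> (\<forall>a b. updet a b \<longrightarrow> upval u v
        \<le> upval a b)"
    using cd unfolding cand_def u_def v_def by auto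
  have up: "run write_up \<tau> (\<lambda>k \<sigma>'. k \<le> ?T \<and> solved \<sigma>')"
    if h: "nmem \<sigma> aHas 0 \<noteq> 0" and \<tau>: "base \<tau>" "nmem \<tau> aBestU = nmem \<sigma> aBestU" "nmem \<tau> aBestV = nmem \<sigma> aBestV"
      and lay: "\<And>P. layP P \<Longrightarrow> upval u v \<le> cost WA P" for \<tau>
  proof -
    have U: "updet (nmem \<tau> aBestU 0) (nmem \<tau> aBestV 0)" using best[OF h] \<tau> by (simp add: u_def v_def)
    show ?thesis
    proof (rule run_mono[OF run_write_up[OF \<tau>(1) U]], elim conjE exE, goal_cases)
      case (1 k \<sigma>' a m b)
      then have *: "walk (set es) s a u" "distinct a" "cost w a = ds u" "walk (Det v) u m v" "distinct
          m" "cost w m = detour u v"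
        "walk (set es) v b t" "distinct b" "cost w b = dt v" using \<tau> by (auto simp: Let_def u_def v_def)
      have "updet u v" "\<And>a b. updet a b \<Longrightarrow> upval u v \<le> upval a b" using best[OF h] by auto
      from up_optimal[OF this lay *] show ?case using 1 unfolding solved_def by blast
    qed
  qed
  show ?thesis
  proof (cases "nmem \<sigma> aAns 0 = 0")
    case True
    \<comment> \<open>A walk is never the empty list, so an answer of length 0 can only be the
      report of failure.\<close>
    have nl: "\<not> layP P" for P
      using ans True by (auto simp: layP_def)
    have "run choose_path \<sigma> (\<lambda>k \<sigma>'. 2 + k \<le> tQ \<and> solved \<sigma>')"
    proof (cases "nmem \<sigma> aHas 0 = 0")
      case False
      show ?thesis unfolding choose_path_def using False True
        by (simp, intro run_mono[OF up[OF False b refl refl]]) (use nl in \<open>auto simp: tQ_def\<close>)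
    next
      case h: True
      have "\<not> nspE q" for q using nspE_cases[of q] has h nl by blast
      then have "solved \<sigma>" using z by (simp add: solved_def outputs_def)
      then show ?thesis unfolding choose_path_def using h by (simp add: tQ_def)
    qed
    then show ?thesis using True by simp
  next
    case False
    then obtain P where P: "layP P" "\<forall>P'. layP P' \<longrightarrow> cost WA P \<le> cost WA P'" "nmem \<sigma> aAns 0 = length P"
      "\<forall>i<length P. nmem \<sigma> aAns (Suc i) < length VL \<and> VL ! nmem \<sigma> aAns (Suc i) = P ! i" using ans by
          (elim disjE exE conjE) (simp, blast)
    have lab: "nmem \<sigma> aLab (nmem \<sigma> aAns (Suc i)) = (case P ! i of Inl x \<Rightarrow> Suc x | Inr _ \<Rightarrow> 0)" if i: "i <
        length P" for i
      using P(4) i labels by simp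
    have "length P \<le> n + length es * n"
    proof -
      have "Inl s \<in> VA" using good_s by (auto simp: VA_def Good_def)
      then have "set P \<subseteq> VA" using walk_verts[of EA "Inl s" P "Inl t" VA] P(1) EA_VA by (auto simp: layP_def)
      then have "length P \<le> card VA" using P(1) card_mono[OF finVA] by (metis distinct_card layP_def)
      also have "\<dots> \<le> card Good + card (set es) * card Good" by (rule card_VA)
      also have "\<dots> \<le> n + length es * n" using card_Good_n card_length[of es] by (intro add_mono
          mult_le_mono) auto
      finally show ?thesis .
    qed
    then have lP: "length P * (tH + 2) \<le> (n + length es * n) * (tH + 2)" by (rule mult_le_mono1)
    have "run (Seq translate choose_path) \<sigma> (\<lambda>k \<sigma>'. 1 + k \<le> tQ \<and> solved \<sigma>')"
    proof (rule run_SeqI[OF run_translate[OF P(1) b md P(3) lab]], assumption, goal_cases)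
      case (1 k \<tau>)
      then obtain xs where xs: "outputs \<tau> xs" "walk (set es) s xs t" "cost w xs = cost WA P" "distinct
          (filter good xs)"
        and cP: "rmem \<tau> rCost 0 = cost WA P" and k: "k \<le> length P * (tH + 2) + 7" and kp: "keeps
            translate \<sigma> \<tau>" by auto
      have bt: "base \<tau>" using b kp base_cong[of \<tau> \<sigma>] by (auto simp: keeps_def)
      have same: "nmem \<tau> aHas = nmem \<sigma> aHas" "nmem \<tau> aBestU = nmem \<sigma> aBestU" "nmem \<tau> aBestV = nmem \<sigma> aBestV"
        "rmem \<tau> rBest = rmem \<sigma> rBest" "nmem \<tau> aAns = nmem \<sigma> aAns" using kp by (auto simp: keeps_def)
      have tm: "1 + (k + (1 + l)) \<le> tQ" if "l \<le> ?T" for l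
        using that k lP unfolding tQ_def by linarith
      show ?case
      proof (cases "nmem \<sigma> aHas 0 \<noteq> 0 \<and> upval u v < cost WA P")
        case True
        then have lay: "upval u v \<le> cost WA P'" if "layP P'" for P' using P(2) that by force
        have "run write_up \<tau> (\<lambda>l \<sigma>'. 1 + (k + (1 + l)) \<le> tQ \<and> solved \<sigma>')"
          by (rule run_mono[OF up[OF _ bt same(2,3)]]) (use True lay tm in auto)
        moreover have "rmem \<sigma> rBest 0 = upval u v" using best True by blast
        ultimately show ?thesis unfolding choose_path_def run_If using True False same cP by simp
      next
        case not_up: False
        have "cost WA P \<le> upval a b" if "updet a b" for a b
          using not_up best has that by (metis not_less order_trans)
        then have "solved \<tau>" using lay_optimal[OF P(1) _ _ xs(2-4)] P(2) xs(1) unfolding solved_def by blast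
        moreover have "\<not> (nmem \<sigma> aHas 0 \<noteq> 0 \<and> rmem \<sigma> rBest 0 < cost WA P)" using not_up best by auto
        ultimately show ?thesis unfolding choose_path_def run_If using False same cP tm[of 1] by auto
      qed
    qed
    then show ?thesis using False by simp
  qed
qed

text \<open>\<open>K\<close> must bound the call for every numbering and every edge order, since
  these are known only after \<open>prepare\<close> has run. The array \<open>aP\<close> is exempt
  from being 0 because \<open>find_ds\<close> has used it as a loop counter.\<close>

lemma run_solve_connected:
  assumes A: "\<And>VL L sL tL. distinct VL \<Longrightarrow> set VL = VA \<Longrightarrow> sL < length VL \<Longrightarrow> VL ! sL = Inl s \<Longrightarrow> tL < length VL \<Longrightarrow>
      VL ! tL = Inl t \<Longrightarrow> set L = parcs (GL VL) \<Longrightarrow> distinct L \<Longrightarrow>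
      \<exists>k \<tau>. exec A (input_state (length VL) L (wL VL) sL tL) k \<tau> \<and> correct_output (GL VL) (wL VL) sL tL
          \<tau> \<and> k \<le> K"
    and i: "inp \<sigma>"
    and z: "\<And>a. 11 < a \<Longrightarrow> nmem \<sigma> a = (\<lambda>_. 0) \<or> a = aP" "nmem \<sigma> 3 = (\<lambda>_. 0)" "\<And>a. 3 < a \<Longrightarrow> rmem \<sigma> a = (\<lambda>_. 0)"
    and S: "\<forall>v<n. (nmem \<sigma> aFromS v \<noteq> 0 \<longleftrightarrow> (\<exists>p. walk (set es) s p v)) \<and>
      (nmem \<sigma> aFromS v \<noteq> 0 \<longrightarrow> rmem \<sigma> rDS v = wdist (set es) w s v)"
    and T: "\<forall>v<n. (nmem \<sigma> aReach v \<noteq> 0 \<longleftrightarrow> (\<exists>p. walk (set es) v p t)) \<and>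
      (nmem \<sigma> aReach v \<noteq> 0 \<longrightarrow> rmem \<sigma> rDist v = wdist (set es) w v t)"
  shows "run (solve_connected A) \<sigma> (\<lambda>k \<sigma>'. k \<le> tP + (K + tQ) \<and> solved \<sigma>')"
proof -
  have zz: "nmem \<sigma> a = (\<lambda>_. 0)" if "a \<in> {aGood, aTight, aNV, aLab, aUp, aNE, aTails, aHeads, aHas, sh}" for a
    using that z(1)[of a] by auto
  have prep: "run prepare \<sigma> (\<lambda>k \<sigma>'. k \<le> tP \<and> detinv \<sigma>' UNIV \<and> nmem \<sigma>' aMode 0 = 1 \<and>
    nmem \<sigma>' sh = array_of [nmem \<sigma>' aNV 0, nmem \<sigma>' aNE 0, nmem \<sigma>' aIdx s, nmem \<sigma>' aIdx t])"
    by (rule run_prepare[OF i _ _ _ _ _ _ _ _ _ _ _ S T]) (use zz z(3) in auto)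
  show ?thesis unfolding solve_connected_def
  proof (rule run_SeqI[OF run_keeps[OF prep]], goal_cases)
    case (1 k1 \<sigma>1)
    then have D1: "detinv \<sigma>1 UNIV" and md1: "nmem \<sigma>1 aMode 0 = 1" and k1: "k1 \<le> tP" and kp: "keeps
        prepare \<sigma> \<sigma>1"
      and sh1: "nmem \<sigma>1 sh = array_of [nmem \<sigma>1 aNV 0, nmem \<sigma>1 aNE 0, nmem \<sigma>1 aIdx s, nmem \<sigma>1 aIdx t]" by auto
    obtain VL EL where R: "rep \<sigma>1 VL EL" "set VL = VA" "set EL = FA \<union> (BA \<inter> {(Inl a, Inl b) |a b. (a, b)
        \<in> UNIV})"
      using D1 unfolding detinv_def by blast
    have sE: "set EL = EA" using R(3) unfolding EA_def BA_def by blast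
    have dV: "distinct VL" using R(1) by (simp add: rep_def)
    have sL: "nmem \<sigma>1 aIdx s < length VL" "VL ! nmem \<sigma>1 aIdx s = Inl s" "nmem \<sigma>1 aIdx t < length VL" "VL
        ! nmem \<sigma>1 aIdx t = Inl t"
      using R(1) good_s good_t by (auto simp: rep_def)
    have vw: "view sh \<sigma>1 = input_state (length VL) (edge_list \<sigma>1 (length EL)) (wL VL) (nmem \<sigma>1 aIdx s)
        (nmem \<sigma>1 aIdx t)"
    proof (rule view_input[OF R(1) sh1])
      fix a :: nat assume "42 < a"
      then show "nmem \<sigma>1 a = (\<lambda>_. 0)" using kp z(1)[of a] by (auto simp: keeps_def)
    next
      fix a :: nat assume "40 < a"
      then show "rmem \<sigma>1 a = (\<lambda>_. 0)" using kp z(3)[of a] by (auto simp: keeps_def)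
    qed
    obtain kA \<tau>0 where A0: "exec A (view sh \<sigma>1) kA \<tau>0" "correct_output (GL VL) (wL VL) (nmem \<sigma>1 aIdx s)
        (nmem \<sigma>1 aIdx t) \<tau>0" "kA \<le> K"
      using A[OF dV R(2) sL edge_list_correct[OF R(1) sE]] unfolding vw by blast
    obtain \<sigma>2 where e2: "exec (shift sh A) \<sigma>1 kA \<sigma>2" and v2: "view sh \<sigma>2 = \<tau>0" using exec_shift[OF A0(1)
        refl] by blast
    have kp2: "nmem \<sigma>2 a = nmem \<sigma>1 a" "rmem \<sigma>2 a = rmem \<sigma>1 a" if "a < 40" for a
      using exec_keeps[OF e2] mods_shift[OF that] unfolding keeps_def by blast+
    have b1: "base \<sigma>1" "cand \<sigma>1 UNIV" using D1 by (auto simp: detinv_def)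
    have b2: "base \<sigma>2" "cand \<sigma>2 UNIV" "nmem \<sigma>2 aMode 0 = 1"
      using b1 md1 kp2 base_cong[of \<sigma>2 \<sigma>1] by (auto simp: cand_def)
    have z2: "nmem \<sigma>2 3 0 = 0" using kp2 kp z(2) by (simp add: keeps_def)
    have lab: "nmem \<sigma>2 aLab i = (case VL ! i of Inl x \<Rightarrow> Suc x | Inr _ \<Rightarrow> 0)" if "i < length VL" for i
      using R(1) kp2 that by (simp add: rep_def)
    have ans: "nmem \<tau>0 3 = nmem \<sigma>2 aAns" unfolding v2[symmetric] view_def by simp
    have "run (Seq (If (nz (sc aAns)) translate Skip) choose_path) \<sigma>2 (\<lambda>k \<sigma>'. k \<le> tQ \<and> solved \<sigma>')"
      by (rule run_finish[OF b2 z2 lab]) (use GL_output[OF dV R(2) sL A0(2)] in \<open>auto simp: ans\<close>)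
    then have "run (Seq (If (nz (sc aAns)) translate Skip) choose_path) \<sigma>2 (\<lambda>k \<sigma>'. k1 + (kA + k) \<le> tP +
        (K + tQ) \<and> solved \<sigma>')"
      by (rule run_mono) (use k1 A0(3) in auto)
    then show ?case unfolding run_Seq[of "shift sh A"] unfolding run_def[of "shift sh A"] using e2 by blast
  qed
qed

lemma solved_correct:
  assumes "st_digraph G w s t" "parcs G = set es" "solved \<sigma>"
  shows "correct_output G w s t \<sigma>"
proof -
  interpret g: st_digraph G w s t by (rule assms(1))
  have eq: "g.nsp p \<longleftrightarrow> nspE p" for p unfolding g.nsp_def nspE_def ds_def assms(2) ..
  from assms(3) show ?thesis unfolding solved_def
  proof (elim disjE exE conjE)
    fix p assume p: "nspE p" "\<forall>q. nspE q \<longrightarrow> cost w p \<le> cost w q" "outputs \<sigma> p"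
    obtain a where "g.next_to_shortest a" "pawalk_verts s a = p"
      using g.next_to_shortestI[of p] p eq by blast
    then show ?thesis using p(3) unfolding correct_output_def by auto
  next
    assume "\<forall>p. \<not> nspE p" "outputs \<sigma> []"
    then show ?thesis using g.next_to_shortestD(1) eq unfolding correct_output_def by auto
  qed
qed

end

context instance_data
begin

text \<open>With \<open>x = n * (m + 1)\<close> every monomial that occurs is at most
  \<open>x * x\<close>, and the coefficients add up to far less than 1000.\<close>

lemma time_bound:
  assumes "connected_instance n es w s t"
  shows "(n * (tD + 3 + 2) + 2) + (1 + (tD + (1 + (connected_instance.tP n es + connected_instance.tQ n es))))
    \<le> 1000 * ((n * (length es + 1)) * (n * (length es + 1)))"
proof -
  interpret c: connected_instance n es w s t by (rule assms)
  define m x where "m = length es" and "x = n * (m + 1)"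
  have n1: "1 \<le> n" using n_pos by (simp add: One_nat_def Suc_le_eq)
  have x: "tD = 20 * x" "n + m * n = x" by (auto simp: tD_def x_def m_def)
  have mn: "1 * m \<le> n * m" by (rule mult_le_mono1[OF n1])
  have x1: "n \<le> x" unfolding x(2)[symmetric] by simp
  have xx: "1 * x \<le> x * x" "n * x \<le> x * x" "n * n \<le> n * x"
    by (rule mult_le_mono1 mult_le_mono2, use n1 x1 in linarith)+
  have tP: "c.tP = 13 * (n * n) + 20 * (n * x) + 8 * (n * m) + 21 * n + 14 * m + 17"
    unfolding c.tP_def x(1) m_def[symmetric] by (simp add: algebra_simps)
  have tQ: "c.tQ = 20 * (x * x) + 4 * (n * x) + 70 * x + 12 * n + 22"
    unfolding c.tQ_def c.tH_def x m_def[symmetric] by (simp add: algebra_simps)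
  have fd: "n * (tD + 3 + 2) = 20 * (n * x) + 5 * n" unfolding x(1) by (simp add: algebra_simps)
  \<comment> \<open>Products are replaced by variables and related by inequalities, so that linear
    arithmetic decides the estimate.\<close>
  have lin: "20 * p + 5 * n + 2 + (1 + (20 * x + (1 + ((13 * nn + 20 * p + 8 * mn + 21 * n + 14 * m + 17) +
      (20 * y + 4 * p + 70 * x + 12 * n + 22))))) \<le> 1000 * y"
    if "1 \<le> n" "n \<le> x" "m \<le> mn" "n + mn = x" "x \<le> y" "p \<le> y" "nn \<le> p" for n m x p y nn mn :: nat
    using that by linarith
  show ?thesis unfolding tP tQ fd unfolding x(1) m_def[symmetric] x_def[symmetric]
    by (rule lin) (use n1 x1 mn xx x(2) in \<open>simp_all add: mult.commute\<close>)
qed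

text \<open>For \<open>s = t\<close> the only path is the trivial one, which costs 0 and is
  therefore shortest.\<close>

lemma no_nsp:
  assumes "st_digraph G w s t" "parcs G = set es" "\<not> (\<exists>p. walk (set es) s p t) \<or> s = t"
  shows "\<not> st_digraph.next_to_shortest G w s t a"
proof
  interpret g: st_digraph G w s t by (rule assms(1))
  assume "g.next_to_shortest a"
  then have n: "g.nsp (pawalk_verts s a)" by (rule g.next_to_shortestD(1))
  let ?p = "pawalk_verts s a"
  have p: "walk (set es) s ?p t" "distinct ?p" "wdist (set es) w s t < cost w ?p"
    using n unfolding g.nsp_def assms(2) by auto
  then have "s = t" using assms(3) by blast
  then have "?p = [s]" using p(1,2) by (cases ?p) (auto simp: walk_def split: if_splits)
  then show False using p(3) wdist_refl[of "set es" w s] es_pos \<open>s = t\<close> by simp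
qed

lemma run_solve:
  assumes G: "st_digraph G w s t" "parcs G = set es"
    and A: "\<And>VL L sL tL. connected_instance n es w s t \<Longrightarrow>
      distinct VL \<Longrightarrow> set VL = reduction.VA (set es) w s t \<Longrightarrow> sL < length VL \<Longrightarrow> VL ! sL = Inl s \<Longrightarrow> tL < length VL \<Longrightarrow>
      VL ! tL = Inl t \<Longrightarrow> set L = parcs (connected_instance.GL es w s t VL) \<Longrightarrow> distinct L \<Longrightarrow>
      \<exists>k \<tau>. exec A (input_state (length VL) L (connected_instance.wL es w s t VL) sL tL) k \<tau> \<and>
        correct_output (connected_instance.GL es w s t VL) (connected_instance.wL es w s t VL) sL tL \<tau> \<and>
            k \<le> K"
  shows "run (solve A) (input_state n es w s t) (\<lambda>k \<sigma>'.
    k \<le> 1000 * ((n * (length es + 1)) * (n * (length es + 1))) + K \<and> correct_output G w s t \<sigma>')"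
proof -
  let ?\<sigma> = "input_state n es w s t"
  have i: "inp ?\<sigma>" by (auto simp: inp_def input_state_def array_of_def numeral_eq_Suc One_nat_def)
  have z0: "nmem ?\<sigma> a = (\<lambda>_. 0)" if "2 < a" for a using that by (simp add: input_state_def)
  have r0: "rmem ?\<sigma> a = (\<lambda>_. 0)" if "0 < a" for a using that by (simp add: input_state_def)
  let ?X = "(n * (length es + 1)) * (n * (length es + 1))"
  have ds: "run find_ds ?\<sigma> (\<lambda>k \<sigma>'. k \<le> n * (tD + 3 + 2) + 2 \<and>
    (\<forall>v<n. (nmem \<sigma>' aFromS v \<noteq> 0 \<longleftrightarrow> (\<exists>p. walk (set es) s p v)) \<and>
      (nmem \<sigma>' aFromS v \<noteq> 0 \<longrightarrow> rmem \<sigma>' rDS v = wdist (set es) w s v)) \<and> keeps find_ds ?\<sigma> \<sigma>')"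
    by (rule run_find_ds[OF i]) (simp_all add: z0)
  show ?thesis unfolding solve_def
  proof (rule run_SeqI[OF ds], goal_cases)
    case (1 k1 \<sigma>1)
    have k1: "k1 \<le> n * (tD + 3 + 2) + 2" and kp1: "keeps find_ds ?\<sigma> \<sigma>1"
      and S1: "\<forall>v<n. (nmem \<sigma>1 aFromS v \<noteq> 0 \<longleftrightarrow> (\<exists>p. walk (set es) s p v)) \<and>
      (nmem \<sigma>1 aFromS v \<noteq> 0 \<longrightarrow> rmem \<sigma>1 rDS v = wdist (set es) w s v)" using 1 by auto
    let ?\<tau> = "nwrite aTarget 0 t \<sigma>1"
    have i1: "inp ?\<tau>" using i kp1 inp_cong[of ?\<tau> ?\<sigma>] by (simp add: keeps_def)
    have t1: "nmem \<sigma>1 0 3 = t" using i1 by (simp add: inp_def)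
    have u1: "usable ?\<tau> = set es" by (rule usable_all) (use kp1 z0 in \<open>auto simp: keeps_def\<close>)
    have dt: "run dist_to ?\<tau> (\<lambda>l \<tau>'. l \<le> tD \<and>
      dist_spec (set es) t (nmem \<tau>' aReach) (rmem \<tau>' rDist) (nmem \<tau>' aNext) \<and> keeps dist_to ?\<tau> \<tau>')"
      using run_dist_to[OF i1] u1 t_less by simp
    have "run (Seq dist_to (If (And (nz (NRead aFromS xT)) (neq xS xT)) (solve_connected A) Skip)) ?\<tau>
      (\<lambda>k \<sigma>'. k1 + (1 + k) \<le> 1000 * ?X + K \<and> correct_output G w s t \<sigma>')"
    proof (rule run_SeqI[OF dt], goal_cases)
      case (1 k2 \<sigma>2)
      have k2: "k2 \<le> tD" and kp2: "keeps dist_to ?\<tau> \<sigma>2"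
        and sp: "dist_spec (set es) t (nmem \<sigma>2 aReach) (rmem \<sigma>2 rDist) (nmem \<sigma>2 aNext)" using 1 by auto
      have i2: "inp \<sigma>2" using i1 kp2 inp_cong[of \<sigma>2 ?\<tau>] by (simp add: keeps_def)
      have S2: "\<forall>v<n. (nmem \<sigma>2 aFromS v \<noteq> 0 \<longleftrightarrow> (\<exists>p. walk (set es) s p v)) \<and>
        (nmem \<sigma>2 aFromS v \<noteq> 0 \<longrightarrow> rmem \<sigma>2 rDS v = wdist (set es) w s v)" using S1 kp2 by (simp add: keeps_def)
      have T2: "\<forall>v<n. (nmem \<sigma>2 aReach v \<noteq> 0 \<longleftrightarrow> (\<exists>p. walk (set es) v p t)) \<and>
        (nmem \<sigma>2 aReach v \<noteq> 0 \<longrightarrow> rmem \<sigma>2 rDist v = wdist (set es) w v t)" using sp unfolding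
            dist_spec_def by blast
      have st: "nmem \<sigma>2 0 2 = s" "nmem \<sigma>2 0 3 = t" using i2 by (auto simp: inp_def)
      have z2: "nmem \<sigma>2 3 = (\<lambda>_. 0)" using kp1 kp2 z0 by (simp add: keeps_def)
      show ?case
      proof (cases "(\<exists>p. walk (set es) s p t) \<and> s \<noteq> t")
        case False
        then have "\<not> (nmem \<sigma>2 aFromS t \<noteq> 0 \<and> s \<noteq> t)" using S2 t_less by blast
        moreover have "correct_output G w s t \<sigma>2"
          using no_nsp[OF G] False z2 unfolding correct_output_def by (auto simp: outputs_def)
        moreover have "k1 + (1 + (k2 + 2)) \<le> 1000 * ?X + K"
        proof -
          define x where "x = n * (length es + 1)"
          have x1: "1 \<le> x" "n \<le> x" using n_pos by (auto simp: x_def One_nat_def Suc_le_eq)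
          have xx: "1 * x \<le> x * x" "n * x \<le> x * x" by (rule mult_le_mono1, fact)+
          have tx: "tD = 20 * x" by (simp add: tD_def x_def)
          have fd: "n * (tD + 3 + 2) = 20 * (n * x) + 5 * n" unfolding tx by (simp add: algebra_simps)
          have lin: "k1 + (1 + (k2 + 2)) \<le> 1000 * y + K" if "k1 \<le> 20 * p + 5 * n + 2" "k2 \<le> 20 * x" "1 \<le>
              x" "n \<le> x"
            "x \<le> y" "p \<le> y" for k1 k2 p n x y K :: nat using that by linarith
          show ?thesis unfolding x_def[symmetric]
            by (rule lin[OF k1[unfolded fd] k2[unfolded tx] x1]) (use xx in simp_all)
        qed
        ultimately show ?thesis using st by auto
      next
        case True
        have ci: "connected_instance n es w s t"
          by (intro connected_instance.intro instance_data_axioms connected_instance_axioms.intro) (use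
              True in auto)
        interpret c: connected_instance n es w s t by (rule ci)
        have "run (solve_connected A) \<sigma>2 (\<lambda>k \<sigma>'. k \<le> c.tP + (K + c.tQ) \<and> c.solved \<sigma>')"
        proof (rule c.run_solve_connected[OF A[OF ci] i2 _ z2 _ S2 T2], assumption+)
          fix a :: nat assume "11 < a"
          then show "nmem \<sigma>2 a = (\<lambda>_. 0) \<or> a = aP" using kp1 kp2 z0[of a] by (auto simp: keeps_def)
        next
          fix a :: nat assume "3 < a"
          then show "rmem \<sigma>2 a = (\<lambda>_. 0)" using kp1 kp2 r0[of a] by (auto simp: keeps_def)
        qed
        then have "run (solve_connected A) \<sigma>2 (\<lambda>k \<sigma>'. k1 + (1 + (k2 + (1 + k))) \<le> 1000 * ?X + K \<and>
            correct_output G w s t \<sigma>')"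
          by (rule run_mono) (use k1 k2 time_bound[OF ci] c.solved_correct[OF G] in auto)
        moreover have "nmem \<sigma>2 aFromS t \<noteq> 0" using S2 True t_less by blast
        ultimately show ?thesis using True st by simp
      qed
    qed
    then show ?case by (subst run_Seq, subst run_NWrite) (simp only: nval.simps t1)
  qed
qed

end

theorem theorem4p1:
  assumes "\<exists>A. solves_in_time_O A st_digraph.layered layered_time"
  shows "\<exists>A. solves_in_time_O A (\<lambda>G w s t. True) general_time"
proof -
  obtain A c where A: "\<And>G w s t n es. st_digraph G w s t \<Longrightarrow> st_digraph.layered G w s t \<Longrightarrow> pverts G = {..<n} \<Longrightarrow>
      set es = parcs G \<Longrightarrow> distinct es \<Longrightarrow>
      \<exists>k \<sigma>. exec A (input_state n es w s t) k \<sigma> \<and> correct_output G w s t \<sigma> \<and> real k \<le> c * layered_time G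
          w s t"
    using assms unfolding solves_in_time_O_def by blast
  have "\<exists>k \<sigma>. exec (solve A) (input_state n es w s t) k \<sigma> \<and> correct_output G w s t \<sigma> \<and>
      real k \<le> (4000 + 11 * max 0 c) * general_time G w s t"
    if G: "st_digraph G w s t" and V: "pverts G = {..<n}" and es: "set es = parcs G" "distinct es"
    for G :: "nat pair_pre_digraph" and w s t n es
  proof -
    interpret g: st_digraph G w s t by (rule G)
    interpret instance_data n es w s t
    proof
      show "set es \<subseteq> {..<n} \<times> {..<n}" using g.in_arcsD1 g.in_arcsD2 unfolding es V[symmetric] by auto
      show "(x, x) \<notin> set es" for x using g.pair_no_loops[of "(x, x)"] unfolding es by auto
    qed (use es V g.weight_pos g.source_in_verts g.target_in_verts in auto)
    define M gen where "M = max 1 (real (length es))" and "gen = real n ^ 4 * M ^ 3 * max 1 (log 2 (real n))"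
    have gen: "general_time G w s t = gen"
      using V es distinct_card[of es] by (simp add: general_time_def gen_def M_def)
    \<comment> \<open>Step counts are naturals, hence the rounding down. \<open>max 0 c\<close> is
      used because nothing forces the constant to be nonnegative, and a negative one would reverse
      the estimate of \<open>layered_time\<close>.\<close>
    define K where "K = nat \<lfloor>max 0 c * (11 * gen)\<rfloor>"
    have M1: "1 \<le> M" by (simp add: M_def)
    have n1: "1 \<le> real n" using n_pos by simp
    have gen_ge: "real n ^ 4 * M ^ 3 \<le> gen" unfolding gen_def
      using mult_left_mono[of 1 "max 1 (log 2 (real n))" "real n ^ 4 * M ^ 3"] M1 by simp
    have gen0: "0 \<le> gen" using gen_ge M1 n1 by (meson mult_nonneg_nonneg order_trans zero_le_one
        zero_le_power)
    have "run (solve A) (input_state n es w s t) (\<lambda>k \<sigma>'.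
      k \<le> 1000 * ((n * (length es + 1)) * (n * (length es + 1))) + K \<and> correct_output G w s t \<sigma>')"
    proof (rule run_solve[OF G es(1)[symmetric]], goal_cases)
      case (1 VL L sL tL)
      interpret c: connected_instance n es w s t by (rule 1(1))
      note h = 1(2-7)
      obtain k \<tau> where k: "exec A (input_state (length VL) L (c.wL VL) sL tL) k \<tau>"
        "correct_output (c.GL VL) (c.wL VL) sL tL \<tau>" "real k \<le> c * layered_time (c.GL VL) (c.wL VL) sL tL"
        using A[OF c.GL_st_digraph[OF h] c.GL_layered[OF h] _ 1(8,9), of "length VL"] by (auto simp: c.GL_def)
      have lt: "layered_time (c.GL VL) (c.wL VL) sL tL \<le> 11 * gen"
        using c.layered_time_bound[OF h] by (simp add: gen_def M_def)
      have "0 \<le> layered_time (c.GL VL) (c.wL VL) sL tL" unfolding layered_time_def by (intro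
          mult_nonneg_nonneg) auto
      then have "c * layered_time (c.GL VL) (c.wL VL) sL tL \<le> max 0 c * (11 * gen)"
        using lt by (intro mult_mono) auto
      then have "k \<le> K" unfolding K_def using k(3) by (intro le_nat_floor) linarith
      then show ?case using k by blast
    qed
    then obtain k \<sigma>' where k: "exec (solve A) (input_state n es w s t) k \<sigma>'" "correct_output G w s t \<sigma>'"
      "k \<le> 1000 * ((n * (length es + 1)) * (n * (length es + 1))) + K" unfolding run_def by blast
    have "real K \<le> max 0 c * (11 * gen)" unfolding K_def using gen0 by simp
    \<comment> \<open>From \<open>length es + 1 \<le> 2 * M\<close> the square is at most
      \<open>4 * n^2 * M^2\<close>, and \<open>n\<close> and \<open>M\<close> are at least 1. So the
      work around the call stays below the claimed bound.\<close>
    moreover have "real (n * (length es + 1)) * real (n * (length es + 1)) \<le> 4 * gen"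
    proof -
      have x: "real (n * (length es + 1)) \<le> 2 * (real n * M)"
      proof -
        have "real (length es) + 1 \<le> 2 * M" by (simp add: M_def)
        from mult_left_mono[OF this, of "real n"] show ?thesis by (simp add: algebra_simps)
      qed
      have "real (n * (length es + 1)) * real (n * (length es + 1)) \<le> (2 * (real n * M)) * (2 * (real n * M))"
        using x M1 by (intro mult_mono) auto
      also have "\<dots> = 4 * (real n ^ 2 * M ^ 2)" by (simp add: power2_eq_square)
      also have "real n ^ 2 * M ^ 2 \<le> real n ^ 4 * M ^ 3"
        using n1 M1 by (intro mult_mono power_increasing) auto
      also note gen_ge
      finally show ?thesis by simp
    qed
    moreover have "real k \<le> 1000 * (real (n * (length es + 1)) * real (n * (length es + 1))) + real K"
      using of_nat_mono[OF k(3), where 'a = real] by simp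
    \<comment> \<open>The constant is 1000 times 4 for the work around the call, plus 11 times that
      of the assumed algorithm.\<close>
    ultimately have "real k \<le> 4000 * gen + max 0 c * (11 * gen)" by linarith
    also have "\<dots> = (4000 + 11 * max 0 c) * general_time G w s t" unfolding gen by (simp add: algebra_simps)
    finally show ?thesis using k(1,2) by blast
  qed
  then have "solves_in_time_O (solve A) (\<lambda>G w s t. True) general_time"
    unfolding solves_in_time_O_def by blast
  then show ?thesis ..
qed

end
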